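(* Let $M$ be a complete Riemannian manifold, $U\subset M$, and let $A$ be an arbitrary set. Let $F:M\times A\to[0,+\infty]$ be a function such that for every $\alpha\in A$ the function $F_\alpha:M\to[0,+\infty]$, $F_\alpha(x)=F(x,\alpha)$, is lower semicontinuous and proper (not everywhere $+\infty$). For $\alpha\in A$ put $\phi(\alpha)=\{x\in U: F(x,\alpha)=0\}$. Let $V\subset M$ and $\delta>0$. Assume that $$\alpha\in A,\ x\in V,\ F(x,\alpha)>0,\ \zeta\in\partial_PF_\alpha(x)\ \Longrightarrow\ \|\zeta\|\ge\delta.$$ Then for every $x\in M$ and $\alpha\in A$ we have $$\min\{d(x,V^c),\,d(x,U^c),\,d(x,\phi(\alpha))\}\le\frac{F(x,\alpha)}{\delta}.$$
   Context: Riemannian manifolds are modelled on a real Hilbert space (finite or infinite dimensional); $d$ is the Riemannian distance, $d(x,S)=\inf_{s\in S}d(x,s)$ with $d(x,\emptyset)=+\infty$, and $S^c=M\setminus S$. Proximal subdifferential: for a lower semicontinuous $g:X\to(-\infty,+\infty]$ on a Hilbert space $X$ and $x$ with $g(x)<+\infty$, $\zeta\in\partial_Pg(x)$ iff there are $\sigma,\eta>0$ with $g(y)\ge g(x)+\langle\zeta,y-x\rangle-\sigma\|y-x\|^2$ for all $y\in B(x,\eta)$. For lower semicontinuous $g:M\to(-\infty,+\infty]$ on a Riemannian manifold, $\partial_Pg(p):=\partial_P(g\circ\exp_p)(0)\subset TM_p$ (empty if $g(p)=+\infty$). *)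

theory Defs
  imports "HOL-Analysis.Analysis"
begin

section \<open>Smooth maps between normed spaces\<close>

text \<open>
  \<open>f\<close> is \<open>C\<^sup>\<infinity>\<close> on the (open) set \<open>S\<close> in the sense of iterated Frechet derivatives.
  The witness \<open>D x [v\<^sub>1, \<dots>, v\<^sub>k]\<close> is the value of the \<open>k\<close>-th derivative of \<open>f\<close> at \<open>x\<close>
  on \<open>v\<^sub>1, \<dots>, v\<^sub>k\<close>: a bounded \<open>k\<close>-linear map whose Frechet derivative, with respect to
  the operator norm on \<open>k\<close>-linear maps, is the \<open>(k+1)\<close>-st derivative.  Lists are used
  because the type of the \<open>k\<close>-th derivative as a nested bounded linear map depends on \<open>k\<close>.
\<close>

definition smooth_on ::
  "'a::real_normed_vector set \<Rightarrow> ('a \<Rightarrow> 'b::real_normed_vector) \<Rightarrow> bool" where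
  "smooth_on S f \<longleftrightarrow>
     (\<exists>D :: 'a \<Rightarrow> 'a list \<Rightarrow> 'b. \<forall>x\<in>S.
        D x [] = f x \<and>
        (\<forall>us ws. linear (\<lambda>v. D x (us @ v # ws))) \<and>
        (\<forall>k. \<exists>C. \<forall>vs. length vs = k \<longrightarrow> norm (D x vs) \<le> C * prod_list (map norm vs)) \<and>
        (\<forall>k. \<forall>e>0. \<exists>d>0. \<forall>y\<in>S. norm (y - x) < d \<longrightarrow>
           (\<forall>vs. length vs = k \<longrightarrow>
              norm (D y vs - D x vs - D x ((y - x) # vs))
                \<le> e * norm (y - x) * prod_list (map norm vs))))"


section \<open>Riemannian manifolds modelled on a Hilbert space\<close>

text \<open>
  The underlying set of the manifold is the whole type \<open>'m\<close>; the model space \<open>'h\<close> is a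
  complete real inner product space of arbitrary dimension.
\<close>

datatype ('m, 'h) chart = Chart (chart_dom: "'m set") (coord: "'m \<Rightarrow> 'h")

definition chart_ran :: "('m, 'h) chart \<Rightarrow> 'h set" where
  "chart_ran c = coord c ` chart_dom c"

definition chart_inv :: "('m, 'h) chart \<Rightarrow> 'h \<Rightarrow> 'm" where
  "chart_inv c = inv_into (chart_dom c) (coord c)"

definition transition :: "('m, 'h) chart \<Rightarrow> ('m, 'h) chart \<Rightarrow> 'h \<Rightarrow> 'h" where
  "transition c c' = coord c' \<circ> chart_inv c"

locale hilbert_manifold =
  fixes \<A> :: "('m::t2_space, 'h::{real_inner, banach}) chart set"
  assumes charts_cover: "(\<Union>c\<in>\<A>. chart_dom c) = UNIV"
    and open_chart_dom: "c \<in> \<A> \<Longrightarrow> open (chart_dom c)"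
    and open_chart_ran: "c \<in> \<A> \<Longrightarrow> open (chart_ran c)"
    and chart_homeomorphism:
      "c \<in> \<A> \<Longrightarrow> homeomorphism (chart_dom c) (chart_ran c) (coord c) (chart_inv c)"
    and smooth_transition:
      "c \<in> \<A> \<Longrightarrow> c' \<in> \<A> \<Longrightarrow>
        smooth_on (coord c ` (chart_dom c \<inter> chart_dom c')) (transition c c')"

text \<open>
  \<open>G c x\<close> is the Gram form of the metric in the chart \<open>c\<close> at the coordinate point \<open>x\<close>.
  It is bounded by its type; together with \<open>metric_coercive\<close> this says that the norm
  which it induces on each tangent space is equivalent to the norm of the model space.
  \<open>metric_transform\<close> is the transformation law of a covariant 2-tensor.
\<close>

locale riemannian_manifold = hilbert_manifold \<A>
  for \<A> :: "('m::t2_space, 'h::{real_inner, banach}) chart set" +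
  fixes G :: "('m, 'h) chart \<Rightarrow> 'h \<Rightarrow> 'h \<Rightarrow>\<^sub>L ('h \<Rightarrow>\<^sub>L real)"
  assumes metric_sym:
      "c \<in> \<A> \<Longrightarrow> x \<in> chart_ran c \<Longrightarrow> G c x u v = G c x v u"
    and metric_coercive:
      "c \<in> \<A> \<Longrightarrow> x \<in> chart_ran c \<Longrightarrow> \<exists>m>0. \<forall>u. m * (norm u)\<^sup>2 \<le> G c x u u"
    and smooth_metric:
      "c \<in> \<A> \<Longrightarrow> smooth_on (chart_ran c) (G c)"
    and metric_transform:
      "c \<in> \<A> \<Longrightarrow> c' \<in> \<A> \<Longrightarrow> p \<in> chart_dom c \<Longrightarrow> p \<in> chart_dom c' \<Longrightarrow>
        T = frechet_derivative (transition c c') (at (coord c p)) \<Longrightarrow>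
        G c' (coord c' p) (T u) (T v) = G c (coord c p) u v"

text \<open>
  The tangent space at \<open>p\<close> is identified with \<open>'h\<close> through the coordinates of one fixed
  chart around \<open>p\<close>.  By \<open>metric_transform\<close> another choice of the chart gives an
  isometric identification.
\<close>

definition chart_at :: "('m, 'h) chart set \<Rightarrow> 'm \<Rightarrow> ('m, 'h) chart" where
  "chart_at \<A> p = (SOME c. c \<in> \<A> \<and> p \<in> chart_dom c)"

definition tangent_inner ::
  "('m, 'h::real_normed_vector) chart set \<Rightarrow> (('m, 'h) chart \<Rightarrow> 'h \<Rightarrow> 'h \<Rightarrow>\<^sub>L ('h \<Rightarrow>\<^sub>L real)) \<Rightarrow>
   'm \<Rightarrow> 'h \<Rightarrow> 'h \<Rightarrow> real" where
  "tangent_inner \<A> G p u v = G (chart_at \<A> p) (coord (chart_at \<A> p) p) u v"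

definition tangent_norm ::
  "('m, 'h::real_normed_vector) chart set \<Rightarrow> (('m, 'h) chart \<Rightarrow> 'h \<Rightarrow> 'h \<Rightarrow>\<^sub>L ('h \<Rightarrow>\<^sub>L real)) \<Rightarrow>
   'm \<Rightarrow> 'h \<Rightarrow> real" where
  "tangent_norm \<A> G p u = sqrt (tangent_inner \<A> G p u u)"


section \<open>Riemannian distance\<close>

definition C1_curve ::
  "('m::topological_space, 'h::real_normed_vector) chart set \<Rightarrow> real \<Rightarrow> real \<Rightarrow> (real \<Rightarrow> 'm) \<Rightarrow> bool"
  where
  "C1_curve \<A> a b \<gamma> \<longleftrightarrow>
     continuous_on {a..b} \<gamma> \<and>
     (\<forall>c\<in>\<A>. let J = {t\<in>{a..b}. \<gamma> t \<in> chart_dom c} in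
        \<exists>x'. continuous_on J x' \<and>
          (\<forall>t\<in>J. ((coord c \<circ> \<gamma>) has_vector_derivative x' t) (at t within J)))"

definition piecewise_C1_curve ::
  "('m::topological_space, 'h::real_normed_vector) chart set \<Rightarrow> real \<Rightarrow> real \<Rightarrow> (real \<Rightarrow> 'm) \<Rightarrow> bool"
  where
  "piecewise_C1_curve \<A> a b \<gamma> \<longleftrightarrow>
     (\<exists>(n::nat) (s::nat \<Rightarrow> real). s 0 = a \<and> s n = b \<and>
        (\<forall>i<n. s i < s (Suc i) \<and> C1_curve \<A> (s i) (s (Suc i)) \<gamma>))"

definition curve_velocity ::
  "('m, 'h::real_normed_vector) chart set \<Rightarrow> (real \<Rightarrow> 'm) \<Rightarrow> real \<Rightarrow> 'h" where
  "curve_velocity \<A> \<gamma> t = vector_derivative (coord (chart_at \<A> (\<gamma> t)) \<circ> \<gamma>) (at t)"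

text \<open>
  At the finitely many corners of a piecewise \<open>C\<^sup>1\<close> curve, and at the end points, the value of
  \<open>curve_velocity\<close> may be meaningless; this does not affect the integral.
\<close>

definition curve_length ::
  "('m, 'h::real_normed_vector) chart set \<Rightarrow> (('m, 'h) chart \<Rightarrow> 'h \<Rightarrow> 'h \<Rightarrow>\<^sub>L ('h \<Rightarrow>\<^sub>L real)) \<Rightarrow>
   real \<Rightarrow> real \<Rightarrow> (real \<Rightarrow> 'm) \<Rightarrow> ennreal" where
  "curve_length \<A> G a b \<gamma> =
     (\<integral>\<^sup>+ t. ennreal (tangent_norm \<A> G (\<gamma> t) (curve_velocity \<A> \<gamma> t)) * indicator {a..b} t \<partial>lborel)"

text \<open>
  The manifold is not required to be connected: the distance between points in
  different components is \<open>\<infinity>\<close>.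
\<close>

definition riem_dist ::
  "('m::topological_space, 'h::real_normed_vector) chart set \<Rightarrow>
   (('m, 'h) chart \<Rightarrow> 'h \<Rightarrow> 'h \<Rightarrow>\<^sub>L ('h \<Rightarrow>\<^sub>L real)) \<Rightarrow> 'm \<Rightarrow> 'm \<Rightarrow> ennreal" where
  "riem_dist \<A> G p q =
     (INF \<gamma> \<in> {\<gamma>. piecewise_C1_curve \<A> 0 1 \<gamma> \<and> \<gamma> 0 = p \<and> \<gamma> 1 = q}. curve_length \<A> G 0 1 \<gamma>)"

definition riem_dist_set ::
  "('m::topological_space, 'h::real_normed_vector) chart set \<Rightarrow>
   (('m, 'h) chart \<Rightarrow> 'h \<Rightarrow> 'h \<Rightarrow>\<^sub>L ('h \<Rightarrow>\<^sub>L real)) \<Rightarrow> 'm \<Rightarrow> 'm set \<Rightarrow> ennreal" where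
  "riem_dist_set \<A> G p S = (INF s\<in>S. riem_dist \<A> G p s)"

definition riem_complete ::
  "('m::topological_space, 'h::real_normed_vector) chart set \<Rightarrow>
   (('m, 'h) chart \<Rightarrow> 'h \<Rightarrow> 'h \<Rightarrow>\<^sub>L ('h \<Rightarrow>\<^sub>L real)) \<Rightarrow> bool" where
  "riem_complete \<A> G \<longleftrightarrow>
     (\<forall>X :: nat \<Rightarrow> 'm.
        (\<forall>e>0. \<exists>N. \<forall>m\<ge>N. \<forall>n\<ge>N. riem_dist \<A> G (X m) (X n) < e) \<longrightarrow>
        (\<exists>p. (\<lambda>n. riem_dist \<A> G (X n) p) \<longlonglongrightarrow> 0))"


section \<open>Geodesics and the exponential map\<close>

text \<open>
  The equation below is the geodesic equation with the index lowered.  In coordinates, with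
  \<open>DG\<close> the derivative of the Gram form, the Christoffel form \<open>\<Gamma>\<close> of the Levi-Civita connection
  satisfies \<open>G (\<Gamma> v v) w = DG v v w - DG w v v / 2\<close>, where the first argument of \<open>DG\<close> is the
  direction of differentiation; testing \<open>x'' + \<Gamma> x' x' = 0\<close> against all \<open>w\<close> gives the equation.
\<close>

definition geodesic_on ::
  "('m::topological_space, 'h::real_normed_vector) chart set \<Rightarrow>
   (('m, 'h) chart \<Rightarrow> 'h \<Rightarrow> 'h \<Rightarrow>\<^sub>L ('h \<Rightarrow>\<^sub>L real)) \<Rightarrow> real \<Rightarrow> real \<Rightarrow> (real \<Rightarrow> 'm) \<Rightarrow> bool" where
  "geodesic_on \<A> G a b \<gamma> \<longleftrightarrow>
     continuous_on {a..b} \<gamma> \<and>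
     (\<forall>c\<in>\<A>. let J = {t\<in>{a..b}. \<gamma> t \<in> chart_dom c}; x = coord c \<circ> \<gamma> in
        \<exists>x' x''. \<forall>t\<in>J.
          (x has_vector_derivative x' t) (at t within J) \<and>
          (x' has_vector_derivative x'' t) (at t within J) \<and>
          (let DG = frechet_derivative (G c) (at (x t)) in
            \<forall>w. G c (x t) (x'' t) w + DG (x' t) (x' t) w - DG w (x' t) (x' t) / 2 = 0))"

definition riem_exp ::
  "('m::topological_space, 'h::real_normed_vector) chart set \<Rightarrow>
   (('m, 'h) chart \<Rightarrow> 'h \<Rightarrow> 'h \<Rightarrow>\<^sub>L ('h \<Rightarrow>\<^sub>L real)) \<Rightarrow> 'm \<Rightarrow> 'h \<Rightarrow> 'm" where
  "riem_exp \<A> G p v =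
     (THE q. \<exists>\<gamma>. geodesic_on \<A> G 0 1 \<gamma> \<and> \<gamma> 0 = p \<and>
        ((coord (chart_at \<A> p) \<circ> \<gamma>) has_vector_derivative v) (at 0 within {0..1}) \<and> \<gamma> 1 = q)"


section \<open>Semicontinuity and proximal subdifferentials\<close>

definition lower_semicont ::
  "('a::topological_space \<Rightarrow> 'b::complete_linorder) \<Rightarrow> bool" where
  "lower_semicont f \<longleftrightarrow> (\<forall>x. f x \<le> Liminf (at x) f)"

text \<open>
  The inner product \<open>B\<close> is a parameter, because on tangent spaces it is given by the metric
  and not by the type class.
\<close>

definition proximal_subdiff ::
  "('h \<Rightarrow> 'h \<Rightarrow> real) \<Rightarrow> ('h::real_vector \<Rightarrow> ereal) \<Rightarrow> 'h \<Rightarrow> 'h set" where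
  "proximal_subdiff B g x =
     {\<zeta>. g x < \<infinity> \<and>
        (\<exists>\<sigma>>0. \<exists>\<eta>>0. \<forall>y. sqrt (B (y - x) (y - x)) < \<eta> \<longrightarrow>
           g y \<ge> g x + ereal (B \<zeta> (y - x) - \<sigma> * (sqrt (B (y - x) (y - x)))\<^sup>2))}"

definition riem_proximal_subdiff ::
  "('m::topological_space, 'h::real_normed_vector) chart set \<Rightarrow>
   (('m, 'h) chart \<Rightarrow> 'h \<Rightarrow> 'h \<Rightarrow>\<^sub>L ('h \<Rightarrow>\<^sub>L real)) \<Rightarrow> ('m \<Rightarrow> ereal) \<Rightarrow> 'm \<Rightarrow> 'h set" where
  "riem_proximal_subdiff \<A> G g p =
     {\<zeta>. g p < \<infinity> \<and> \<zeta> \<in> proximal_subdiff (tangent_inner \<A> G p) (g \<circ> riem_exp \<A> G p) 0}"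

end

theory Submission
  imports Defs
begin

text \<open>
  If the claim fails at \<open>x\<close>, Ekeland's principle for the Riemannian distance, with a constant \<open>\<kappa>\<close> slightly
  below \<open>\<delta>\<close>, yields a point \<open>y\<close> in \<open>V \<inter> U - \<phi> \<alpha>\<close> at which the value of \<open>F\<close> is at most that at any other
  point \<open>z\<close> plus \<open>\<kappa>\<close> times the distance from \<open>y\<close> to \<open>z\<close>.  In a chart around \<open>y\<close> this distance is at most
  \<open>1 + \<eta>\<close> times the norm of \<open>z - y\<close> with respect to the metric at \<open>y\<close>.  Smoothing the norm at the origin and
  applying the Borwein--Preiss principle, whose perturbation is a small quadratic, produces a point near
  \<open>y\<close> and a supporting concave quadratic of slope less than \<open>\<delta>\<close> there.  In any chart
  the exponential map agrees to second order with an affine map, so this quadratic gives a proximal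
  subgradient of norm less than \<open>\<delta>\<close>, contrary to the hypothesis.
\<close>

section \<open>Variational principles\<close>

text \<open>The model space may be infinite dimensional, so closed balls need not be compact and
  lower semicontinuous functions need not attain minima; variational principles replace
  minimisation. Ekeland's principle works for the distance on the whole manifold, but the cone it
  places under the function has a corner at \<open>y\<close>, hence gives no supporting smooth
  quadratic there. Borwein--Preiss gives one, but its perturbations collapse to a single quadratic
  only through an inner product, hence its use inside a chart. For the same reason, that convergence
  in the distance implies convergence in the topology, and that short curves and slow geodesics stay
  in a chart, is shown by real induction along the curve. \<open>riem_exp\<close> is a definite
  description, so geodesics must be unique before its values mean anything. Three factors 1 + \<eta>
  separate \<kappa> from \<delta>: the distance against the norm at \<open>y\<close>, the room that
  keeps the perturbed minimiser inside the ball, and the metric at \<open>y\<close> against the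
  metric at the new point.\<close>

lemma ekeland:
  fixes d :: "'m::topological_space \<Rightarrow> 'm \<Rightarrow> ennreal" and f :: "'m \<Rightarrow> ennreal" and \<kappa> :: real
  assumes refl: "\<And>p. d p p = 0" and sym: "\<And>p q. d p q = d q p"
    and tri: "\<And>p q r. d p r \<le> d p q + d q r"
    and complete: "\<And>X::nat \<Rightarrow> 'm. (\<And>e. e > 0 \<Longrightarrow> \<exists>N. \<forall>m\<ge>N. \<forall>n\<ge>N. d (X m) (X n) < e) \<Longrightarrow>
      \<exists>p. (\<lambda>n. d (X n) p) \<longlonglongrightarrow> 0"
    and top: "\<And>X p. (\<lambda>n. d (X n) p) \<longlonglongrightarrow> 0 \<Longrightarrow> X \<longlonglongrightarrow> p"
    and lsc: "\<And>X p a. X \<longlonglongrightarrow> p \<Longrightarrow> (\<And>n::nat. f (X n) \<le> a) \<Longrightarrow> f p \<le> a"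
    and fin: "f x < \<infinity>" and k: "\<kappa> > 0"
  obtains y where "f y + \<kappa> * d x y \<le> f x" "\<And>z. f y \<le> f z + \<kappa> * d y z"
proof -
  \<comment> \<open>\<open>S y\<close> is the set of points below \<open>y\<close> in Ekeland's
    order. The goal is a point below \<open>x\<close> whose own section contains no smaller value of
    \<open>f\<close>.\<close>
  define S where "S y = {z. f z + \<kappa> * d y z \<le> f y}" for y
  have S_refl: "y \<in> S y" for y by (simp add: S_def refl)
  have S_trans: "z \<in> S u" if "z \<in> S y" "y \<in> S u" for y z u
  proof -
    have "f z + \<kappa> * d u z \<le> f z + \<kappa> * (d y z + d u y)"
      using tri[of u z y] by (intro add_left_mono mult_left_mono) (auto simp: add.commute)
    also have "\<dots> = (f z + \<kappa> * d y z) + \<kappa> * d u y" by (simp add: distrib_left add.assoc)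
    also have "\<dots> \<le> f y + \<kappa> * d u y" using that by (auto simp: S_def intro: add_right_mono)
    also have "\<dots> \<le> f u" using that by (auto simp: S_def)
    finally show ?thesis by (simp add: S_def)
  qed
  have S_le: "f z \<le> f y" if "z \<in> S y" for y z
    using that by (auto simp: S_def intro: order_trans[rotated] dest: order_trans[rotated])
  have ex: "\<exists>z\<in>S y. f z \<le> (INF w\<in>S y. f w) + ennreal (1/2^n)" if "f y < \<infinity>" for y and n::nat
  proof -
    let ?I = "INF w\<in>S y. f w"
    have "?I \<le> f y" using S_refl by (intro INF_lower)
    then have "?I < \<infinity>" using that by (auto intro: le_less_trans)
    then have "?I < ?I + ennreal (1/2^n)"
      by (metis add.commute add_cancel_right_right ennreal_add_left_cancel_less add_0_right ennreal_zero_less_divide infinity_ennreal_def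
           order_le_less zero_le ennreal_less_zero_iff divide_pos_pos zero_less_one zero_less_power zero_less_numeral less_top)
    then show ?thesis by (metis INF_less_iff less_imp_le)
  qed
  \<comment> \<open>Greedy choice: the next point nearly minimises \<open>f\<close> over the current
    section. The error only has to tend to 0; the Cauchy property comes from the decrease of
    \<open>f\<close>.\<close>
  define nxt where "nxt n y = (SOME z. z \<in> S y \<and> f z \<le> (INF w\<in>S y. f w) + ennreal (1/2^n))" for n y
  define Y where "Y = rec_nat x nxt"
  have Y0: "Y 0 = x" and YS: "Y (Suc n) = nxt n (Y n)" for n by (simp_all add: Y_def)
  have nxt: "nxt n y \<in> S y \<and> f (nxt n y) \<le> (INF w\<in>S y. f w) + ennreal (1/2^n)" if "f y < \<infinity>" for n y
    unfolding nxt_def by (rule someI_ex) (use ex[OF that, of n] in blast)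
  have Yfin: "f (Y n) < \<infinity>" for n
  proof (induction n)
    case (Suc n) then show ?case using nxt[OF Suc, of n] S_le[of "nxt n (Y n)" "Y n"] by (auto simp: YS intro: le_less_trans)
  qed (use fin in \<open>simp add: Y0\<close>)
  have YSS: "Y (Suc n) \<in> S (Y n)" "f (Y (Suc n)) \<le> (INF w\<in>S (Y n). f w) + ennreal (1/2^n)" for n
    using nxt[OF Yfin, of n n] by (auto simp: YS)
  have Ymono: "Y m \<in> S (Y n)" if "n \<le> m" for n m
    using that by (induction m rule: dec_induct) (auto intro: S_refl S_trans YSS)
  have dec: "decseq (\<lambda>n. f (Y n))" by (auto simp: decseq_def intro: S_le Ymono)
  define L where "L = (INF n. f (Y n))"
  have fL: "(\<lambda>n. f (Y n)) \<longlonglongrightarrow> L" unfolding L_def by (rule LIMSEQ_INF[OF dec])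
  have Lle: "L \<le> f (Y n)" for n unfolding L_def by (intro INF_lower) auto
  have Lfin: "L < \<infinity>" using Lle[of 0] Yfin[of 0] by (rule le_less_trans)
  have small: "\<exists>N. \<forall>m\<ge>N. \<forall>n\<ge>N. d (Y m) (Y n) < e" if e: "e > 0" for e
  proof -
    have ke: "0 < \<kappa> * e" using k e by (simp add: ennreal_zero_less_mult_iff)
    then have "L < L + \<kappa> * e"
      using Lfin by (metis add_0_right ennreal_add_left_cancel_less infinity_ennreal_def less_top)
    then have "eventually (\<lambda>n. f (Y n) < L + \<kappa> * e) sequentially" using fL by (rule order_tendstoD(2)[rotated])
    then obtain N where N: "\<And>n. n \<ge> N \<Longrightarrow> f (Y n) < L + \<kappa> * e" by (auto simp: eventually_sequentially)
    have a: "d (Y n) (Y m) < e" if "N \<le> n" "n \<le> m" for n m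
    proof -
      \<comment> \<open>The finite limit \<open>L\<close> is added on both sides and cancelled,
        since subtraction on \<open>ennreal\<close> truncates.\<close>
      have "L + \<kappa> * d (Y n) (Y m) \<le> f (Y m) + \<kappa> * d (Y n) (Y m)" using Lle by (rule add_right_mono)
      also have "\<dots> \<le> f (Y n)" using Ymono[OF that(2)] by (simp add: S_def)
      also have "\<dots> < L + \<kappa> * e" by (rule N[OF that(1)])
      finally have "\<kappa> * d (Y n) (Y m) < \<kappa> * e" by (simp add: ennreal_add_left_cancel_less)
      then show ?thesis by (metis leD leI mult_left_mono zero_le)
    qed
    have "d (Y m) (Y n) < e" if "N \<le> m" "N \<le> n" for m n
      using a[of m n] a[of n m] sym[of "Y m" "Y n"] that by (cases "m \<le> n") auto
    then show ?thesis by blast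
  qed
  then obtain y where dy: "(\<lambda>n. d (Y n) y) \<longlonglongrightarrow> 0" using complete by blast
  have fy: "f y \<le> f (Y n)" for n
  proof (rule lsc)
    show "(\<lambda>k. Y (k + n)) \<longlonglongrightarrow> y" using top[OF dy] by (rule LIMSEQ_ignore_initial_segment)
    show "f (Y (k + n)) \<le> f (Y n)" for k using dec by (simp add: decseq_def)
  qed
  then have fyL: "f y \<le> L" unfolding L_def by (intro INF_greatest)
  \<comment> \<open>\<open>f y \<le> f (Y m)\<close> and the triangle inequality let
    \<open>m\<close> tend to infinity in the membership of \<open>Y m\<close>. By transitivity
    \<open>S y\<close> then lies in every \<open>S (Y n)\<close>.\<close>
  have yS: "y \<in> S (Y n)" for n
  proof -
    have "f y + \<kappa> * d (Y n) y \<le> f (Y n) + \<kappa> * d (Y m) y" if "m \<ge> n" for m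
    proof -
      have "f y + \<kappa> * d (Y n) y \<le> f (Y m) + \<kappa> * (d (Y n) (Y m) + d (Y m) y)"
        by (intro add_mono mult_left_mono fy tri) auto
      also have "\<dots> = (f (Y m) + \<kappa> * d (Y n) (Y m)) + \<kappa> * d (Y m) y" by (simp add: distrib_left add.assoc)
      also have "\<dots> \<le> f (Y n) + \<kappa> * d (Y m) y"
        using Ymono[OF that] by (auto simp: S_def intro: add_right_mono)
      finally show ?thesis .
    qed
    moreover have "(\<lambda>m. f (Y n) + \<kappa> * d (Y m) y) \<longlonglongrightarrow> f (Y n) + ennreal \<kappa> * 0"
      by (rule tendsto_add[OF tendsto_const ennreal_tendsto_cmult[OF _ dy]]) simp
    ultimately have "f y + \<kappa> * d (Y n) y \<le> f (Y n) + ennreal \<kappa> * 0"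
      by (intro LIMSEQ_le_const) auto
    then show ?thesis by (simp add: S_def)
  qed
  show thesis
  proof
    show "f y + \<kappa> * d x y \<le> f x" using yS[of 0] by (simp add: S_def Y0)
    show "f y \<le> f z + \<kappa> * d y z" for z
    proof (cases "z \<in> S y")
      case True
      \<comment> \<open>Such a \<open>z\<close> was a competitor in every greedy choice, so it
        cannot undercut \<open>f y\<close> by more than any of the errors.\<close>
      have "f y \<le> f z + ennreal (1/2^n)" for n
      proof -
        have "f y \<le> f (Y (Suc n))" by (rule fy)
        also have "\<dots> \<le> (INF w\<in>S (Y n). f w) + ennreal (1/2^n)" by (rule YSS)
        also have "\<dots> \<le> f z + ennreal (1/2^n)" using S_trans[OF True yS] by (intro add_right_mono INF_lower)
        finally show ?thesis .
      qed
      moreover have "(\<lambda>n. f z + ennreal (1/2^n)) \<longlonglongrightarrow> f z + ennreal 0"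
        by (intro tendsto_add tendsto_const tendsto_ennrealI LIMSEQ_divide_realpow_zero) auto
      ultimately have "f y \<le> f z" by (intro LIMSEQ_le_const[of _ "f z"]) auto
      then show ?thesis by (meson add_increasing2 zero_le)
    next
      case False then show ?thesis by (auto simp: S_def)
    qed
  qed
qed

text \<open>
  Borwein--Preiss in a Hilbert space: the perturbations \<open>\<mu> k * (norm (z - Z k))\<^sup>2\<close> collected along an
  approximately minimising sequence add up, because \<open>\<mu>\<close> sums to \<open>1\<close>, to the single quadratic
  \<open>(norm (z - w))\<^sup>2\<close> plus a constant, where \<open>w\<close> is the barycentre of the sequence.
\<close>

lemma smooth_variational_principle:
  fixes g :: "'h::{real_inner, banach} \<Rightarrow> real"
  assumes closed: "\<And>a. closed {z\<in>X. g z \<le> a}" and bounded: "\<And>z. z \<in> X \<Longrightarrow> norm z \<le> r"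
    and ne: "X \<noteq> {}" and lower: "\<And>z. z \<in> X \<Longrightarrow> B \<le> g z" and eps: "\<epsilon> > 0"
  obtains z' w where "z' \<in> X" "norm w \<le> r"
    "\<And>z. z \<in> X \<Longrightarrow> g z' + \<epsilon> * (norm (z' - w))\<^sup>2 \<le> g z + \<epsilon> * (norm (z - w))\<^sup>2"
proof -
  define \<mu> :: "nat \<Rightarrow> real" where "\<mu> n = (1/2) ^ Suc n" for n
  \<comment> \<open>The tolerance is matched to the weight: comparing consecutive points bounds
    \<open>\<epsilon> * \<mu> n\<close> times their squared distance by
    \<open>e n + e (Suc n)\<close>, so the factor (1/4)^n makes the steps geometrically
    small.\<close>
  define e where "e n = \<epsilon> * \<mu> n * (1/4) ^ n" for n
  have \<mu>: "\<mu> n > 0" for n by (simp add: \<mu>_def)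
  have e: "e n > 0" for n by (simp add: e_def \<mu> eps)
  have \<mu>1: "\<mu> sums 1" unfolding \<mu>_def by (rule power_half_series)
  have e0: "e \<longlonglongrightarrow> 0"
  proof (rule tendsto_sandwich[OF _ _ tendsto_const])
    show "\<forall>\<^sub>F n in sequentially. e n \<le> \<epsilon> * (1/4) ^ n"
    proof (intro always_eventually allI)
      fix n show "e n \<le> \<epsilon> * (1/4) ^ n"
        using eps mult_left_le_one_le[of "\<epsilon> * (1/4)^n" "\<mu> n"] \<mu>[of n] power_le_one[of "1/2::real" "Suc n"]
        by (simp add: e_def \<mu>_def mult_ac)
    qed
    show "(\<lambda>n. \<epsilon> * (1/4) ^ n) \<longlonglongrightarrow> 0"
      by (intro tendsto_mult_right_zero LIMSEQ_power_zero) simp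
    show "\<forall>\<^sub>F n in sequentially. 0 \<le> e n" using e by (auto intro: less_imp_le always_eventually)
  qed
  \<comment> \<open>A state is the perturbation collected so far together with the current point.
    Nonnegativity of the perturbation keeps the perturbed function bounded below, which the next
    approximate minimisation requires.\<close>
  define P :: "nat \<Rightarrow> ('h \<Rightarrow> real) \<times> 'h \<Rightarrow> bool" where
    "P n s \<longleftrightarrow> snd s \<in> X \<and> (\<forall>y. fst s y \<ge> 0) \<and> (n = 0 \<longrightarrow> fst s = (\<lambda>_. 0)) \<and>
       (\<forall>y\<in>X. g (snd s) + fst s (snd s) \<le> g y + fst s y + e n)" for n s
  define Q :: "nat \<Rightarrow> ('h \<Rightarrow> real) \<times> 'h \<Rightarrow> ('h \<Rightarrow> real) \<times> 'h \<Rightarrow> bool" where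
    "Q n s t \<longleftrightarrow> fst t = (\<lambda>y. fst s y + \<epsilon> * (\<mu> n * (norm (y - snd s))\<^sup>2))" for n s t
  have approx: "\<exists>z\<in>X. \<forall>y\<in>X. g z + h z \<le> g y + h y + e n" if "\<And>y. h y \<ge> 0" for h :: "'h \<Rightarrow> real" and n
  proof -
    let ?I = "INF y\<in>X. g y + h y"
    have bdd: "bdd_below ((\<lambda>y. g y + h y) ` X)"
      using lower that by (intro bdd_belowI2[of _ B]) (simp add: add_increasing2)
    have "?I < ?I + e n" using e by simp
    then obtain z where "z \<in> X" "g z + h z < ?I + e n" using cINF_less_iff[OF ne bdd] by blast
    moreover have "?I \<le> g y + h y" if "y \<in> X" for y using cINF_lower[OF bdd that] .
    ultimately show ?thesis by (intro bexI[of _ z]) force+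
  qed
  have "\<exists>f. \<forall>n. P n (f n) \<and> Q n (f n) (f (Suc n))"
  proof (rule dependent_nat_choice)
    show "\<exists>x. P 0 x" using approx[of "\<lambda>_. 0" 0] by (fastforce simp: P_def)
    fix s n assume s: "P n s"
    let ?h = "\<lambda>y. fst s y + \<epsilon> * (\<mu> n * (norm (y - snd s))\<^sup>2)"
    have "\<And>y. ?h y \<ge> 0" using s \<mu>[of n] eps by (auto simp: P_def)
    from approx[of ?h "Suc n", OF this] obtain z where "z \<in> X" "\<forall>y\<in>X. g z + ?h z \<le> g y + ?h y + e (Suc n)" by blast
    with \<open>\<And>y. ?h y \<ge> 0\<close> have "P (Suc n) (?h, z) \<and> Q n s (?h, z)" by (auto simp: P_def Q_def)
    then show "\<exists>t. P (Suc n) t \<and> Q n s t" by blast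
  qed
  then obtain f where f: "\<And>n. P n (f n)" "\<And>n. Q n (f n) (f (Suc n))" by blast
  define h where "h n = fst (f n)" for n
  define Z where "Z n = snd (f n)" for n
  have ZX: "Z n \<in> X" for n using f(1)[of n] by (simp add: P_def Z_def)
  have min: "g (Z n) + h n (Z n) \<le> g y + h n y + e n" if "y \<in> X" for n y
    using f(1)[of n] that by (simp add: P_def Z_def h_def)
  have h0: "h 0 = (\<lambda>_. 0)" using f(1)[of 0] by (simp add: P_def h_def)
  have hS: "h (Suc n) y = h n y + \<epsilon> * (\<mu> n * (norm (y - Z n))\<^sup>2)" for n y
    using f(2)[of n] by (simp add: Q_def h_def Z_def)
  have h: "h n y = \<epsilon> * (\<Sum>k<n. \<mu> k * (norm (y - Z k))\<^sup>2)" for n y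
    by (induction n) (simp_all add: h0 hS algebra_simps)
  have step: "norm (Z (Suc n) - Z n) \<le> 2 * (1/2) ^ n" for n
  proof -
    let ?D = "(norm (Z (Suc n) - Z n))\<^sup>2"
    have "g (Z (Suc n)) + h (Suc n) (Z (Suc n)) \<le> g (Z n) + h (Suc n) (Z n) + e (Suc n)"
      by (rule min[OF ZX])
    moreover have "g (Z n) + h n (Z n) \<le> g (Z (Suc n)) + h n (Z (Suc n)) + e n" by (rule min[OF ZX])
    ultimately have "\<epsilon> * (\<mu> n * ?D) \<le> e n + e (Suc n)" by (simp add: hS)
    also have "\<dots> \<le> \<epsilon> * (\<mu> n * (4 * (1/4) ^ n))"
    proof -
      have "e n = \<epsilon> * (\<mu> n * (1/4)^n)" "e (Suc n) = \<epsilon> * (\<mu> n * ((1/4)^n / 8))" by (simp_all add: e_def \<mu>_def)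
      then have "e n + e (Suc n) = \<epsilon> * (\<mu> n * (9/8 * (1/4)^n))" by (simp add: algebra_simps)
      also have "\<dots> \<le> \<epsilon> * (\<mu> n * (4 * (1/4) ^ n))" using eps \<mu>[of n] by (intro mult_left_mono) auto
      finally show ?thesis .
    qed
    finally have "?D \<le> 4 * (1/4) ^ n" using eps \<mu>[of n] by simp
    also have "\<dots> = (2 * (1/2) ^ n)\<^sup>2" by (simp add: power2_eq_square flip: power_mult_distrib)
    finally show ?thesis by (rule power2_le_imp_le) simp
  qed
  have "summable (\<lambda>n. Z (Suc n) - Z n)"
    by (rule summable_comparison_test'[of "\<lambda>n. 2 * (1/2) ^ n" 0])
       (use step in \<open>auto intro!: summable_mult summable_geometric\<close>)
  then have "convergent (\<lambda>n. \<Sum>k<n. Z (Suc k) - Z k)" by (simp add: summable_iff_convergent)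
  then obtain l where "(\<lambda>n. Z n - Z 0) \<longlonglongrightarrow> l" by (auto simp: convergent_def sum_lessThan_telescope)
  then have "(\<lambda>n. Z n - Z 0 + Z 0) \<longlonglongrightarrow> l + Z 0" by (intro tendsto_add tendsto_const)
  then obtain z' where z': "Z \<longlonglongrightarrow> z'" by auto
  have Zr: "norm (Z n) \<le> r" for n by (rule bounded[OF ZX])
  have sum_const: "summable (\<lambda>k. \<mu> k * a)" for a by (intro summable_mult2 sums_summable[OF \<mu>1])
  have w_le: "norm (\<mu> k *\<^sub>R Z k) \<le> \<mu> k * r" for k using \<mu>[of k] Zr[of k] by (simp add: mult_left_mono)
  have sumw: "summable (\<lambda>k. \<mu> k *\<^sub>R Z k)" and sn: "summable (\<lambda>k. norm (\<mu> k *\<^sub>R Z k))"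
    using w_le by (auto intro: summable_comparison_test'[OF sum_const[of r], of 0])
  have "\<mu> k * (norm (Z k))\<^sup>2 \<le> \<mu> k * r\<^sup>2" for k
    using \<mu>[of k] Zr[of k] by (intro mult_left_mono power_mono) auto
  then have sumD: "summable (\<lambda>k. \<mu> k * (norm (Z k))\<^sup>2)"
    using \<mu> by (intro summable_comparison_test'[OF sum_const[of "r\<^sup>2"], of 0]) (simp add: less_imp_le)
  define w where "w = (\<Sum>k. \<mu> k *\<^sub>R Z k)"
  define D where "D = (\<Sum>k. \<mu> k * (norm (Z k))\<^sup>2)"
  have w: "(\<lambda>k. \<mu> k *\<^sub>R Z k) sums w" unfolding w_def by (rule summable_sums[OF sumw])
  have Dw: "(\<lambda>k. \<mu> k * (norm (Z k))\<^sup>2) sums D" unfolding D_def by (rule summable_sums[OF sumD])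
  have wr: "norm w \<le> r"
  proof -
    have "norm w \<le> (\<Sum>k. norm (\<mu> k *\<^sub>R Z k))" unfolding w_def by (rule summable_norm[OF sn])
    also have "\<dots> \<le> (\<Sum>k. \<mu> k * r)"
      by (rule suminf_le[OF w_le sn sum_const])
    also have "\<dots> = r" using sums_mult2[OF \<mu>1, of r] by (simp add: sums_iff)
    finally show ?thesis .
  qed
  \<comment> \<open>Limit of \<open>h n\<close>: expanding the squares and summing against
    \<open>\<mu>\<close> leaves only the barycentre \<open>w\<close> and the constant
    \<open>D\<close>.\<close>
  define H where "H z = \<epsilon> * ((norm z)\<^sup>2 - 2 * (z \<bullet> w) + D)" for z
  have H: "(\<lambda>n. h n z) \<longlonglongrightarrow> H z" for z
  proof -
    have "(\<lambda>k. \<mu> k * (norm z)\<^sup>2 - 2 * (z \<bullet> (\<mu> k *\<^sub>R Z k)) + \<mu> k * (norm (Z k))\<^sup>2) sums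
        (1 * (norm z)\<^sup>2 - 2 * (z \<bullet> w) + D)"
      by (intro sums_add sums_diff sums_mult sums_mult2 \<mu>1 Dw bounded_linear.sums[OF bounded_linear_inner_right] w)
    also have "(\<lambda>k. \<mu> k * (norm z)\<^sup>2 - 2 * (z \<bullet> (\<mu> k *\<^sub>R Z k)) + \<mu> k * (norm (Z k))\<^sup>2) = (\<lambda>k. \<mu> k * (norm (z - Z k))\<^sup>2)"
      by (rule ext) (simp add: power2_norm_eq_inner inner_diff algebra_simps inner_commute)
    finally show ?thesis unfolding H_def h by (auto simp: sums_def intro!: tendsto_mult tendsto_const)
  qed
  have hH: "h n z \<le> H z" for n z
  proof (rule incseq_le[OF _ H])
    show "incseq (\<lambda>n. h n z)" using eps \<mu> by (intro incseq_SucI) (simp add: hS less_imp_le)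
  qed
  \<comment> \<open>Two limits, in this order: with \<open>m\<close> fixed, \<open>h m\<close> is
    continuous and lies below every later \<open>h n\<close>, so \<open>n\<close> may tend to
    infinity along the closed sublevel sets of \<open>g\<close>; \<open>m\<close> follows at the
    very end.\<close>
  have key: "z' \<in> X \<and> g z' + h m z' \<le> g z + H z" if z: "z \<in> X" for m z
  proof -
    have ev: "z' \<in> X \<and> g z' \<le> g z + H z - h m z' + \<eta>" if \<eta>: "\<eta> > 0" for \<eta>
    proof -
      have "(\<lambda>n. h m (Z n)) \<longlonglongrightarrow> h m z'" unfolding h by (intro tendsto_intros z')
      then have "\<forall>\<^sub>F n in sequentially. h m z' - \<eta>/2 < h m (Z n)" by (rule order_tendstoD) (use \<eta> in auto)
      moreover have "\<forall>\<^sub>F n in sequentially. e n < \<eta>/2" by (rule order_tendstoD[OF e0]) (use \<eta> in auto)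
      ultimately have "\<forall>\<^sub>F n in sequentially. Z n \<in> {y\<in>X. g y \<le> g z + H z - h m z' + \<eta>}"
        using eventually_ge_at_top[of m]
      proof eventually_elim
        case (elim n)
        have "h m (Z n) \<le> h n (Z n)" using elim(3)
          unfolding h using eps \<mu> by (intro mult_left_mono sum_mono2) (auto simp: less_imp_le)
        then show ?case using min[OF z, of n] hH[of n z] elim ZX by auto
      qed
      then have "z' \<in> {y\<in>X. g y \<le> g z + H z - h m z' + \<eta>}"
        using Lim_in_closed_set[OF closed _ _ z'] by auto
      then show ?thesis by auto
    qed
    have "g z' \<le> g z + H z - h m z'"
    proof (rule field_le_epsilon)
      fix \<eta> :: real assume "0 < \<eta>" then show "g z' \<le> g z + H z - h m z' + \<eta>" using ev[of \<eta>] by simp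
    qed
    then show ?thesis using ev[of 1] by auto
  qed
  have HH: "H z = \<epsilon> * (norm (z - w))\<^sup>2 + \<epsilon> * (D - (norm w)\<^sup>2)" for z
    by (simp add: H_def power2_norm_eq_inner inner_diff inner_commute algebra_simps)
  show thesis
  proof
    show "z' \<in> X" using key ne by blast
    show "norm w \<le> r" by (rule wr)
    fix z assume "z \<in> X"
    have "g z' + H z' \<le> g z + H z"
      by (rule LIMSEQ_le_const2[OF tendsto_add[OF tendsto_const H]]) (use key[OF \<open>z \<in> X\<close>] in auto)
    then show "g z' + \<epsilon> * (norm (z' - w))\<^sup>2 \<le> g z + \<epsilon> * (norm (z - w))\<^sup>2" by (simp add: HH)
  qed
qed

text \<open>Near the limit \<open>l\<close> the continuous summand is almost \<open>p l\<close>, so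
  the sequence enters the closed sublevel set of \<open>g\<close> at any level above
  \<open>a - p l\<close>. This set also yields \<open>l \<in> X\<close>.\<close>

lemma closed_sublevel_add:
  fixes g p :: "'h::real_normed_vector \<Rightarrow> real"
  assumes g: "\<And>a. closed {z\<in>X. g z \<le> a}" and p: "continuous_on UNIV p"
  shows "closed {z\<in>X. g z + p z \<le> a}"
  unfolding closed_sequential_limits
proof (intro allI impI, elim conjE)
  fix Z l assume Z: "\<forall>n. Z n \<in> {z\<in>X. g z + p z \<le> a}" and l: "Z \<longlonglongrightarrow> l"
  have ev: "l \<in> X \<and> g l \<le> a - p l + \<eta>" if "\<eta> > 0" for \<eta>
  proof -
    have "(\<lambda>n. p (Z n)) \<longlonglongrightarrow> p l" using p l continuous_on_tendsto_compose[OF p l] by auto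
    then have "\<forall>\<^sub>F n in sequentially. p l - \<eta> < p (Z n)" by (rule order_tendstoD) (use that in auto)
    then have "\<forall>\<^sub>F n in sequentially. Z n \<in> {z\<in>X. g z \<le> a - p l + \<eta>}"
      proof eventually_elim
      case (elim n) then show ?case using Z[rule_format, of n] by simp
    qed
    then have "l \<in> {z\<in>X. g z \<le> a - p l + \<eta>}" using Lim_in_closed_set[OF g _ _ l] by auto
    then show ?thesis by auto
  qed
  have "g l \<le> a - p l"
  proof (rule field_le_epsilon)
    fix \<eta> :: real assume "0 < \<eta>" then show "g l \<le> a - p l + \<eta>" using ev[of \<eta>] by simp
  qed
  then show "l \<in> {z\<in>X. g z + p z \<le> a}" using ev[of 1] by auto
qed

text \<open>The solution minimises the energy \<open>J\<close>, and the parallelogram identity with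
  coercivity makes a minimising sequence Cauchy in the norm of the type. It serves twice: to solve
  the weak geodesic equation for the acceleration, and to turn a slope into a tangent
  vector.\<close>

lemma riesz_coercive:
  fixes B :: "'h::banach \<Rightarrow>\<^sub>L ('h \<Rightarrow>\<^sub>L real)" and l :: "'h \<Rightarrow>\<^sub>L real"
  assumes sym: "\<And>u v. B u v = B v u" and m: "m > 0" and coercive: "\<And>u. m * (norm u)\<^sup>2 \<le> B u u"
  shows "\<exists>q. \<forall>w. B q w = l w"
proof -
  define J where "J u = B u u - 2 * l u" for u
  have low: "- ((norm l)\<^sup>2 / m) \<le> J u" for u
  proof -
    have "l u \<le> norm l * norm u" using norm_blinfun[of l u] by (simp add: abs_le_iff)
    then have "J u \<ge> m * (norm u)\<^sup>2 - 2 * (norm l * norm u)" using coercive[of u] by (simp add: J_def)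
    then have "m * J u \<ge> m * (m * (norm u)\<^sup>2 - 2 * (norm l * norm u))" using m by (intro mult_left_mono) auto
    moreover have "0 \<le> (m * norm u - norm l)\<^sup>2" by simp
    ultimately have "- (norm l)\<^sup>2 \<le> m * J u" by (simp add: power2_eq_square algebra_simps)
    then show ?thesis using m by (simp add: field_simps)
  qed
  let ?I = "INF u. J u"
  have bdd: "bdd_below (range J)" using low by (intro bdd_belowI2)
  have I: "?I \<le> J u" for u by (rule cINF_lower[OF bdd]) simp
  have "\<exists>u. J u < ?I + 1 / real (Suc n)" for n
    using cINF_less_iff[OF _ bdd, of "?I + 1 / real (Suc n)"] by auto
  then obtain U where U: "\<And>n. J (U n) < ?I + 1 / real (Suc n)" by metis
  have par: "m / 2 * (norm (u - v))\<^sup>2 \<le> J u + J v - 2 * ?I" for u v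
  proof -
    have "B (u - v) (u - v) = 2 * (J u + J v - 2 * J ((1/2) *\<^sub>R (u + v)))"
      by (simp add: J_def blinfun.bilinear_simps sym[of v u] algebra_simps)
    moreover have "m * (norm (u - v))\<^sup>2 \<le> B (u - v) (u - v)" by (rule coercive)
    ultimately show ?thesis using I[of "(1/2) *\<^sub>R (u + v)"] by simp
  qed
  have "Cauchy U"
  proof (rule metric_CauchyI)
    fix e :: real assume e: "e > 0"
    then have "m / 4 * e\<^sup>2 > 0" using m by simp
    then obtain N where N: "1 / real (Suc N) < m / 4 * e\<^sup>2" using nat_approx_posE by blast
    have "dist (U i) (U j) < e" if "N \<le> i" "N \<le> j" for i j
    proof -
      have "1 / real (Suc i) \<le> 1 / real (Suc N)" "1 / real (Suc j) \<le> 1 / real (Suc N)"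
        using that by (auto intro!: divide_left_mono)
      then have "m / 2 * (norm (U i - U j))\<^sup>2 < m / 2 * e\<^sup>2"
        using par[of "U i" "U j"] U[of i] U[of j] N by simp
      then have "(norm (U i - U j))\<^sup>2 < e\<^sup>2" using m by simp
      then show ?thesis using e by (simp add: dist_norm power2_less_imp_less)
    qed
    then show "\<exists>M. \<forall>i\<ge>M. \<forall>j\<ge>M. dist (U i) (U j) < e" by blast
  qed
  then obtain q where q: "U \<longlonglongrightarrow> q" by (auto simp: Cauchy_convergent_iff convergent_def)
  have "(\<lambda>n. J (U n)) \<longlonglongrightarrow> J q" unfolding J_def by (intro tendsto_intros q)
  moreover have "(\<lambda>n. ?I + 1 / real (Suc n)) \<longlonglongrightarrow> ?I + 0"
    by (intro tendsto_add tendsto_const LIMSEQ_Suc[OF lim_1_over_n])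
  ultimately have Jq: "J q \<le> ?I"
    using U by (intro LIMSEQ_le[of "\<lambda>n. J (U n)" "J q" "\<lambda>n. ?I + 1 / real (Suc n)"]) (auto intro: less_imp_le)
  have "B q w = l w" for w
  proof (rule ccontr)
    assume ne: "B q w \<noteq> l w"
    define c where "c = B q w - l w"
    define b where "b = B w w"
    have ineq: "0 \<le> 2 * t * c + t\<^sup>2 * b" for t
    proof -
      have "J q \<le> J (q + t *\<^sub>R w)" using Jq I order_trans by blast
      then show ?thesis
        by (simp add: J_def c_def b_def blinfun.bilinear_simps sym[of w q] algebra_simps power2_eq_square)
    qed
    have b: "b \<ge> 0" using coercive[of w] m by (auto simp: b_def intro: order_trans[rotated])
    have c: "c \<noteq> 0" using ne by (simp add: c_def)
    \<comment> \<open>Nearly the optimal step -c/b for the quadratic in \<open>t\<close>, with b + 1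
      below so that b = 0 is covered.\<close>
    have "2 * (- c / (b + 1)) * c + (- c / (b + 1))\<^sup>2 * b = - (c\<^sup>2 * (b + 2)) / (b + 1)\<^sup>2"
      using b by (simp add: power2_eq_square divide_simps) (simp add: algebra_simps)
    moreover have "c\<^sup>2 * (b + 2) / (b + 1)\<^sup>2 > 0" using b c by (intro divide_pos_pos mult_pos_pos) auto
    ultimately show False using ineq[of "- c / (b + 1)"] by simp
  qed
  then show ?thesis by blast
qed

section \<open>Second order calculus\<close>

lemma norm_blinfun2:
  fixes B :: "'a::real_normed_vector \<Rightarrow>\<^sub>L ('b::real_normed_vector \<Rightarrow>\<^sub>L 'c::real_normed_vector)"
  shows "norm (B a b) \<le> norm B * norm a * norm b"
  by (rule order_trans[OF norm_blinfun]) (intro mult_right_mono norm_blinfun norm_ge_zero)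

lemma norm_blinfun3:
  fixes D :: "'a::real_normed_vector \<Rightarrow>\<^sub>L ('b::real_normed_vector \<Rightarrow>\<^sub>L ('c::real_normed_vector \<Rightarrow>\<^sub>L real))"
  shows "\<bar>D a b c\<bar> \<le> norm D * norm a * norm b * norm c"
  using order_trans[OF norm_blinfun2[of "D a" b c] mult_right_mono[OF mult_right_mono[OF norm_blinfun[of D a]]]] by simp

text \<open>Two derivatives suffice for geodesics and transition maps, so the list-indexed tower of
  \<open>smooth_on\<close> is cut off here. The derivatives are named arguments, so that later
  estimates can refer to them as bounded linear maps.\<close>

definition C2_on ::
  "'a::real_normed_vector set \<Rightarrow> ('a \<Rightarrow> 'b::real_normed_vector) \<Rightarrow> ('a \<Rightarrow> 'a \<Rightarrow>\<^sub>L 'b) \<Rightarrow>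
   ('a \<Rightarrow> 'a \<Rightarrow>\<^sub>L ('a \<Rightarrow>\<^sub>L 'b)) \<Rightarrow> bool" where
  "C2_on S f f1 f2 \<longleftrightarrow>
     (\<forall>x\<in>S. (f has_derivative blinfun_apply (f1 x)) (at x) \<and>
            (f1 has_derivative blinfun_apply (f2 x)) (at x)) \<and>
     continuous_on S f2"

text \<open>Levels one and two of the tower become \<open>f1\<close> and \<open>f2\<close>.
  Continuity of \<open>f2\<close> uses the next level: the remainder estimate and the bound on the
  third derivative make \<open>f2\<close> Lipschitz at each point.\<close>

lemma smooth_on_imp_C2_on:
  assumes S: "open S" and f: "smooth_on S f"
  obtains f1 f2 where "C2_on S f f1 f2"
proof -
  from f obtain D where D': "\<forall>x\<in>S.
        D x [] = f x \<and>
        (\<forall>us ws. linear (\<lambda>v. D x (us @ v # ws))) \<and>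
        (\<forall>k. \<exists>C. \<forall>vs. length vs = k \<longrightarrow> norm (D x vs) \<le> C * prod_list (map norm vs)) \<and>
        (\<forall>k. \<forall>e>0. \<exists>d>0. \<forall>y\<in>S. norm (y - x) < d \<longrightarrow>
           (\<forall>vs. length vs = k \<longrightarrow>
              norm (D y vs - D x vs - D x ((y - x) # vs))
                \<le> e * norm (y - x) * prod_list (map norm vs)))"
    unfolding smooth_on_def by (rule exE)
  note D = bspec[OF D']
  have lin: "linear (\<lambda>v. D x (us @ v # ws))" if "x \<in> S" for x us ws using D[OF that] by blast
  have bnd: "\<exists>C\<ge>0. \<forall>vs. length vs = k \<longrightarrow> norm (D x vs) \<le> C * prod_list (map norm vs)" if x: "x \<in> S" for x k
  proof -
    obtain C where C: "\<And>vs. length vs = k \<Longrightarrow> norm (D x vs) \<le> C * prod_list (map norm vs)" using D[OF x] by metis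
    have "norm (D x vs) \<le> max C 0 * prod_list (map norm vs)" if "length vs = k" for vs
    proof -
      have "0 \<le> prod_list (map norm vs)" by (induction vs) auto
      then have "C * prod_list (map norm vs) \<le> max C 0 * prod_list (map norm vs)" by (intro mult_right_mono) auto
      then show ?thesis using C[OF that] by linarith
    qed
    then show ?thesis by (intro exI[of _ "max C 0"]) auto
  qed
  have der: "\<exists>d>0. \<forall>y\<in>S. norm (y - x) < d \<longrightarrow>
           (\<forall>vs. length vs = k \<longrightarrow>
              norm (D y vs - D x vs - D x ((y - x) # vs)) \<le> e * norm (y - x) * prod_list (map norm vs))"
    if "x \<in> S" "e > 0" for x k and e :: real using D[OF that(1)] that(2) by blast
  have bl1: "bounded_linear (\<lambda>v. D x [v])" if x: "x \<in> S" for x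
  proof -
    obtain C where "\<And>vs. length vs = 1 \<Longrightarrow> norm (D x vs) \<le> C * prod_list (map norm vs)" using bnd[OF x, of 1] by blast
    from this[of "[_]"] have "\<And>v. norm (D x [v]) \<le> norm v * C" by (simp add: mult.commute)
    then show ?thesis using lin[OF x, of "[]" "[]"]
      by (intro bounded_linear.intro bounded_linear_axioms.intro) auto
  qed
  have bl2: "bounded_linear (\<lambda>v. D x [u, v])" if x: "x \<in> S" for x u
  proof -
    obtain C where "\<And>vs. length vs = 2 \<Longrightarrow> norm (D x vs) \<le> C * prod_list (map norm vs)" using bnd[OF x, of 2] by blast
    from this[of "[u, _]"] have "\<And>v. norm (D x [u, v]) \<le> norm v * (C * norm u)" by (simp add: mult_ac)
    then show ?thesis using lin[OF x, of "[u]" "[]"]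
      by (intro bounded_linear.intro bounded_linear_axioms.intro) auto
  qed
  define f1 where "f1 x = Blinfun (\<lambda>v. D x [v])" for x
  define h where "h x u = Blinfun (\<lambda>v. D x [u, v])" for x u
  define f2 where "f2 x = Blinfun (h x)" for x
  have f1: "f1 x v = D x [v]" if "x \<in> S" for x v
    unfolding f1_def by (simp add: bounded_linear_Blinfun_apply[OF bl1[OF that]])
  have h: "h x u v = D x [u, v]" if "x \<in> S" for x u v
    unfolding h_def by (simp add: bounded_linear_Blinfun_apply[OF bl2[OF that]])
  have "bounded_linear (h x)" if x: "x \<in> S" for x
  proof -
    obtain C where C: "C \<ge> 0" "\<And>vs. length vs = 2 \<Longrightarrow> norm (D x vs) \<le> C * prod_list (map norm vs)" using bnd[OF x, of 2] by blast
    have "norm (h x u) \<le> norm u * C" for u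
      using C(1) C(2)[of "[u, _]"] by (intro norm_blinfun_bound) (auto simp: h[OF x] mult_ac)
    moreover have "linear (h x)"
    proof (rule linearI)
      show "h x (a + b) = h x a + h x b" for a b
        by (rule blinfun_eqI) (use linear_add[OF lin[OF x, of "[]" "[_]"]] in \<open>simp add: h[OF x] blinfun.bilinear_simps\<close>)
      show "h x (r *\<^sub>R b) = r *\<^sub>R h x b" for r b
        by (rule blinfun_eqI) (use linear_scale[OF lin[OF x, of "[]" "[_]"]] in \<open>simp add: h[OF x] blinfun.bilinear_simps\<close>)
    qed
    ultimately show ?thesis by (intro bounded_linear.intro bounded_linear_axioms.intro) auto
  qed
  then have f2: "f2 x u v = D x [u, v]" if "x \<in> S" for x u v
    unfolding f2_def using that by (simp add: bounded_linear_Blinfun_apply h)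
  have nbhd: "\<exists>d>0. \<forall>y. norm (y - x) < d \<longrightarrow> y \<in> S" if "x \<in> S" for x
    using S that by (auto simp: open_dist dist_norm)
  have "(f has_derivative f1 x) (at x)" if x: "x \<in> S" for x
    unfolding has_derivative_at_alt
  proof (intro conjI allI impI)
    show "bounded_linear (f1 x)" by (rule blinfun.bounded_linear_right)
    fix e :: real assume "e > 0"
    from der[OF x this, of 0] obtain d1 where d1: "d1 > 0" "\<And>y. y \<in> S \<Longrightarrow> norm (y - x) < d1 \<Longrightarrow>
       norm (D y [] - D x [] - D x [y - x]) \<le> e * norm (y - x)" by auto
    obtain d2 where d2: "d2 > 0" "\<And>y. norm (y - x) < d2 \<Longrightarrow> y \<in> S" using nbhd[OF x] by blast
    show "\<exists>d>0. \<forall>y. norm (y - x) < d \<longrightarrow> norm (f y - f x - f1 x (y - x)) \<le> e * norm (y - x)"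
      using d1 d2 D x by (intro exI[of _ "min d1 d2"]) (auto simp: f1)
  qed
  moreover have "(f1 has_derivative f2 x) (at x)" if x: "x \<in> S" for x
    unfolding has_derivative_at_alt
  proof (intro conjI allI impI)
    show "bounded_linear (f2 x)" by (rule blinfun.bounded_linear_right)
    fix e :: real assume e: "e > 0"
    from der[OF x this, of 1] obtain d1 where d1: "d1 > 0" "\<And>y vs. y \<in> S \<Longrightarrow> norm (y - x) < d1 \<Longrightarrow> length vs = 1 \<Longrightarrow>
       norm (D y vs - D x vs - D x ((y - x) # vs)) \<le> e * norm (y - x) * prod_list (map norm vs)" by blast
    obtain d2 where d2: "d2 > 0" "\<And>y. norm (y - x) < d2 \<Longrightarrow> y \<in> S" using nbhd[OF x] by blast
    show "\<exists>d>0. \<forall>y. norm (y - x) < d \<longrightarrow> norm (f1 y - f1 x - f2 x (y - x)) \<le> e * norm (y - x)"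
    proof (intro exI[of _ "min d1 d2"] conjI allI impI)
      fix y assume "norm (y - x) < min d1 d2"
      then have y: "y \<in> S" "norm (y - x) < d1" using d2 by auto
      show "norm (f1 y - f1 x - f2 x (y - x)) \<le> e * norm (y - x)"
        using d1(2)[OF y, of "[_]"] e
        by (intro norm_blinfun_bound) (auto simp: blinfun.diff_left f1[OF x] f1[OF y(1)] f2[OF x])
    qed (use d1 d2 in auto)
  qed
  moreover have "continuous_on S f2"
    unfolding continuous_on_iff
  proof (intro ballI allI impI)
    fix x :: 'a and e :: real assume x: "x \<in> S" and e: "e > 0"
    from der[OF x zero_less_one, of 2] obtain d1 where d1: "d1 > 0" "\<And>y vs. y \<in> S \<Longrightarrow> norm (y - x) < d1 \<Longrightarrow> length vs = 2 \<Longrightarrow>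
       norm (D y vs - D x vs - D x ((y - x) # vs)) \<le> 1 * norm (y - x) * prod_list (map norm vs)" by blast
    obtain C where C: "C \<ge> 0" "\<And>vs. length vs = 3 \<Longrightarrow> norm (D x vs) \<le> C * prod_list (map norm vs)" using bnd[OF x, of 3] by blast
    define d where "d = min d1 (e / (2 * (C + 1)))"
    have "d > 0" using d1 e C by (simp add: d_def)
    moreover have "dist (f2 y) (f2 x) < e" if y: "y \<in> S" "dist y x < d" for y
    proof -
      have yd: "norm (y - x) < d1" using y by (simp add: d_def dist_norm)
      have b: "norm ((f2 y - f2 x) u v) \<le> (C + 1) * norm (y - x) * norm u * norm v" for u v
      proof -
        have "norm (D y [u,v] - D x [u,v]) \<le> norm (D y [u,v] - D x [u,v] - D x [y - x, u, v]) + norm (D x [y - x, u, v])"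
          by (metis diff_add_cancel norm_triangle_ineq)
        also have "\<dots> \<le> norm (y - x) * (norm u * norm v) + C * (norm (y - x) * (norm u * norm v))"
          using d1(2)[OF y(1) yd, of "[u,v]"] C(2)[of "[y - x, u, v]"] by (intro add_mono) auto
        finally show ?thesis by (simp add: blinfun.bilinear_simps f2[OF x] f2[OF y(1)] algebra_simps)
      qed
      have "norm (f2 y - f2 x) \<le> (C + 1) * norm (y - x)"
        using C(1) b by (intro norm_blinfun_bound) (auto intro!: norm_blinfun_bound)
      also have "\<dots> < e"
      proof -
        have "norm (y - x) < e / (2 * (C + 1))" using y by (simp add: d_def dist_norm)
        then have "(C + 1) * norm (y - x) < (C + 1) * (e / (2 * (C + 1)))" using C(1) by (intro mult_strict_left_mono) auto
        also have "\<dots> = e / 2" using C(1) by (simp add: field_simps)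
        finally show ?thesis using e by simp
      qed
      finally show ?thesis by (simp add: dist_norm)
    qed
    ultimately show "\<exists>d>0. \<forall>y\<in>S. dist y x < d \<longrightarrow> dist (f2 y) (f2 x) < e" by blast
  qed
  ultimately show thesis by (intro that[of f1 f2]) (auto simp: C2_on_def)
qed

text \<open>Mean value inequality for \<open>t \<mapsto> g t - t *\<^sub>R c\<close>. With
  \<open>c = 0\<close> it bounds increments; with \<open>c\<close> the initial velocity it gives a
  second order remainder.\<close>

lemma vector_mean_value_bound:
  fixes g :: "real \<Rightarrow> 'b::real_normed_vector"
  assumes "a \<le> b" and g: "\<And>t. t \<in> {a..b} \<Longrightarrow> (g has_vector_derivative g' t) (at t within {a..b})"
    and B: "\<And>t. t \<in> {a..b} \<Longrightarrow> norm (g' t - c) \<le> B"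
  shows "norm (g b - g a - (b - a) *\<^sub>R c) \<le> B * (b - a)"
proof -
  have "norm ((g b - b *\<^sub>R c) - (g a - a *\<^sub>R c)) \<le> B * norm (b - a)"
  proof (rule differentiable_bound[where S="{a..b}" and f'="\<lambda>t h. h *\<^sub>R (g' t - c)"])
    fix t assume t: "t \<in> {a..b}"
    have "((\<lambda>t. g t - t *\<^sub>R c) has_vector_derivative g' t - 1 *\<^sub>R c) (at t within {a..b})"
      by (intro has_vector_derivative_diff g t has_vector_derivative_scaleR DERIV_ident has_vector_derivative_const | simp)+
         (auto intro!: derivative_eq_intros)
    then show "((\<lambda>t. g t - t *\<^sub>R c) has_derivative (\<lambda>h. h *\<^sub>R (g' t - c))) (at t within {a..b})"
      by (simp add: has_vector_derivative_def)
    show "onorm (\<lambda>h. h *\<^sub>R (g' t - c)) \<le> B"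
      using B[OF t] by (intro onorm_bound)
        (auto simp: mult.commute[of B] intro: mult_left_mono order_trans[OF norm_ge_zero])
  qed (use \<open>a \<le> b\<close> in auto)
  then show ?thesis using \<open>a \<le> b\<close> by (simp add: algebra_simps)
qed

text \<open>The second difference \<open>\<Delta> s u v\<close> is symmetric in \<open>u\<close> and
  \<open>v\<close>, and divided by \<open>s\<^sup>2\<close> it tends to \<open>f2 v u\<close>. The
  mean value inequality is applied to one of the two differences, so the derivative of
  \<open>f1\<close> enters at the single point \<open>x\<close>.\<close>

lemma second_derivative_symmetric:
  fixes f :: "'a::real_normed_vector \<Rightarrow> 'b::real_normed_vector"
  assumes S: "open S" "x \<in> S" and f: "\<And>y. y \<in> S \<Longrightarrow> (f has_derivative blinfun_apply (f1 y)) (at y)"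
    and f1: "(f1 has_derivative blinfun_apply f2) (at x)"
  shows "f2 u v = f2 v u"
proof -
  define \<Delta> where "\<Delta> s u v = f (x + s *\<^sub>R u + s *\<^sub>R v) - f (x + s *\<^sub>R u) - f (x + s *\<^sub>R v) + f x" for s :: real and u v
  have main: "\<exists>d>0. \<forall>s. 0 < s \<and> s < d \<longrightarrow> norm (\<Delta> s u v - s\<^sup>2 *\<^sub>R f2 v u) \<le> e * s\<^sup>2" if e: "e > 0" for e u v
  proof -
    define K where "K = norm u + norm v + 1"
    have K: "K \<ge> 1" by (simp add: K_def)
    \<comment> \<open>Two remainders of size at most e' s K, applied to a vector of norm at most K,
      have to add up to e s.\<close>
    define e' where "e' = e / (2 * K * K)"
    have e': "e' > 0" using e K by (simp add: e'_def)
    obtain d1 where d1: "d1 > 0" "\<And>y. norm (y - x) < d1 \<Longrightarrow> norm (f1 y - f1 x - f2 (y - x)) \<le> e' * norm (y - x)"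
      using f1 e' unfolding has_derivative_at_alt by metis
    obtain d2 where d2: "d2 > 0" "\<And>y. norm (y - x) < d2 \<Longrightarrow> y \<in> S"
      using S by (auto simp: open_dist dist_norm)
    have "norm (\<Delta> s u v - s\<^sup>2 *\<^sub>R f2 v u) \<le> e * s\<^sup>2" if s: "0 < s" "s < min d1 d2 / K" for s
    proof -
      have sK: "s * K < min d1 d2" using s K by (simp add: pos_less_divide_eq)
      define g where "g t = f (x + t *\<^sub>R u + s *\<^sub>R v) - f (x + t *\<^sub>R u)" for t
      define g' where "g' t = f1 (x + t *\<^sub>R u + s *\<^sub>R v) u - f1 (x + t *\<^sub>R u) u" for t
      have near: "norm (t *\<^sub>R u + r *\<^sub>R v) \<le> s * K" if "0 \<le> t" "t \<le> s" "0 \<le> r" "r \<le> s" for t r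
      proof -
        have "norm (t *\<^sub>R u + r *\<^sub>R v) \<le> t * norm u + r * norm v" using that norm_triangle_ineq[of "t *\<^sub>R u" "r *\<^sub>R v"] by simp
        also have "\<dots> \<le> s * norm u + s * norm v" using that by (intro add_mono mult_right_mono) auto
        also have "\<dots> \<le> s * K" using s by (simp add: K_def algebra_simps)
        finally show ?thesis .
      qed
      have "norm (g s - g 0 - (s - 0) *\<^sub>R (s *\<^sub>R f2 v u)) \<le> (e * s) * (s - 0)"
      proof (rule vector_mean_value_bound[where g'=g'])
        fix t assume t: "t \<in> {0..s}"
        have n1: "norm (t *\<^sub>R u + s *\<^sub>R v) \<le> s * K" and n2: "norm (t *\<^sub>R u) \<le> s * K"
          using near[of t s] near[of t 0] t s by auto
        have inS: "x + t *\<^sub>R u + s *\<^sub>R v \<in> S" "x + t *\<^sub>R u \<in> S"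
          using n1 n2 sK by (auto intro!: d2(2) simp: add.assoc)
        have "((\<lambda>t. f (x + t *\<^sub>R u + s *\<^sub>R v)) has_derivative (\<lambda>h. f1 (x + t *\<^sub>R u + s *\<^sub>R v) (h *\<^sub>R u))) (at t within {0..s})"
          by (rule has_derivative_compose[of "\<lambda>t. x + t *\<^sub>R u + s *\<^sub>R v" _ t _ f, OF _ f[OF inS(1)]]) (auto intro!: derivative_eq_intros)
        moreover have "((\<lambda>t. f (x + t *\<^sub>R u)) has_derivative (\<lambda>h. f1 (x + t *\<^sub>R u) (h *\<^sub>R u))) (at t within {0..s})"
          by (rule has_derivative_compose[of "\<lambda>t. x + t *\<^sub>R u" _ t _ f, OF _ f[OF inS(2)]]) (auto intro!: derivative_eq_intros)
        ultimately show "(g has_vector_derivative g' t) (at t within {0..s})"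
          unfolding g_def g'_def has_vector_derivative_def
          by (rule has_derivative_eq_rhs[OF has_derivative_diff]) (auto simp: blinfun.bilinear_simps algebra_simps)
        define A1 where "A1 = f1 (x + t *\<^sub>R u + s *\<^sub>R v) - f1 x - f2 (t *\<^sub>R u + s *\<^sub>R v)"
        define A2 where "A2 = f1 (x + t *\<^sub>R u) - f1 x - f2 (t *\<^sub>R u)"
        have "norm u \<le> K" by (simp add: K_def)
        have A1: "norm A1 \<le> e' * (s * K)"
        proof (rule order_trans)
          show "norm A1 \<le> e' * norm (t *\<^sub>R u + s *\<^sub>R v)"
            using d1(2)[of "x + t *\<^sub>R u + s *\<^sub>R v"] n1 sK by (simp add: A1_def add.assoc)
        qed (use n1 e' in \<open>intro mult_left_mono, auto\<close>)
        have A2: "norm A2 \<le> e' * (s * K)"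
        proof (rule order_trans)
          show "norm A2 \<le> e' * norm (t *\<^sub>R u)" using d1(2)[of "x + t *\<^sub>R u"] n2 sK by (simp add: A2_def)
        qed (use n2 e' in \<open>intro mult_left_mono, auto\<close>)
        have "g' t - s *\<^sub>R f2 v u = (A1 - A2) u"
          by (simp add: g'_def A1_def A2_def blinfun.bilinear_simps)
        moreover have "norm ((A1 - A2) u) \<le> (norm A1 + norm A2) * norm u"
          by (rule order_trans[OF norm_blinfun]) (intro mult_right_mono norm_triangle_ineq4 norm_ge_zero)
        moreover have "(norm A1 + norm A2) * norm u \<le> (e' * (s * K) + e' * (s * K)) * K"
          using A1 A2 e' s K \<open>norm u \<le> K\<close> by (intro mult_mono add_mono) auto
        ultimately have "norm (g' t - s *\<^sub>R f2 v u) \<le> (e' * (s * K) + e' * (s * K)) * K"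
          by simp
        also have "\<dots> = e * s" using K by (simp add: e'_def field_simps)
        finally show "norm (g' t - s *\<^sub>R f2 v u) \<le> e * s" .
      qed (use s in auto)
      moreover have "g s - g 0 = \<Delta> s u v" by (simp add: g_def \<Delta>_def)
      ultimately show ?thesis by (simp add: power2_eq_square algebra_simps)
    qed
    moreover have "min d1 d2 / K > 0" using d1 d2 K by simp
    ultimately show ?thesis by blast
  qed
  have sym: "\<Delta> s u v = \<Delta> s v u" for s by (simp add: \<Delta>_def algebra_simps)
  have "norm (f2 v u - f2 u v) \<le> e" if e: "e > 0" for e
  proof -
    obtain d1 where d1: "d1 > 0" "\<And>s. 0 < s \<Longrightarrow> s < d1 \<Longrightarrow> norm (\<Delta> s u v - s\<^sup>2 *\<^sub>R f2 v u) \<le> e/2 * s\<^sup>2"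
      using main[of "e/2" u v] e by auto
    obtain d2 where d2: "d2 > 0" "\<And>s. 0 < s \<Longrightarrow> s < d2 \<Longrightarrow> norm (\<Delta> s v u - s\<^sup>2 *\<^sub>R f2 u v) \<le> e/2 * s\<^sup>2"
      using main[of "e/2" v u] e by auto
    define s where "s = min d1 d2 / 2"
    have s: "0 < s" "s < d1" "s < d2" using d1 d2 by (auto simp: s_def)
    have "s\<^sup>2 *\<^sub>R (f2 v u - f2 u v) = (\<Delta> s v u - s\<^sup>2 *\<^sub>R f2 u v) - (\<Delta> s u v - s\<^sup>2 *\<^sub>R f2 v u)"
      by (simp add: sym scaleR_diff_right)
    then have "norm (s\<^sup>2 *\<^sub>R (f2 v u - f2 u v)) \<le> norm (\<Delta> s v u - s\<^sup>2 *\<^sub>R f2 u v) + norm (\<Delta> s u v - s\<^sup>2 *\<^sub>R f2 v u)"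
      by (metis norm_triangle_ineq4)
    also have "\<dots> \<le> e/2 * s\<^sup>2 + e/2 * s\<^sup>2" using d1(2) d2(2) s by (intro add_mono) auto
    finally have "s\<^sup>2 * norm (f2 v u - f2 u v) \<le> s\<^sup>2 * e" by (simp add: mult.commute)
    then show ?thesis using s by simp
  qed
  then have "norm (f2 v u - f2 u v) \<le> 0 + e" if "0 < e" for e using that by simp
  from field_le_epsilon[OF this] show ?thesis by simp
qed

section \<open>Second order equations with quadratic right-hand side\<close>

text \<open>
  As \<open>q\<close> is quadratic in the velocity, the integral operator on velocities of size \<open>2 * \<beta>\<close> is a
  contraction on the whole unit interval once \<open>\<beta>\<close> is small; the same estimate gives uniqueness,
  so no Gronwall argument is needed.
\<close>

locale second_order_ode =
  fixes q :: "'h::banach \<Rightarrow> 'h \<Rightarrow> 'h" and z0 :: 'h and C R \<beta> :: real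
  assumes C: "C > 0" and \<beta>: "0 < \<beta>" "2 * \<beta> \<le> 1" "2 * \<beta> \<le> R" "32 * C * \<beta> \<le> 1"
    and lipschitz: "\<And>x y u w. x \<in> cball z0 R \<Longrightarrow> y \<in> cball z0 R \<Longrightarrow> norm u \<le> 1 \<Longrightarrow> norm w \<le> 1 \<Longrightarrow>
      norm (q x u - q y w) \<le> C * (norm (x - y) + norm (u - w)) * (norm u + norm w)"
    and bound: "\<And>x u. x \<in> cball z0 R \<Longrightarrow> norm (q x u) \<le> C * (norm u)\<^sup>2"
begin

text \<open>The speed bound is part of the notion: it keeps the position in the ball where
  \<open>q\<close> is controlled, and uniqueness is claimed among such solutions. Geodesics are
  shown to satisfy it afterwards.\<close>

definition solution :: "'h \<Rightarrow> (real \<Rightarrow> 'h) \<Rightarrow> (real \<Rightarrow> 'h) \<Rightarrow> bool" where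
  "solution v x u \<longleftrightarrow> x 0 = z0 \<and> u 0 = v \<and> (\<forall>t\<in>{0..1}. norm (u t) \<le> 2 * \<beta> \<and>
     (x has_vector_derivative u t) (at t within {0..1}) \<and>
     (u has_vector_derivative q (x t) (u t)) (at t within {0..1}))"

lemma solution_derivatives:
  assumes "solution v x u" "t \<in> {0..1}" "s \<in> {0..t}"
  shows "(x has_vector_derivative u s) (at s within {0..t})"
    "(u has_vector_derivative q (x s) (u s)) (at s within {0..t})"
  using assms unfolding solution_def by (auto intro: has_vector_derivative_within_subset[of _ _ _ "{0..1}"])

lemma solution_continuous:
  assumes "solution v x u"
  shows "continuous_on {0..1} u"
  using assms unfolding solution_def by (intro continuous_on_vector_derivative) blast

lemma solution_stays:
  assumes "solution v x u" "t \<in> {0..1}"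
  shows "x t \<in> cball z0 (2 * \<beta>)"
proof -
  have "norm (x t - x 0 - (t - 0) *\<^sub>R 0) \<le> 2 * \<beta> * (t - 0)"
    by (rule vector_mean_value_bound[where g'=u])
       (use assms in \<open>auto simp: solution_def intro!: solution_derivatives[OF assms]\<close>)
  also have "\<dots> \<le> 2 * \<beta> * 1" using assms \<beta> by (intro mult_left_mono) auto
  finally show ?thesis using assms by (simp add: solution_def dist_norm norm_minus_commute)
qed

text \<open>At a time where the velocities differ most, by \<open>?M\<close>, the positions differ
  by at most \<open>?M\<close> throughout; integrating the equation gives
  \<open>?M \<le> ?M / 4\<close>.\<close>

lemma solution_unique:
  assumes s: "solution v x u" and s': "solution v x' u'"
  shows "x 1 = x' 1"
proof -
  have cont: "continuous_on {0..1} (\<lambda>t. norm (u t - u' t))"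
    by (intro continuous_intros solution_continuous[OF s] solution_continuous[OF s'])
  obtain t where t: "t \<in> {0..1}" "\<And>r. r \<in> {0..1} \<Longrightarrow> norm (u r - u' r) \<le> norm (u t - u' t)"
    using continuous_attains_sup[OF _ _ cont] by auto
  let ?M = "norm (u t - u' t)"
  have X: "norm (x r - x' r) \<le> ?M" if r: "r \<in> {0..1}" for r
  proof -
    have "norm ((\<lambda>t. x t - x' t) r - (\<lambda>t. x t - x' t) 0 - (r - 0) *\<^sub>R 0) \<le> ?M * (r - 0)"
      by (rule vector_mean_value_bound[where g'="\<lambda>t. u t - u' t"])
         (use t r in \<open>auto intro!: has_vector_derivative_diff solution_derivatives[OF s r] solution_derivatives[OF s' r]\<close>)
    also have "\<dots> \<le> ?M * 1" using r by (intro mult_left_mono) auto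
    finally show ?thesis using s s' by (simp add: solution_def)
  qed
  have "norm ((\<lambda>t. u t - u' t) t - (\<lambda>t. u t - u' t) 0 - (t - 0) *\<^sub>R 0) \<le> (?M / 4) * (t - 0)"
  proof (rule vector_mean_value_bound[where g'="\<lambda>t. q (x t) (u t) - q (x' t) (u' t)"])
    fix r assume "r \<in> {0..t}"
    then have r: "r \<in> {0..1}" using t by auto
    show "((\<lambda>t. u t - u' t) has_vector_derivative q (x r) (u r) - q (x' r) (u' r)) (at r within {0..t})"
      using \<open>r \<in> {0..t}\<close>
      by (intro has_vector_derivative_diff solution_derivatives[OF s t(1)] solution_derivatives[OF s' t(1)])
    have n: "norm (u r) \<le> 2 * \<beta>" "norm (u' r) \<le> 2 * \<beta>" using s s' r by (auto simp: solution_def)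
    have "norm (q (x r) (u r) - q (x' r) (u' r)) \<le> C * (norm (x r - x' r) + norm (u r - u' r)) * (norm (u r) + norm (u' r))"
      by (rule lipschitz) (use solution_stays[OF s r] solution_stays[OF s' r] n \<beta> in auto)
    also have "\<dots> \<le> C * (?M + ?M) * (2 * \<beta> + 2 * \<beta>)"
      using X[OF r] t(2)[OF r] n C by (intro mult_mono add_mono) auto
    \<comment> \<open>The Lipschitz bound amounts to 8 C \<beta> times \<open>?M\<close>; the 32 in
      the locale turns it into a quarter of \<open>?M\<close>.\<close>
    also have "\<dots> = (32 * C * \<beta>) * (?M / 4)" by simp
    also have "\<dots> \<le> 1 * (?M / 4)" using \<beta> by (intro mult_right_mono) auto
    finally show "norm (q (x r) (u r) - q (x' r) (u' r) - 0) \<le> ?M / 4" by simp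
  qed (use t in auto)
  also have "\<dots> \<le> (?M / 4) * 1" using t by (intro mult_left_mono) auto
  finally have "?M = 0" using s s' by (simp add: solution_def)
  then show ?thesis using X[of 1] by simp
qed

text \<open>In a chart this becomes the second order expansion of the exponential map. The maximal
  speed satisfies \<open>?M \<le> ?M / 16 + norm v\<close>, hence is at most twice the initial
  speed, and the quadratic bound on \<open>q\<close> does the rest.\<close>

lemma solution_estimate:
  assumes s: "solution v x u"
  shows "norm (x 1 - z0 - v) \<le> 4 * C * (norm v)\<^sup>2"
proof -
  have cont: "continuous_on {0..1} (\<lambda>t. norm (u t))"
    by (intro continuous_intros solution_continuous[OF s])
  obtain t where t: "t \<in> {0..1}" "\<And>r. r \<in> {0..1} \<Longrightarrow> norm (u r) \<le> norm (u t)"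
    using continuous_attains_sup[OF _ _ cont] by auto
  let ?M = "norm (u t)"
  have U: "norm (u r - v) \<le> C * ?M\<^sup>2" if r: "r \<in> {0..1}" for r
  proof -
    have "norm (u r - u 0 - (r - 0) *\<^sub>R 0) \<le> C * ?M\<^sup>2 * (r - 0)"
    proof (rule vector_mean_value_bound[where g'="\<lambda>t. q (x t) (u t)"])
      fix y assume "y \<in> {0..r}"
      then have y: "y \<in> {0..1}" using r by auto
      show "(u has_vector_derivative q (x y) (u y)) (at y within {0..r})"
        by (rule solution_derivatives[OF s r \<open>y \<in> {0..r}\<close>])
      have "norm (q (x y) (u y)) \<le> C * (norm (u y))\<^sup>2"
        by (rule bound) (use solution_stays[OF s y] \<beta> in auto)
      also have "\<dots> \<le> C * ?M\<^sup>2" using C t(2)[OF y] by (intro mult_left_mono power_mono) auto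
      finally show "norm (q (x y) (u y) - 0) \<le> C * ?M\<^sup>2" by simp
    qed (use r in auto)
    also have "\<dots> \<le> C * ?M\<^sup>2 * 1" using r C by (intro mult_left_mono) auto
    finally show ?thesis using s by (simp add: solution_def)
  qed
  have "?M \<le> norm (u t - v) + norm v" by (metis diff_add_cancel norm_triangle_ineq)
  also have "\<dots> \<le> C * ?M\<^sup>2 + norm v" using U[OF t(1)] by simp
  also have "C * ?M\<^sup>2 \<le> C * (2 * \<beta>) * ?M"
  proof -
    have "?M \<le> 2 * \<beta>" using s t(1) unfolding solution_def by blast
    then have "?M * ?M \<le> (2 * \<beta>) * ?M" by (rule mult_right_mono) simp
    then show ?thesis using C by (simp add: power2_eq_square mult.assoc)
  qed
  also have "C * (2 * \<beta>) * ?M = (32 * C * \<beta>) * (?M / 16)" by simp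
  also have "\<dots> \<le> 1 * (?M / 16)" using \<beta> by (intro mult_right_mono) auto
  finally have "?M \<le> 1 * (?M / 16) + norm v" by simp
  then have M: "?M \<le> 2 * norm v" using norm_ge_zero[of v] by linarith
  have "norm (x 1 - x 0 - (1 - 0) *\<^sub>R v) \<le> C * ?M\<^sup>2 * (1 - 0)"
    by (rule vector_mean_value_bound[where g'=u]) (use s U in \<open>auto simp: solution_def\<close>)
  also have "\<dots> \<le> C * (2 * norm v)\<^sup>2 * (1 - 0)"
    using M C by (intro mult_right_mono mult_left_mono power_mono) auto
  finally show ?thesis using s by (simp add: solution_def power_mult_distrib)
qed

lemma continuous_on_rhs:
  assumes x: "continuous_on T x" "\<And>t. t \<in> T \<Longrightarrow> x t \<in> cball z0 R"
    and u: "continuous_on T u" "\<And>t. t \<in> T \<Longrightarrow> norm (u t) \<le> 1"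
  shows "continuous_on T (\<lambda>t. q (x t) (u t))"
  unfolding continuous_on_def
proof
  fix t assume t: "t \<in> T"
  have "((\<lambda>s. q (x s) (u s) - q (x t) (u t)) \<longlongrightarrow> 0) (at t within T)"
  proof (rule Lim_null_comparison)
    show "\<forall>\<^sub>F s in at t within T. norm (q (x s) (u s) - q (x t) (u t)) \<le> C * (norm (x s - x t) + norm (u s - u t)) * 2"
      unfolding eventually_at_filter
    proof (intro always_eventually allI impI)
      fix s assume s: "s \<in> T"
      have "norm (q (x s) (u s) - q (x t) (u t)) \<le> C * (norm (x s - x t) + norm (u s - u t)) * (norm (u s) + norm (u t))"
        by (rule lipschitz) (use s t x u in auto)
      also have "\<dots> \<le> C * (norm (x s - x t) + norm (u s - u t)) * 2"
        using u(2)[OF s] u(2)[OF t] C by (intro mult_left_mono) auto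
      finally show "norm (q (x s) (u s) - q (x t) (u t)) \<le> C * (norm (x s - x t) + norm (u s - u t)) * 2" .
    qed
    have "((\<lambda>s. x s - x t) \<longlongrightarrow> 0) (at t within T)" "((\<lambda>s. u s - u t) \<longlongrightarrow> 0) (at t within T)"
      using x(1) u(1) t by (auto simp: continuous_on_def intro!: LIM_zero)
    then show "((\<lambda>s. C * (norm (x s - x t) + norm (u s - u t)) * 2) \<longlongrightarrow> 0) (at t within T)"
      by (auto intro!: tendsto_mult_left_zero tendsto_mult_right_zero tendsto_add_zero tendsto_norm_zero)
  qed
  then show "((\<lambda>t. q (x t) (u t)) \<longlongrightarrow> q (x t) (u t)) (at t within T)" by (rule LIM_zero_cancel)
qed

text \<open>Banach's fixed point theorem for the velocity alone, the position being its integral.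
  Velocities are bounded continuous functions on the whole line, of which the values on the unit
  interval matter.\<close>

lemma solution_exists:
  assumes v: "norm v \<le> \<beta>"
  obtains x u where "solution v x u"
proof -
  define S :: "(real \<Rightarrow>\<^sub>C 'h) set" where "S = {u. \<forall>t. norm (apply_bcontfun u t) \<le> 2 * \<beta>}"
  define X where "X u t = z0 + integral {0..t} (apply_bcontfun u)" for u :: "real \<Rightarrow>\<^sub>C 'h" and t :: real
  define r where "r u t = q (X u t) (u t)" for u :: "real \<Rightarrow>\<^sub>C 'h" and t :: real
  \<comment> \<open>Clamping the time makes \<open>\<Phi> u\<close> bounded and continuous on the
    whole line, although the position is known to stay in the ball only for times in the unit
    interval.\<close>
  define cl :: "real \<Rightarrow> real" where "cl t = max 0 (min 1 t)" for t
  define \<Phi> where "\<Phi> u = Bcontfun (\<lambda>t. v + integral {0..cl t} (r u))" for u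
  have cl: "cl t \<in> {0..1}" for t by (auto simp: cl_def)
  have cl_id: "cl t = t" if "t \<in> {0..1}" for t using that by (auto simp: cl_def)
  have int_u: "(apply_bcontfun u) integrable_on {a..b}" for u :: "real \<Rightarrow>\<^sub>C 'h" and a b :: real
    by (intro integrable_continuous_real continuous_on_apply_bcontfun)
  have Xball: "X u t \<in> cball z0 R" if u: "u \<in> S" and t: "t \<in> {0..1}" for u t
  proof -
    have "norm (integral {0..t} (apply_bcontfun u)) \<le> 2 * \<beta> * (t - 0)"
      using u t by (intro integral_bound) (auto simp: S_def)
    also have "\<dots> \<le> 2 * \<beta> * 1" using \<beta> t by (intro mult_left_mono) auto
    finally show ?thesis using \<beta> by (simp add: X_def dist_norm)
  qed
  have Sle: "norm (apply_bcontfun u t) \<le> 1" if "u \<in> S" for u t using that \<beta> by (auto simp: S_def intro: order_trans)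
  have r_cont: "continuous_on {0..1} (r u)" if u: "u \<in> S" for u
    unfolding r_def
    by (rule continuous_on_rhs)
       (use u Xball Sle in \<open>auto simp: X_def intro!: continuous_intros indefinite_integral_continuous_1 int_u\<close>)
  have r_cont': "continuous_on {0..cl t} (r u)" if "u \<in> S" for u t
    using r_cont[OF that] by (rule continuous_on_subset) (use cl[of t] in auto)
  have r_bound: "norm (r u t) \<le> \<beta> / 8" if u: "u \<in> S" and t: "t \<in> {0..1}" for u t
  proof -
    have "norm (r u t) \<le> C * (norm (apply_bcontfun u t))\<^sup>2" unfolding r_def by (rule bound[OF Xball[OF u t]])
    also have "\<dots> \<le> C * (2 * \<beta>)\<^sup>2" using C u by (intro mult_left_mono power_mono) (auto simp: S_def)
    also have "\<dots> = (32 * C * \<beta>) * (\<beta> / 8)" by (simp add: power2_eq_square)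
    also have "\<dots> \<le> 1 * (\<beta> / 8)" using \<beta> by (intro mult_right_mono) auto
    finally show ?thesis by simp
  qed
  have int_bound: "norm (integral {0..cl t} f) \<le> B" if "continuous_on {0..cl t} f" "\<And>s. s \<in> {0..1} \<Longrightarrow> norm (f s) \<le> B"
    for f :: "real \<Rightarrow> 'h" and t B
  proof -
    have "norm (integral {0..cl t} f) \<le> B * (cl t - 0)"
      using that cl[of t] by (intro integral_bound) auto
    also have "\<dots> \<le> B * 1" using cl[of t] that(2)[of 0] norm_ge_zero[of "f 0"] by (intro mult_left_mono) (auto simp del: norm_ge_zero)
    finally show ?thesis by simp
  qed
  have val_bound: "norm (v + integral {0..cl t} (r u)) \<le> 2 * \<beta>" if "u \<in> S" for u t
    using norm_triangle_ineq[of v "integral {0..cl t} (r u)"] v int_bound[OF r_cont'[OF that] r_bound[OF that], where t=t] \<beta>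
    by auto
  have \<Phi>: "\<Phi> u t = v + integral {0..cl t} (r u)" if u: "u \<in> S" for u t
  proof -
    have "continuous_on UNIV (\<lambda>t. integral {0..cl t} (r u))"
      by (rule continuous_on_compose2[OF indefinite_integral_continuous_1[OF integrable_continuous_real[OF r_cont[OF u]]]])
         (auto simp: cl_def intro!: continuous_intros)
    then have "(\<lambda>t. v + integral {0..cl t} (r u)) \<in> bcontfun"
      using val_bound[OF u] by (intro bcontfun_normI continuous_intros)
    then show ?thesis by (simp add: \<Phi>_def Bcontfun_inverse)
  qed
  have "S = PiC UNIV (\<lambda>_. cball 0 (2 * \<beta>))" by (auto simp: S_def mem_PiC_iff Pi_iff)
  then have "closed S" by (simp add: closed_PiC)
  then have "complete S" by (simp add: complete_eq_closed)
  moreover have "S \<noteq> {}" using \<beta> by (auto simp: S_def intro!: exI[of _ 0])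
  moreover have "\<Phi> ` S \<subseteq> S" using val_bound by (auto simp: S_def[symmetric] \<Phi>) (auto simp: S_def \<Phi>)
  moreover have "dist (\<Phi> u) (\<Phi> w) \<le> 1/2 * dist u w" if u: "u \<in> S" and w: "w \<in> S" for u w
  proof (rule dist_bound)
    fix t
    let ?d = "dist u w"
    have uw: "norm (apply_bcontfun u s - apply_bcontfun w s) \<le> ?d" for s
      using dist_bounded[of u s w] by (simp add: dist_norm)
    have diff: "norm (r u s - r w s) \<le> 1/2 * ?d" if s: "s \<in> {0..1}" for s
    proof -
      have "X u s - X w s = integral {0..s} (\<lambda>t. apply_bcontfun u t - apply_bcontfun w t)"
        by (simp add: X_def integral_diff int_u)
      also have "norm \<dots> \<le> ?d * (s - 0)"
        using s uw by (intro integral_bound) (auto intro!: continuous_intros)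
      also have "\<dots> \<le> ?d * 1" using s by (intro mult_left_mono) auto
      finally have XX: "norm (X u s - X w s) \<le> ?d" by simp
      have "norm (r u s - r w s) \<le> C * (norm (X u s - X w s) + norm (apply_bcontfun u s - apply_bcontfun w s)) * (norm (apply_bcontfun u s) + norm (apply_bcontfun w s))"
        unfolding r_def by (rule lipschitz) (use Xball Sle u w s in auto)
      also have "\<dots> \<le> C * (?d + ?d) * (2 * \<beta> + 2 * \<beta>)"
        using XX uw[of s] u w C by (intro mult_mono add_mono) (auto simp: S_def)
      also have "\<dots> = (32 * C * \<beta>) * (?d / 4)" by simp
      also have "\<dots> \<le> 1 * (?d / 4)" using \<beta> by (intro mult_right_mono) auto
      also have "\<dots> \<le> 1/2 * ?d" by simp
      finally show ?thesis .
    qed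
    have "apply_bcontfun (\<Phi> u) t - apply_bcontfun (\<Phi> w) t = integral {0..cl t} (\<lambda>s. r u s - r w s)"
      using r_cont'[OF u] r_cont'[OF w] by (simp add: \<Phi> u w integral_diff integrable_continuous_real)
    also have "norm \<dots> \<le> 1/2 * ?d"
      by (rule int_bound[OF _ diff]) (intro continuous_intros r_cont' u w)
    finally show "dist (apply_bcontfun (\<Phi> u) t) (apply_bcontfun (\<Phi> w) t) \<le> 1/2 * ?d" by (simp add: dist_norm)
  qed
  ultimately have "\<exists>!u\<in>S. \<Phi> u = u" by (intro Banach_fix[of S "1/2"]) auto
  then obtain u where u: "u \<in> S" "\<Phi> u = u" by blast
  have eq: "apply_bcontfun u t = v + integral {0..t} (r u)" if "t \<in> {0..1}" for t
    using \<Phi>[OF u(1), of t] u(2) cl_id[OF that] by simp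
  have "solution v (X u) u"
    unfolding solution_def
  proof (intro conjI ballI)
    show "X u 0 = z0" by (simp add: X_def)
    show "apply_bcontfun u 0 = v" by (simp add: eq)
    fix t :: real assume t: "t \<in> {0..1}"
    show "norm (apply_bcontfun u t) \<le> 2 * \<beta>" using u by (simp add: S_def)
    have "((\<lambda>t. z0 + integral {0..t} (apply_bcontfun u)) has_vector_derivative 0 + apply_bcontfun u t) (at t within {0..1})"
      by (intro has_vector_derivative_add has_vector_derivative_const integral_has_vector_derivative t) auto
    then show "(X u has_vector_derivative apply_bcontfun u t) (at t within {0..1})" by (simp add: X_def[abs_def])
    have "((\<lambda>t. v + integral {0..t} (r u)) has_vector_derivative 0 + r u t) (at t within {0..1})"
      by (intro has_vector_derivative_add has_vector_derivative_const integral_has_vector_derivative t r_cont u)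
    then show "(apply_bcontfun u has_vector_derivative q (X u t) (apply_bcontfun u t)) (at t within {0..1})"
      by (intro has_vector_derivative_transform[OF t eq]) (auto simp: r_def)
  qed
  then show thesis by (rule that)
qed

end

section \<open>Curves and the Riemannian distance\<close>

context hilbert_manifold
begin

lemma chart_inv_coord [simp]: "c \<in> \<A> \<Longrightarrow> p \<in> chart_dom c \<Longrightarrow> chart_inv c (coord c p) = p"
  using chart_homeomorphism by (simp add: homeomorphism_def)

lemma coord_chart_inv [simp]: "c \<in> \<A> \<Longrightarrow> x \<in> chart_ran c \<Longrightarrow> coord c (chart_inv c x) = x"
  using chart_homeomorphism by (simp add: homeomorphism_def)

lemma chart_inv_in_dom [simp]: "c \<in> \<A> \<Longrightarrow> x \<in> chart_ran c \<Longrightarrow> chart_inv c x \<in> chart_dom c"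
  using chart_homeomorphism by (force simp: homeomorphism_def)

lemma coord_in_ran [simp]: "p \<in> chart_dom c \<Longrightarrow> coord c p \<in> chart_ran c"
  by (simp add: chart_ran_def)

lemma continuous_on_coord: "c \<in> \<A> \<Longrightarrow> continuous_on (chart_dom c) (coord c)"
  using chart_homeomorphism by (simp add: homeomorphism_def)

lemma continuous_on_chart_inv: "c \<in> \<A> \<Longrightarrow> continuous_on (chart_ran c) (chart_inv c)"
  using chart_homeomorphism by (simp add: homeomorphism_def)

lemma open_coord_image:
  assumes c: "c \<in> \<A>" and S: "open S" "S \<subseteq> chart_dom c"
  shows "open (coord c ` S)"
proof -
  have "coord c ` S = chart_ran c \<inter> chart_inv c -` S"
    using c S by (force simp: chart_ran_def)
  then show ?thesis using continuous_open_preimage[OF continuous_on_chart_inv[OF c] open_chart_ran[OF c] S(1)] by simp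
qed

lemma open_coord_preimage:
  assumes c: "c \<in> \<A>" and S: "open S"
  shows "open {p \<in> chart_dom c. coord c p \<in> S}"
  using continuous_open_preimage[OF continuous_on_coord[OF c] open_chart_dom[OF c] S]
  by (simp add: Int_def vimage_def)

lemma chart_at: "chart_at \<A> p \<in> \<A>" "p \<in> chart_dom (chart_at \<A> p)"
proof -
  have "\<exists>c. c \<in> \<A> \<and> p \<in> chart_dom c" using charts_cover by auto
  from someI_ex[OF this] show "chart_at \<A> p \<in> \<A>" "p \<in> chart_dom (chart_at \<A> p)" by (auto simp: chart_at_def)
qed

definition overlap :: "('m, 'h) chart \<Rightarrow> ('m, 'h) chart \<Rightarrow> 'h set" where
  "overlap c c' = coord c ` (chart_dom c \<inter> chart_dom c')"

text \<open>Chosen from a \<open>C2_on\<close> witness, so that it is a bounded linear map by type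
  and can be differentiated again. On the open set \<open>overlap c c'\<close> it is the derivative
  of the transition map; elsewhere it is arbitrary.\<close>

definition trans_deriv :: "('m, 'h) chart \<Rightarrow> ('m, 'h) chart \<Rightarrow> 'h \<Rightarrow> 'h \<Rightarrow>\<^sub>L 'h" where
  "trans_deriv c c' = (SOME f1. \<exists>f2. C2_on (overlap c c') (transition c c') f1 f2)"

definition trans_deriv2 :: "('m, 'h) chart \<Rightarrow> ('m, 'h) chart \<Rightarrow> 'h \<Rightarrow> 'h \<Rightarrow>\<^sub>L ('h \<Rightarrow>\<^sub>L 'h)" where
  "trans_deriv2 c c' = (SOME f2. C2_on (overlap c c') (transition c c') (trans_deriv c c') f2)"

lemma open_overlap: "c \<in> \<A> \<Longrightarrow> c' \<in> \<A> \<Longrightarrow> open (overlap c c')"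
  unfolding overlap_def by (intro open_coord_image) (auto intro: open_chart_dom)

lemma coord_in_overlap: "p \<in> chart_dom c \<Longrightarrow> p \<in> chart_dom c' \<Longrightarrow> coord c p \<in> overlap c c'"
  by (simp add: overlap_def)

lemma C2_on_transition:
  assumes "c \<in> \<A>" "c' \<in> \<A>"
  shows "C2_on (overlap c c') (transition c c') (trans_deriv c c') (trans_deriv2 c c')"
proof -
  have "\<exists>f1 f2. C2_on (overlap c c') (transition c c') f1 f2"
    using smooth_on_imp_C2_on[OF open_overlap[OF assms]] smooth_transition[OF assms] unfolding overlap_def by metis
  then have "\<exists>f2. C2_on (overlap c c') (transition c c') (trans_deriv c c') f2"
    unfolding trans_deriv_def by (rule someI_ex)
  then show ?thesis unfolding trans_deriv2_def by (rule someI_ex)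
qed

lemma transition_coord [simp]:
  "c \<in> \<A> \<Longrightarrow> p \<in> chart_dom c \<Longrightarrow> transition c c' (coord c p) = coord c' p"
  by (simp add: transition_def)

lemma transition_has_derivative:
  assumes "c \<in> \<A>" "c' \<in> \<A>" "x \<in> overlap c c'"
  shows "(transition c c' has_derivative blinfun_apply (trans_deriv c c' x)) (at x)"
    "(trans_deriv c c' has_derivative blinfun_apply (trans_deriv2 c c' x)) (at x)"
  using C2_on_transition[OF assms(1,2)] assms(3) by (auto simp: C2_on_def)

lemma trans_deriv2_sym:
  assumes "c \<in> \<A>" "c' \<in> \<A>" "x \<in> overlap c c'"
  shows "trans_deriv2 c c' x u v = trans_deriv2 c c' x v u"
  using second_derivative_symmetric[OF open_overlap[OF assms(1,2)] assms(3)] transition_has_derivative[OF assms(1,2)] assms(3)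
  by blast

text \<open>Chain rule for the two transition maps, whose composition is the identity near the
  point. It shows that every vector is the image of a test vector under a change of chart.\<close>

lemma trans_deriv_inverse:
  assumes "c \<in> \<A>" "c' \<in> \<A>" "p \<in> chart_dom c" "p \<in> chart_dom c'"
  shows "trans_deriv c c' (coord c p) (trans_deriv c' c (coord c' p) w) = w"
proof -
  have "(transition c c' \<circ> transition c' c has_derivative
      blinfun_apply (trans_deriv c c' (coord c p)) \<circ> blinfun_apply (trans_deriv c' c (coord c' p))) (at (coord c' p))"
    using transition_has_derivative(1)[of c c' "coord c p"] transition_has_derivative(1)[of c' c "coord c' p"] assms
    by (intro diff_chain_at) (auto intro: coord_in_overlap)
  moreover have "(transition c c' \<circ> transition c' c has_derivative id) (at (coord c' p))"
    by (rule has_derivative_transform_within_open[OF has_derivative_id[unfolded id_def[symmetric]] open_overlap[OF assms(2,1)]])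
       (use assms in \<open>auto simp: coord_in_overlap\<close>, auto simp: overlap_def assms)
  ultimately have "blinfun_apply (trans_deriv c c' (coord c p)) \<circ> blinfun_apply (trans_deriv c' c (coord c' p)) = id"
    by (rule has_derivative_unique)
  then show ?thesis by (metis comp_apply id_apply)
qed

text \<open>The set \<open>J\<close> is arbitrary because curves and geodesics are differentiated
  within the times spent in a chart domain. Continuity keeps nearby times in the first chart, where
  the chain rule applies.\<close>

lemma coord_change_vector_derivative:
  assumes c: "c \<in> \<A>" "c' \<in> \<A>" and p: "\<gamma> t \<in> chart_dom c" "\<gamma> t \<in> chart_dom c'" and t: "t \<in> J"
    and cont: "continuous (at t within J) \<gamma>"
    and d: "((coord c \<circ> \<gamma>) has_vector_derivative v) (at t within J)"
  shows "((coord c' \<circ> \<gamma>) has_vector_derivative trans_deriv c c' (coord c (\<gamma> t)) v) (at t within J)"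
proof -
  have "((transition c c' \<circ> (coord c \<circ> \<gamma>)) has_vector_derivative trans_deriv c c' (coord c (\<gamma> t)) v) (at t within J)"
    by (rule vector_derivative_diff_chain_within[OF d])
       (simp add: has_derivative_at_withinI[OF transition_has_derivative(1)[OF c coord_in_overlap[OF p]]])
  moreover have "\<forall>\<^sub>F s in at t within J. (transition c c' \<circ> (coord c \<circ> \<gamma>)) s = (coord c' \<circ> \<gamma>) s"
  proof -
    have "\<forall>\<^sub>F s in at t within J. \<gamma> s \<in> chart_dom c"
      using cont p c by (auto simp: continuous_within intro: topological_tendstoD open_chart_dom)
    then show ?thesis by eventually_elim (use c in auto)
  qed
  ultimately show ?thesis
    unfolding has_vector_derivative_def
    by (rule has_derivative_transform_eventually) (use c p t in auto)
qed

end

section \<open>The speed of a curve read in a fixed chart\<close>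

context riemannian_manifold
begin

lemma metric_trans:
  assumes "c \<in> \<A>" "c' \<in> \<A>" "p \<in> chart_dom c" "p \<in> chart_dom c'"
  shows "G c' (coord c' p) (trans_deriv c c' (coord c p) u) (trans_deriv c c' (coord c p) v) = G c (coord c p) u v"
  by (rule metric_transform[OF assms])
     (rule frechet_derivative_at[OF transition_has_derivative(1)[OF assms(1,2) coord_in_overlap[OF assms(3,4)]]])

lemma metric_nonneg: "c \<in> \<A> \<Longrightarrow> x \<in> chart_ran c \<Longrightarrow> 0 \<le> G c x u u"
  using metric_coercive[of c x] by (meson mult_nonneg_nonneg less_imp_le order_trans zero_le_power2)

definition metric_norm :: "('m, 'h) chart \<Rightarrow> 'h \<Rightarrow> 'h \<Rightarrow> real" where
  "metric_norm c x u = sqrt (G c x u u)"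

definition speed :: "(real \<Rightarrow> 'm) \<Rightarrow> real \<Rightarrow> real" where
  "speed \<gamma> t = tangent_norm \<A> G (\<gamma> t) (curve_velocity \<A> \<gamma> t)"

lemma tangent_norm_eq:
  assumes "c \<in> \<A>" "p \<in> chart_dom c"
  shows "tangent_norm \<A> G p (trans_deriv c (chart_at \<A> p) (coord c p) u) = metric_norm c (coord c p) u"
  using metric_trans[OF assms(1) chart_at(1) assms(2) chart_at(2)]
  by (simp add: tangent_norm_def tangent_inner_def metric_norm_def)

text \<open>\<open>curve_velocity\<close> uses the chart chosen at the current point, which may jump
  with \<open>t\<close>. Changes of chart are isometric, so one fixed chart can be used
  instead.\<close>

lemma speed_eq:
  assumes c: "c \<in> \<A>" "\<gamma> t \<in> chart_dom c" and "isCont \<gamma> t"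
    and d: "((coord c \<circ> \<gamma>) has_vector_derivative v) (at t)"
  shows "speed \<gamma> t = metric_norm c (coord c (\<gamma> t)) v"
proof -
  have "((coord (chart_at \<A> (\<gamma> t)) \<circ> \<gamma>) has_vector_derivative trans_deriv c (chart_at \<A> (\<gamma> t)) (coord c (\<gamma> t)) v) (at t)"
    by (rule coord_change_vector_derivative) (use assms chart_at in auto)
  then have "curve_velocity \<A> \<gamma> t = trans_deriv c (chart_at \<A> (\<gamma> t)) (coord c (\<gamma> t)) v"
    unfolding curve_velocity_def by (rule vector_derivative_at)
  then show ?thesis by (simp add: speed_def tangent_norm_eq[OF c])
qed

lemma metric_norm_scale: "metric_norm c x (k *\<^sub>R u) = \<bar>k\<bar> * metric_norm c x u"
proof -
  have "G c x (k *\<^sub>R u) (k *\<^sub>R u) = k\<^sup>2 * G c x u u"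
    by (simp add: blinfun.bilinear_simps power2_eq_square)
  then show ?thesis by (simp add: metric_norm_def real_sqrt_mult)
qed

text \<open>The two curves are compared near \<open>t\<close> only, because a concatenation is an
  affine reparametrisation on each half separately.\<close>

lemma speed_affine:
  assumes e: "\<forall>\<^sub>F r in nhds t. \<gamma>' r = \<gamma> (k * r + e)" and c: "c \<in> \<A>" "\<gamma> (k * t + e) \<in> chart_dom c"
    and cont: "isCont \<gamma> (k * t + e)" and d: "((coord c \<circ> \<gamma>) has_vector_derivative v) (at (k * t + e))"
  shows "speed \<gamma>' t = \<bar>k\<bar> * speed \<gamma> (k * t + e)"
proof -
  have t: "\<gamma>' t = \<gamma> (k * t + e)" using e by (rule eventually_nhds_x_imp_x)
  have e': "\<forall>\<^sub>F r in at t. \<gamma>' r = \<gamma> (k * r + e)" using e by (simp add: eventually_nhds_conv_at)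
  have "isCont (\<lambda>r. \<gamma> (k * r + e)) t"
    by (rule isCont_o2[where f="\<lambda>r. k * r + e"]) (use cont in \<open>auto intro!: continuous_intros\<close>)
  then have "isCont \<gamma>' t" by (simp add: isCont_cong[OF e])
  have "((\<lambda>r. k * r + e) has_vector_derivative k) (at t)"
    by (auto intro!: derivative_eq_intros simp flip: has_real_derivative_iff_has_vector_derivative)
  from vector_diff_chain_at[OF this d]
  have "((coord c \<circ> \<gamma>) \<circ> (\<lambda>r. k * r + e) has_vector_derivative k *\<^sub>R v) (at t)" .
  then have "((coord c \<circ> \<gamma>') has_vector_derivative k *\<^sub>R v) (at t)"
    unfolding has_vector_derivative_def
    by (rule has_derivative_transform_eventually) (use e' t in \<open>auto elim: eventually_mono\<close>)
  then have "speed \<gamma>' t = metric_norm c (coord c (\<gamma>' t)) (k *\<^sub>R v)"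
    by (intro speed_eq) (use c t \<open>isCont \<gamma>' t\<close> in auto)
  also have "\<dots> = \<bar>k\<bar> * speed \<gamma> (k * t + e)" by (simp add: t metric_norm_scale speed_eq[OF c cont d])
  finally show ?thesis .
qed

lemma C1_curve_interior:
  assumes g: "C1_curve \<A> a b \<gamma>" and t: "a < t" "t < b" and c: "c \<in> \<A>" "\<gamma> t \<in> chart_dom c"
  obtains x' where "isCont x' t"
    "\<forall>\<^sub>F r in nhds t. \<gamma> r \<in> chart_dom c \<and> isCont \<gamma> r \<and> ((coord c \<circ> \<gamma>) has_vector_derivative x' r) (at r)"
proof -
  define J where "J = {r\<in>{a..b}. \<gamma> r \<in> chart_dom c}"
  obtain x' where x': "continuous_on J x'"
    "\<And>r. r \<in> J \<Longrightarrow> ((coord c \<circ> \<gamma>) has_vector_derivative x' r) (at r within J)"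
    using g c unfolding C1_curve_def J_def Let_def by blast
  have cont: "continuous_on {a<..<b} \<gamma>"
    using g unfolding C1_curve_def by (auto intro: continuous_on_subset)
  define N where "N = {a<..<b} \<inter> \<gamma> -` chart_dom c"
  have N: "open N" unfolding N_def by (rule continuous_open_preimage[OF cont _ open_chart_dom]) (use c in auto)
  have NJ: "N \<subseteq> J" "t \<in> N" using t c by (auto simp: N_def J_def)
  show thesis
  proof
    show "isCont x' t" using continuous_on_subset[OF x'(1) NJ(1)] N NJ(2) by (simp add: continuous_on_eq_continuous_at)
    have "\<forall>r\<in>N. \<gamma> r \<in> chart_dom c \<and> isCont \<gamma> r \<and> ((coord c \<circ> \<gamma>) has_vector_derivative x' r) (at r)"
    proof
      fix r assume r: "r \<in> N"
      have "at r within J = at r" using at_within_open_subset[OF r N NJ(1)] .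
      moreover have "isCont \<gamma> r" using cont r by (auto simp: N_def continuous_on_eq_continuous_at)
      ultimately show "\<gamma> r \<in> chart_dom c \<and> isCont \<gamma> r \<and> ((coord c \<circ> \<gamma>) has_vector_derivative x' r) (at r)"
        using r x'(2)[of r] NJ by (auto simp: N_def)
    qed
    then show "\<forall>\<^sub>F r in nhds t. \<gamma> r \<in> chart_dom c \<and> isCont \<gamma> r \<and> ((coord c \<circ> \<gamma>) has_vector_derivative x' r) (at r)"
      using N NJ(2) eventually_nhds by blast
  qed
qed

lemma isCont_metric:
  assumes c: "c \<in> \<A>" "x \<in> chart_ran c"
  shows "isCont (G c) x"
proof -
  obtain f1 f2 where "C2_on (chart_ran c) (G c) f1 f2"
    using smooth_on_imp_C2_on[OF open_chart_ran smooth_metric] c by blast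
  then show ?thesis using c by (auto simp: C2_on_def intro: has_derivative_continuous)
qed

text \<open>Continuity becomes visible in the chart at \<open>\<gamma> t\<close>, kept fixed for
  nearby times. It is the source of measurability of the speed.\<close>

lemma isCont_speed:
  assumes g: "C1_curve \<A> a b \<gamma>" and t: "a < t" "t < b"
  shows "isCont (speed \<gamma>) t"
proof -
  define c where "c = chart_at \<A> (\<gamma> t)"
  have c: "c \<in> \<A>" "\<gamma> t \<in> chart_dom c" by (auto simp: c_def chart_at)
  obtain x' where x': "isCont x' t"
    "\<forall>\<^sub>F r in nhds t. \<gamma> r \<in> chart_dom c \<and> isCont \<gamma> r \<and> ((coord c \<circ> \<gamma>) has_vector_derivative x' r) (at r)"
    by (rule C1_curve_interior[OF g t c])
  have "isCont \<gamma> t" using eventually_nhds_x_imp_x[OF x'(2)] by blast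
  moreover have "isCont (coord c) (\<gamma> t)"
    using continuous_on_coord[OF c(1)] open_chart_dom[OF c(1)] c(2) by (simp add: continuous_on_eq_continuous_at)
  ultimately have "isCont (\<lambda>r. coord c (\<gamma> r)) t" by (rule isCont_o2)
  then have Gc: "isCont (\<lambda>r. G c (coord c (\<gamma> r))) t"
    by (rule isCont_o2) (use isCont_metric c in auto)
  have "isCont (\<lambda>r. metric_norm c (coord c (\<gamma> r)) (x' r)) t"
    unfolding metric_norm_def by (intro continuous_intros Gc x'(1))
  moreover have "\<forall>\<^sub>F r in nhds t. speed \<gamma> r = metric_norm c (coord c (\<gamma> r)) (x' r)"
    using x'(2) by eventually_elim (use c in \<open>auto intro: speed_eq\<close>)
  ultimately show ?thesis by (simp add: isCont_cong)
qed

end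

section \<open>Null sets, real induction and left limits\<close>

lemma null_set_AE: "finite N \<Longrightarrow> AE t::real in lborel. t \<notin> N"
  by (intro AE_not_in finite_imp_null_set_lborel)

lemma AE_not_in_affine_vimage:
  fixes K :: "real set"
  assumes "finite K" "k \<noteq> 0"
  shows "AE t in lborel. t \<notin> (\<lambda>t. k * t + e) -` K"
  using assms by (intro null_set_AE finite_vimageI) (auto simp: inj_def)

text \<open>Real induction: the times where \<open>P\<close> fails form a compact set, and its least
  element would contradict the step. It is used to show that a curve does not leave a chart.\<close>

lemma continuous_induction:
  fixes P :: "real \<Rightarrow> bool"
  assumes op: "openin (top_of_set {0..1}) {t\<in>{0..1}. P t}" and P0: "P 0"
    and step: "\<And>\<tau>. 0 < \<tau> \<Longrightarrow> \<tau> \<le> 1 \<Longrightarrow> (\<And>s. 0 \<le> s \<Longrightarrow> s < \<tau> \<Longrightarrow> P s) \<Longrightarrow> P \<tau>"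
    and t: "t \<in> {0..1}"
  shows "P t"
proof (rule ccontr)
  assume nP: "\<not> P t"
  let ?B = "{t\<in>{0..1}. \<not> P t}"
  have B: "?B = {0..1} - {t\<in>{0..1}. P t}" by auto
  have "closedin (top_of_set {0..1}) ?B" unfolding B by (rule closedin_diff[OF _ op]) simp
  then have "compact ?B" by (rule closedin_compact[OF compact_Icc])
  moreover have "?B \<noteq> {}" using nP t by auto
  ultimately obtain \<tau> where \<tau>: "\<tau> \<in> ?B" "\<And>s. s \<in> ?B \<Longrightarrow> \<tau> \<le> s" using compact_attains_inf[of ?B] by blast
  have "\<tau> \<noteq> 0" using \<tau>(1) P0 by auto
  have "P \<tau>"
  proof (rule step)
    show "P s" if "0 \<le> s" "s < \<tau>" for s using \<tau>(1) \<tau>(2)[of s] that by force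
  qed (use \<open>\<tau> \<noteq> 0\<close> \<tau>(1) in auto)
  then show False using \<tau>(1) by auto
qed

text \<open>Substitute for compactness: the increments of the continuous \<open>\<Lambda>\<close>
  make \<open>f\<close> uniformly continuous on the half-open interval, and completeness of the
  target supplies the limit.\<close>

lemma limit_at_left_of_bounded_variation:
  fixes f :: "real \<Rightarrow> 'b::banach"
  assumes \<tau>: "0 < \<tau>" and \<Lambda>: "continuous_on {0..\<tau>} \<Lambda>"
    and f: "\<And>a b. 0 \<le> a \<Longrightarrow> a \<le> b \<Longrightarrow> b < \<tau> \<Longrightarrow> norm (f b - f a) \<le> \<Lambda> b - \<Lambda> a"
  obtains l where "(f \<longlongrightarrow> l) (at_left \<tau>)" "norm (l - f 0) \<le> \<Lambda> \<tau> - \<Lambda> 0"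
proof -
  have "uniformly_continuous_on {0..\<tau>} \<Lambda>" using \<Lambda> by (intro compact_uniformly_continuous) auto
  then have "uniformly_continuous_on {0..<\<tau>} f"
    unfolding uniformly_continuous_on_def
  proof (intro allI impI)
    fix e :: real assume "e > 0" and u: "\<forall>e>0. \<exists>d>0. \<forall>x\<in>{0..\<tau>}. \<forall>x'\<in>{0..\<tau>}. dist x' x < d \<longrightarrow> dist (\<Lambda> x') (\<Lambda> x) < e"
    then obtain d where d: "d > 0" "\<And>x x'. x \<in> {0..\<tau>} \<Longrightarrow> x' \<in> {0..\<tau>} \<Longrightarrow> dist x' x < d \<Longrightarrow> dist (\<Lambda> x') (\<Lambda> x) < e"
      by metis
    have le: "dist (f x') (f x) < e" if "0 \<le> x" "x \<le> x'" "x' < \<tau>" "dist x' x < d" for x x'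
      using f[OF that(1-3)] d(2)[of x x'] that by (simp add: dist_norm)
    have "dist (f x') (f x) < e" if "x \<in> {0..<\<tau>}" "x' \<in> {0..<\<tau>}" "dist x' x < d" for x x'
      using le[of x x'] le[of x' x] that by (cases "x \<le> x'") (auto simp: dist_commute)
    then show "\<exists>d>0. \<forall>x\<in>{0..<\<tau>}. \<forall>x'\<in>{0..<\<tau>}. dist x' x < d \<longrightarrow> dist (f x') (f x) < e" using d(1) by blast
  qed
  then obtain g where g: "uniformly_continuous_on (closure {0..<\<tau>}) g" "\<And>x. x \<in> {0..<\<tau>} \<Longrightarrow> f x = g x"
    by (rule uniformly_continuous_on_extension_on_closure) blast
  have "continuous_on {0..\<tau>} g" using uniformly_continuous_imp_continuous[OF g(1)] \<tau> by simp
  then have "(g \<longlongrightarrow> g \<tau>) (at \<tau> within {0..\<tau>})" using \<tau> by (auto simp: continuous_on_def)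
  then have "(g \<longlongrightarrow> g \<tau>) (at_left \<tau>)" using \<tau> by (simp add: at_within_Icc_at_left)
  moreover have ev: "\<forall>\<^sub>F s in at_left \<tau>. s \<in> {0..<\<tau>}"
    using eventually_at_left_real[OF \<tau>] by eventually_elim auto
  then have "\<forall>\<^sub>F s in at_left \<tau>. g s = f s" by eventually_elim (use g(2) in auto)
  ultimately have lim: "(f \<longlongrightarrow> g \<tau>) (at_left \<tau>)" by (rule Lim_transform_eventually)
  have "(\<Lambda> \<longlongrightarrow> \<Lambda> \<tau>) (at \<tau> within {0..\<tau>})" using \<tau> \<Lambda> by (auto simp: continuous_on_def)
  then have "(\<Lambda> \<longlongrightarrow> \<Lambda> \<tau>) (at_left \<tau>)" using \<tau> by (simp add: at_within_Icc_at_left)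
  then have "norm (g \<tau> - f 0) \<le> \<Lambda> \<tau> - \<Lambda> 0"
    by (intro tendsto_le[OF _ tendsto_diff[OF _ tendsto_const] tendsto_norm[OF tendsto_diff[OF lim tendsto_const]]])
       (use ev in \<open>auto elim!: eventually_mono intro!: f\<close>)
  with lim show thesis by (rule that)
qed

section \<open>Curves read in one chart\<close>

context hilbert_manifold
begin

text \<open>The limit in coordinates gives a limit of \<open>\<gamma>\<close> inside the chart, and
  by the Hausdorff property it is \<open>p\<close>. This is how \<open>p\<close> is seen to lie in
  the chart domain.\<close>

lemma chart_limit:
  assumes c: "c \<in> \<A>" and l: "l \<in> chart_ran c" and lim: "((coord c \<circ> \<gamma>) \<longlongrightarrow> l) F"
    and \<gamma>: "(\<gamma> \<longlongrightarrow> p) F" and ev: "\<forall>\<^sub>F s in F. \<gamma> s \<in> chart_dom c" and F: "F \<noteq> bot"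
  shows "p = chart_inv c l"
proof -
  have "isCont (chart_inv c) l"
    using continuous_on_chart_inv[OF c] open_chart_ran[OF c] l by (simp add: continuous_on_eq_continuous_at)
  then have "((\<lambda>s. chart_inv c ((coord c \<circ> \<gamma>) s)) \<longlongrightarrow> chart_inv c l) F" using lim by (rule isCont_tendsto_compose)
  moreover have "\<forall>\<^sub>F s in F. chart_inv c ((coord c \<circ> \<gamma>) s) = \<gamma> s" using ev by eventually_elim (use c in auto)
  ultimately have "(\<gamma> \<longlongrightarrow> chart_inv c l) F" by (rule Lim_transform_eventually)
  then show ?thesis using tendsto_unique[OF F \<gamma>] by simp
qed

text \<open>One statement for the reversal of a curve, \<open>k = -1\<close>, and for both halves of
  a concatenation, \<open>k = 2\<close>.\<close>

lemma C1_curve_affine: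
  assumes g: "C1_curve \<A> a b \<gamma>" and r: "\<And>r. r \<in> {a'..b'} \<Longrightarrow> k * r + e \<in> {a..b} \<and> \<gamma>' r = \<gamma> (k * r + e)"
  shows "C1_curve \<A> a' b' \<gamma>'"
  unfolding C1_curve_def Let_def
proof (intro conjI ballI)
  have "continuous_on {a'..b'} (\<lambda>r. \<gamma> (k * r + e))"
    by (rule continuous_on_compose2[of "{a..b}" \<gamma>])
       (use g r in \<open>auto simp: C1_curve_def intro!: continuous_intros\<close>)
  then show "continuous_on {a'..b'} \<gamma>'" by (rule continuous_on_eq) (use r in auto)
  fix c assume c: "c \<in> \<A>"
  let ?J = "{t \<in> {a..b}. \<gamma> t \<in> chart_dom c}" and ?J' = "{t \<in> {a'..b'}. \<gamma>' t \<in> chart_dom c}"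
  obtain x' where x': "continuous_on ?J x'" "\<And>t. t \<in> ?J \<Longrightarrow> ((coord c \<circ> \<gamma>) has_vector_derivative x' t) (at t within ?J)"
    using g c unfolding C1_curve_def Let_def by blast
  have J: "k * t + e \<in> ?J" if "t \<in> ?J'" for t using that r[of t] by auto
  have "continuous_on ?J' (\<lambda>t. k *\<^sub>R x' (k * t + e))"
    by (intro continuous_intros continuous_on_compose2[OF x'(1)]) (use J in auto)
  moreover have "((coord c \<circ> \<gamma>') has_vector_derivative k *\<^sub>R x' (k * t + e)) (at t within ?J')" if t: "t \<in> ?J'" for t
  proof -
    have "((\<lambda>r. k * r + e) has_vector_derivative k) (at t within ?J')"
      by (auto intro!: derivative_eq_intros simp flip: has_real_derivative_iff_has_vector_derivative)
    moreover have "((coord c \<circ> \<gamma>) has_vector_derivative x' (k * t + e)) (at (k * t + e) within (\<lambda>r. k * r + e) ` ?J')"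
      by (rule has_vector_derivative_within_subset[OF x'(2)[OF J[OF t]]]) (use J in auto)
    ultimately have "((coord c \<circ> \<gamma>) \<circ> (\<lambda>r. k * r + e) has_vector_derivative k *\<^sub>R x' (k * t + e)) (at t within ?J')"
      by (rule vector_diff_chain_within)
    then show ?thesis
      by (rule has_vector_derivative_transform[OF t, rotated]) (use r in auto)
  qed
  ultimately show "\<exists>x'. continuous_on ?J' x' \<and> (\<forall>t\<in>?J'. ((coord c \<circ> \<gamma>') has_vector_derivative x' t) (at t within ?J'))"
    by blast
qed

lemma C1_curve_chart:
  assumes c: "c \<in> \<A>" and cont: "continuous_on {a..b} \<gamma>" and dom: "\<And>t. t \<in> {a..b} \<Longrightarrow> \<gamma> t \<in> chart_dom c"
    and x': "continuous_on {a..b} x'" and d: "\<And>t. t \<in> {a..b} \<Longrightarrow> ((coord c \<circ> \<gamma>) has_vector_derivative x' t) (at t within {a..b})"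
  shows "C1_curve \<A> a b \<gamma>"
  unfolding C1_curve_def Let_def
proof (intro conjI ballI)
  fix c' assume c': "c' \<in> \<A>"
  let ?J = "{t \<in> {a..b}. \<gamma> t \<in> chart_dom c'}"
  have coord: "continuous_on ?J (\<lambda>t. coord c (\<gamma> t))"
    by (rule continuous_on_compose2[OF continuous_on_coord[OF c]]) (use cont dom in \<open>auto intro: continuous_on_subset\<close>)
  have "continuous_on (overlap c c') (trans_deriv c c')"
    using transition_has_derivative(2)[OF c c'] has_derivative_continuous
    by (blast intro: continuous_at_imp_continuous_on)
  then have "continuous_on ?J (\<lambda>t. trans_deriv c c' (coord c (\<gamma> t)))"
    by (rule continuous_on_compose2[OF _ coord]) (use dom in \<open>auto intro: coord_in_overlap\<close>)
  moreover have "continuous_on ?J x'" by (rule continuous_on_subset[OF x']) auto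
  ultimately have "continuous_on ?J (\<lambda>t. trans_deriv c c' (coord c (\<gamma> t)) (x' t))" by (intro continuous_intros)
  moreover have "((coord c' \<circ> \<gamma>) has_vector_derivative trans_deriv c c' (coord c (\<gamma> t)) (x' t)) (at t within ?J)" if t: "t \<in> ?J" for t
  proof (rule coord_change_vector_derivative[OF c c'])
    have "continuous_on ?J \<gamma>" by (rule continuous_on_subset[OF cont]) auto
    then show "continuous (at t within ?J) \<gamma>" using t by (simp add: continuous_on_eq_continuous_within)
    show "((coord c \<circ> \<gamma>) has_vector_derivative x' t) (at t within ?J)"
      by (rule has_vector_derivative_within_subset[OF d]) (use t in auto)
  qed (use t dom in auto)
  ultimately show "\<exists>x'. continuous_on ?J x' \<and> (\<forall>t\<in>?J. ((coord c' \<circ> \<gamma>) has_vector_derivative x' t) (at t within ?J))"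
    by (intro exI[of _ "\<lambda>t. trans_deriv c c' (coord c (\<gamma> t)) (x' t)"]) blast
qed (rule cont)

end

section \<open>Length of curves and the axioms of the distance\<close>

context riemannian_manifold
begin

text \<open>At the end points \<open>speed\<close> depends on the junk values of the curve outside the unit interval.\<close>

definition cut_speed :: "(real \<Rightarrow> 'm) \<Rightarrow> real \<Rightarrow> real" where
  "cut_speed \<gamma> t = (if 0 < t \<and> t < 1 then speed \<gamma> t else 0)"

lemma metric_norm_nonneg: "c \<in> \<A> \<Longrightarrow> x \<in> chart_ran c \<Longrightarrow> 0 \<le> metric_norm c x u"
  by (simp add: metric_norm_def metric_nonneg)

lemma speed_nonneg: "0 \<le> speed \<gamma> t"
  using metric_nonneg[OF chart_at(1) coord_in_ran[OF chart_at(2)]]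
  by (simp add: speed_def tangent_norm_def tangent_inner_def)

lemma cut_speed_nonneg: "0 \<le> cut_speed \<gamma> t"
  by (simp add: cut_speed_def speed_nonneg)

text \<open>Replaces the subdivision by the finite set \<open>K\<close> of its nodes, which is all
  that an argument up to null sets has to know.\<close>

lemma piecewise_C1_regular:
  assumes "piecewise_C1_curve \<A> 0 1 \<gamma>"
  obtains K where "finite K" "continuous_on {0..1} \<gamma>"
    "\<And>t. 0 < t \<Longrightarrow> t < 1 \<Longrightarrow> t \<notin> K \<Longrightarrow> isCont (speed \<gamma>) t"
    "\<And>t c. 0 < t \<Longrightarrow> t < 1 \<Longrightarrow> t \<notin> K \<Longrightarrow> c \<in> \<A> \<Longrightarrow> \<gamma> t \<in> chart_dom c \<Longrightarrow>
       isCont \<gamma> t \<and> (\<exists>v. ((coord c \<circ> \<gamma>) has_vector_derivative v) (at t))"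
proof -
  obtain n :: nat and s :: "nat \<Rightarrow> real" where s: "s 0 = 0" "s n = 1"
    "\<And>i. i < n \<Longrightarrow> s i < s (Suc i) \<and> C1_curve \<A> (s i) (s (Suc i)) \<gamma>"
    using assms unfolding piecewise_C1_curve_def by blast
  define K where "K = s ` {..n}"
  have mono: "s 0 \<le> s k" if "k \<le> n" for k
    using that
  proof (induction k)
    case (Suc k) then show ?case using s(3)[of k] by auto
  qed simp
  have cont: "continuous_on {s 0..s k} \<gamma>" if "k \<le> n" for k
    using that
  proof (induction k)
    case (Suc k)
    have "{s 0..s (Suc k)} = {s 0..s k} \<union> {s k..s (Suc k)}"
      using mono[of k] s(3)[of k] Suc.prems by (intro ivl_disj_un_two_touch(4)[symmetric]) auto
    then show ?case using Suc s(3)[of k] by (auto simp: C1_curve_def intro!: continuous_on_closed_Un)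
  qed simp
  have loc: "\<exists>i<k. s i < t \<and> t < s (Suc i)" if "k \<le> n" "s 0 < t" "t < s k" "t \<notin> K" for k t
    using that
  proof (induction k)
    case (Suc k)
    show ?case
    proof (cases "t < s k")
      case True then show ?thesis using Suc by (auto intro: less_SucI)
    next
      case False
      moreover have "t \<noteq> s k" using Suc.prems by (auto simp: K_def)
      ultimately show ?thesis using Suc.prems by (intro exI[of _ k]) auto
    qed
  qed simp
  have ex: "\<exists>a b. a < t \<and> t < b \<and> C1_curve \<A> a b \<gamma>" if "0 < t" "t < 1" "t \<notin> K" for t
    using loc[of n t] that s by force
  show thesis
  proof
    show "finite K" by (simp add: K_def)
    show "continuous_on {0..1} \<gamma>" using cont[of n] s by simp
    fix t :: real assume t: "0 < t" "t < 1" "t \<notin> K"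
    from ex[OF t] obtain a b where ab: "a < t" "t < b" "C1_curve \<A> a b \<gamma>" by blast
    show "isCont (speed \<gamma>) t" by (rule isCont_speed[OF ab(3,1,2)])
    fix c assume c: "c \<in> \<A>" "\<gamma> t \<in> chart_dom c"
    obtain x' where "isCont x' t"
      "\<forall>\<^sub>F r in nhds t. \<gamma> r \<in> chart_dom c \<and> isCont \<gamma> r \<and> ((coord c \<circ> \<gamma>) has_vector_derivative x' r) (at r)"
      by (rule C1_curve_interior[OF ab(3,1,2) c])
    from eventually_nhds_x_imp_x[OF this(2)]
    show "isCont \<gamma> t \<and> (\<exists>v. ((coord c \<circ> \<gamma>) has_vector_derivative v) (at t))" by blast
  qed
qed

lemma cut_speed_measurable:
  assumes "piecewise_C1_curve \<A> 0 1 \<gamma>"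
  shows "cut_speed \<gamma> \<in> borel_measurable borel"
proof -
  obtain K where K: "finite K" "\<And>t. 0 < t \<Longrightarrow> t < 1 \<Longrightarrow> t \<notin> K \<Longrightarrow> isCont (speed \<gamma>) t"
    by (rule piecewise_C1_regular[OF assms]) blast
  have "isCont (cut_speed \<gamma>) t" if "t \<notin> K \<union> {0, 1}" for t
  proof -
    consider "t < 0" | "0 < t" "t < 1" | "1 < t" using \<open>t \<notin> K \<union> {0, 1}\<close> by (auto simp: not_less) force
    then show ?thesis
    proof cases
      case 1
      then have "\<forall>\<^sub>F r in nhds t. cut_speed \<gamma> r = 0"
        using eventually_nhds_in_open[of "{..<0}" t] by (auto elim!: eventually_mono simp: cut_speed_def)
      then show ?thesis by (simp add: isCont_cong)
    next
      case 2
      then have "\<forall>\<^sub>F r in nhds t. cut_speed \<gamma> r = speed \<gamma> r"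
        using eventually_nhds_in_open[of "{0<..<1}" t] by (auto elim!: eventually_mono simp: cut_speed_def)
      then show ?thesis using K(2)[OF 2] that by (simp add: isCont_cong)
    next
      case 3
      then have "\<forall>\<^sub>F r in nhds t. cut_speed \<gamma> r = 0"
        using eventually_nhds_in_open[of "{1<..}" t] by (auto elim!: eventually_mono simp: cut_speed_def)
      then show ?thesis by (simp add: isCont_cong)
    qed
  qed
  then show ?thesis
    using K(1) by (intro borel_measurable_continuous_countable_exceptions[of "K \<union> {0, 1}"])
      (auto intro: continuous_at_imp_continuous_on countable_finite)
qed

lemma curve_length_eq: "curve_length \<A> G 0 1 \<gamma> = (\<integral>\<^sup>+ t. ennreal (cut_speed \<gamma> t) \<partial>lborel)"
  unfolding curve_length_def
proof (rule nn_integral_cong_AE)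
  have "AE t::real in lborel. t \<notin> {0, 1}" by (intro AE_not_in finite_imp_null_set_lborel) auto
  then show "AE t in lborel. ennreal (tangent_norm \<A> G (\<gamma> t) (curve_velocity \<A> \<gamma> t)) * indicator {0..1} t = ennreal (cut_speed \<gamma> t)"
    by eventually_elim (auto simp: cut_speed_def speed_def indicator_def)
qed

lemma speed_reparametrization:
  assumes "piecewise_C1_curve \<A> 0 1 \<gamma>"
  obtains K where "finite K"
    "\<And>\<gamma>' k e t. 0 < k * t + e \<Longrightarrow> k * t + e < 1 \<Longrightarrow> t \<notin> (\<lambda>t. k * t + e) -` K \<Longrightarrow>
       \<forall>\<^sub>F r in nhds t. \<gamma>' r = \<gamma> (k * r + e) \<Longrightarrow> speed \<gamma>' t = \<bar>k\<bar> * speed \<gamma> (k * t + e)"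
proof -
  obtain K where K: "finite K"
    "\<And>t c. 0 < t \<Longrightarrow> t < 1 \<Longrightarrow> t \<notin> K \<Longrightarrow> c \<in> \<A> \<Longrightarrow> \<gamma> t \<in> chart_dom c \<Longrightarrow>
       isCont \<gamma> t \<and> (\<exists>v. ((coord c \<circ> \<gamma>) has_vector_derivative v) (at t))"
    by (rule piecewise_C1_regular[OF assms]) blast
  show thesis
  proof (rule that[OF K(1)])
    fix \<gamma>' k e t assume t: "0 < k * t + e" "k * t + e < 1" "t \<notin> (\<lambda>t. k * t + e) -` K"
      and ev: "\<forall>\<^sub>F r in nhds t. \<gamma>' r = \<gamma> (k * r + e)"
    let ?c = "chart_at \<A> (\<gamma> (k * t + e))"
    obtain v where "isCont \<gamma> (k * t + e)" "((coord ?c \<circ> \<gamma>) has_vector_derivative v) (at (k * t + e))"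
      using K(2)[of "k * t + e" ?c] chart_at t by auto
    then show "speed \<gamma>' t = \<bar>k\<bar> * speed \<gamma> (k * t + e)"
      by (intro speed_affine[OF ev, where c="?c"]) (auto simp: chart_at)
  qed
qed

lemma riem_dist_le_reverse: "riem_dist \<A> G p q \<le> riem_dist \<A> G q p"
  unfolding riem_dist_def
proof (rule INF_greatest)
  fix \<gamma> assume "\<gamma> \<in> {\<gamma>. piecewise_C1_curve \<A> 0 1 \<gamma> \<and> \<gamma> 0 = q \<and> \<gamma> 1 = p}"
  then have \<gamma>: "piecewise_C1_curve \<A> 0 1 \<gamma>" "\<gamma> 0 = q" "\<gamma> 1 = p" by auto
  define \<gamma>' where "\<gamma>' r = \<gamma> ((-1) * r + 1)" for r :: real
  obtain n :: nat and s :: "nat \<Rightarrow> real" where s: "s 0 = 0" "s n = 1"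
    "\<And>i. i < n \<Longrightarrow> s i < s (Suc i) \<and> C1_curve \<A> (s i) (s (Suc i)) \<gamma>"
    using \<gamma>(1) unfolding piecewise_C1_curve_def by blast
  have pw: "piecewise_C1_curve \<A> 0 1 \<gamma>'"
    unfolding piecewise_C1_curve_def
  proof (intro exI conjI allI impI)
    \<comment> \<open>These goals determine the reversed nodes
      \<open>\<lambda>i. 1 - s (n - i)\<close>; piece \<open>i\<close> is the mirror image of piece
      \<open>n - Suc i\<close>.\<close>
    show "1 - s (n - 0) = 0" "1 - s (n - n) = 1" using s by auto
    fix i assume i: "i < n"
    define j where "j = n - Suc i"
    have j: "j < n" "n - i = Suc j" using i by (auto simp: j_def)
    then show "1 - s (n - i) < 1 - s (n - Suc i)" using s(3)[of j] by (simp add: j_def)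
    have "C1_curve \<A> (1 - s (Suc j)) (1 - s j) \<gamma>'"
      by (rule C1_curve_affine[OF conjunct2[OF s(3)[OF j(1)]], where k="-1" and e=1]) (auto simp: \<gamma>'_def)
    then show "C1_curve \<A> (1 - s (n - i)) (1 - s (n - Suc i)) \<gamma>'" using j by (simp add: j_def)
  qed
  obtain K where K: "finite K"
    "\<And>t. 0 < -1 * t + 1 \<Longrightarrow> -1 * t + 1 < 1 \<Longrightarrow> t \<notin> (\<lambda>t. -1 * t + 1) -` K \<Longrightarrow>
       \<forall>\<^sub>F r in nhds t. \<gamma>' r = \<gamma> (-1 * r + 1) \<Longrightarrow> speed \<gamma>' t = \<bar>-1\<bar> * speed \<gamma> (-1 * t + 1)"
    by (rule speed_reparametrization[OF \<gamma>(1)]) blast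
  have "AE t in lborel. t \<notin> (\<lambda>t. -1 * t + 1) -` K" by (rule AE_not_in_affine_vimage[OF K(1)]) simp
  then have "AE t in lborel. ennreal (cut_speed \<gamma>' t) = ennreal (cut_speed \<gamma> (1 + (-1) * t))"
    by eventually_elim (use K(2) in \<open>auto simp: cut_speed_def \<gamma>'_def\<close>)
  then have "curve_length \<A> G 0 1 \<gamma>' = (\<integral>\<^sup>+ t. ennreal (cut_speed \<gamma> (1 + (-1) * t)) \<partial>lborel)"
    unfolding curve_length_eq by (rule nn_integral_cong_AE)
  also have "\<dots> = curve_length \<A> G 0 1 \<gamma>"
    unfolding curve_length_eq
    using nn_integral_real_affine[of "\<lambda>t. ennreal (cut_speed \<gamma> t)" "-1" 1] cut_speed_measurable[OF \<gamma>(1)] by simp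
  finally have "curve_length \<A> G 0 1 \<gamma>' = curve_length \<A> G 0 1 \<gamma>" .
  then show "(INF \<gamma>\<in>{\<gamma>. piecewise_C1_curve \<A> 0 1 \<gamma> \<and> \<gamma> 0 = p \<and> \<gamma> 1 = q}. curve_length \<A> G 0 1 \<gamma>) \<le> curve_length \<A> G 0 1 \<gamma>"
    by (intro INF_lower2[of \<gamma>']) (use pw \<gamma> in \<open>auto simp: \<gamma>'_def\<close>)
qed

lemma riem_dist_sym: "riem_dist \<A> G p q = riem_dist \<A> G q p"
  by (intro antisym riem_dist_le_reverse)

text \<open>Each curve is run at double speed on its half of the interval, which the change of
  variables in the integral compensates.\<close>

lemma curve_join:
  assumes \<gamma>1: "piecewise_C1_curve \<A> 0 1 \<gamma>1" and \<gamma>2: "piecewise_C1_curve \<A> 0 1 \<gamma>2" and eq: "\<gamma>1 1 = \<gamma>2 0"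
  obtains \<gamma> where "piecewise_C1_curve \<A> 0 1 \<gamma>" "\<gamma> 0 = \<gamma>1 0" "\<gamma> 1 = \<gamma>2 1"
    "curve_length \<A> G 0 1 \<gamma> = curve_length \<A> G 0 1 \<gamma>1 + curve_length \<A> G 0 1 \<gamma>2"
proof
  define \<gamma> where "\<gamma> r = (if r \<le> 1/2 then \<gamma>1 (2 * r + 0) else \<gamma>2 (2 * r + (-1)))" for r :: real
  have right: "\<gamma> r = \<gamma>2 (2 * r + (-1))" if "1/2 \<le> r" for r
  proof (cases "r = 1/2")
    case True show ?thesis unfolding True by (simp add: \<gamma>_def eq)
  qed (use that in \<open>simp add: \<gamma>_def\<close>)
  show "\<gamma> 0 = \<gamma>1 0" "\<gamma> 1 = \<gamma>2 1" by (auto simp: \<gamma>_def)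
  obtain n :: nat and s :: "nat \<Rightarrow> real" where s: "s 0 = 0" "s n = 1"
    "\<And>i. i < n \<Longrightarrow> s i < s (Suc i) \<and> C1_curve \<A> (s i) (s (Suc i)) \<gamma>1"
    using \<gamma>1 unfolding piecewise_C1_curve_def by blast
  obtain m :: nat and r :: "nat \<Rightarrow> real" where r: "r 0 = 0" "r m = 1"
    "\<And>i. i < m \<Longrightarrow> r i < r (Suc i) \<and> C1_curve \<A> (r i) (r (Suc i)) \<gamma>2"
    using \<gamma>2 unfolding piecewise_C1_curve_def by blast
  have s_le: "s i \<le> 1" if "i \<le> n" for i
    using that by (induction i rule: inc_induct) (use s in \<open>auto intro: less_imp_le order_trans\<close>)
  have r_ge: "0 \<le> r i" if "i \<le> m" for i
    using that
  proof (induction i)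
    case (Suc i) then show ?case using r(3)[of i] by auto
  qed (simp add: r)
  \<comment> \<open>At \<open>i = n\<close> both formulas give 1/2, which is what makes the two
    subdivisions fit together.\<close>
  define s' where "s' i = (if i \<le> n then s i / 2 else 1/2 + r (i - n) / 2)" for i
  show "piecewise_C1_curve \<A> 0 1 \<gamma>"
    unfolding piecewise_C1_curve_def
  proof (intro exI conjI allI impI)
    show "s' 0 = 0" by (simp add: s'_def s)
    show "s' (n + m) = 1" using s r by (cases "m = 0") (auto simp: s'_def)
    fix i assume i: "i < n + m"
    have "s' i < s' (Suc i) \<and> C1_curve \<A> (s' i) (s' (Suc i)) \<gamma>"
    proof (cases "i < n")
      case True
      have "C1_curve \<A> (s i / 2) (s (Suc i) / 2) \<gamma>"
        by (rule C1_curve_affine[OF conjunct2[OF s(3)[OF True]], where k=2 and e=0])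
           (use s_le[of "Suc i"] True in \<open>auto simp: \<gamma>_def\<close>)
      then show ?thesis using s(3)[OF True] True by (simp add: s'_def)
    next
      case False
      define j where "j = i - n"
      have j: "j < m" "i = n + j" using i False by (auto simp: j_def)
      have "C1_curve \<A> (1/2 + r j / 2) (1/2 + r (Suc j) / 2) \<gamma>"
        by (rule C1_curve_affine[OF conjunct2[OF r(3)[OF j(1)]], where k=2 and e="-1"])
           (use r_ge[of j] j in \<open>auto simp: right\<close>)
      moreover have "s' i = 1/2 + r j / 2" using j s r by (cases "j = 0") (auto simp: s'_def)
      moreover have "s' (Suc i) = 1/2 + r (Suc j) / 2" using j by (auto simp: s'_def Suc_diff_le)
      ultimately show ?thesis using r(3)[OF j(1)] by simp
    qed
    then show "s' i < s' (Suc i)" "C1_curve \<A> (s' i) (s' (Suc i)) \<gamma>" by auto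
  qed
  obtain K1 where K1: "finite K1"
    "\<And>t. 0 < 2 * t + 0 \<Longrightarrow> 2 * t + 0 < 1 \<Longrightarrow> t \<notin> (\<lambda>t. 2 * t + 0) -` K1 \<Longrightarrow>
       \<forall>\<^sub>F r in nhds t. \<gamma> r = \<gamma>1 (2 * r + 0) \<Longrightarrow> speed \<gamma> t = \<bar>2\<bar> * speed \<gamma>1 (2 * t + 0)"
    by (rule speed_reparametrization[OF \<gamma>1]) blast
  obtain K2 where K2: "finite K2"
    "\<And>t. 0 < 2 * t + (-1) \<Longrightarrow> 2 * t + (-1) < 1 \<Longrightarrow> t \<notin> (\<lambda>t. 2 * t + (-1)) -` K2 \<Longrightarrow>
       \<forall>\<^sub>F r in nhds t. \<gamma> r = \<gamma>2 (2 * r + (-1)) \<Longrightarrow> speed \<gamma> t = \<bar>2\<bar> * speed \<gamma>2 (2 * t + (-1))"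
    by (rule speed_reparametrization[OF \<gamma>2]) blast
  have "AE t in lborel. t \<notin> (\<lambda>t. 2 * t + 0) -` K1" by (rule AE_not_in_affine_vimage[OF K1(1)]) simp
  moreover have "AE t in lborel. t \<notin> (\<lambda>t. 2 * t + (-1)) -` K2" by (rule AE_not_in_affine_vimage[OF K2(1)]) simp
  moreover have "AE t::real in lborel. t \<notin> {1/2}" by (rule null_set_AE) simp
  \<comment> \<open>A single formula serves both halves because \<open>cut_speed\<close> vanishes
    outside the open unit interval, so at most one summand is nonzero.\<close>
  ultimately have AE: "AE t in lborel. ennreal (cut_speed \<gamma> t) = 2 * ennreal (cut_speed \<gamma>1 (0 + 2 * t)) + 2 * ennreal (cut_speed \<gamma>2 (-1 + 2 * t))"
  proof eventually_elim
    case (elim t)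
    consider "t \<le> 0" | "0 < t" "t < 1/2" | "1/2 < t" "t < 1" | "1 \<le> t" using elim by force
    then show ?case
    proof cases
      case 2
      have "\<forall>\<^sub>F r in nhds t. \<gamma> r = \<gamma>1 (2 * r + 0)"
        using eventually_nhds_in_open[of "{..<1/2}" t] 2 by (auto elim!: eventually_mono simp: \<gamma>_def)
      then have "speed \<gamma> t = \<bar>2\<bar> * speed \<gamma>1 (2 * t + 0)" using 2 elim by (intro K1(2)) auto
      then show ?thesis using 2 by (simp add: cut_speed_def ennreal_mult speed_nonneg)
    next
      case 3
      have "\<forall>\<^sub>F r in nhds t. \<gamma> r = \<gamma>2 (2 * r + (-1))"
        using eventually_nhds_in_open[of "{1/2<..}" t] 3 by (auto elim!: eventually_mono simp: \<gamma>_def)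
      then have "speed \<gamma> t = \<bar>2\<bar> * speed \<gamma>2 (2 * t + (-1))" using 3 elim by (intro K2(2)) auto
      then show ?thesis using 3 by (simp add: cut_speed_def ennreal_mult speed_nonneg add.commute)
    qed (auto simp: cut_speed_def)
  qed
  note [measurable] = cut_speed_measurable[OF \<gamma>1] cut_speed_measurable[OF \<gamma>2]
  have "curve_length \<A> G 0 1 \<gamma> = (\<integral>\<^sup>+ t. 2 * ennreal (cut_speed \<gamma>1 (0 + 2 * t)) + 2 * ennreal (cut_speed \<gamma>2 (-1 + 2 * t)) \<partial>lborel)"
    unfolding curve_length_eq by (rule nn_integral_cong_AE[OF AE])
  also have "\<dots> = 2 * (\<integral>\<^sup>+ t. ennreal (cut_speed \<gamma>1 (0 + 2 * t)) \<partial>lborel) + 2 * (\<integral>\<^sup>+ t. ennreal (cut_speed \<gamma>2 (-1 + 2 * t)) \<partial>lborel)"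
    by (subst nn_integral_add) (auto simp: nn_integral_cmult)
  also have "\<dots> = curve_length \<A> G 0 1 \<gamma>1 + curve_length \<A> G 0 1 \<gamma>2"
    unfolding curve_length_eq
    using nn_integral_real_affine[of "\<lambda>t. ennreal (cut_speed \<gamma>1 t)" 2 0]
      nn_integral_real_affine[of "\<lambda>t. ennreal (cut_speed \<gamma>2 t)" 2 "-1"] by simp
  finally show "curve_length \<A> G 0 1 \<gamma> = curve_length \<A> G 0 1 \<gamma>1 + curve_length \<A> G 0 1 \<gamma>2" .
qed

lemma riem_dist_triangle: "riem_dist \<A> G p r \<le> riem_dist \<A> G p q + riem_dist \<A> G q r"
proof (cases "riem_dist \<A> G p q = \<infinity> \<or> riem_dist \<A> G q r = \<infinity>")
  case False
  show ?thesis
  proof (rule ennreal_le_epsilon)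
    fix e :: real assume e: "0 < e"
    have ex: "\<exists>\<gamma>. piecewise_C1_curve \<A> 0 1 \<gamma> \<and> \<gamma> 0 = p \<and> \<gamma> 1 = q \<and> curve_length \<A> G 0 1 \<gamma> < riem_dist \<A> G p q + ennreal (e / 2)"
      if "riem_dist \<A> G p q \<noteq> \<infinity>" for p q
    proof -
      have "riem_dist \<A> G p q < riem_dist \<A> G p q + ennreal (e / 2)"
        using that e by (cases "riem_dist \<A> G p q") (auto simp: ennreal_plus[symmetric] ennreal_less_iff simp del: ennreal_plus)
      then show ?thesis unfolding riem_dist_def[of \<A> G p q] INF_less_iff by auto
    qed
    obtain \<gamma>1 where \<gamma>1: "piecewise_C1_curve \<A> 0 1 \<gamma>1" "\<gamma>1 0 = p" "\<gamma>1 1 = q" "curve_length \<A> G 0 1 \<gamma>1 < riem_dist \<A> G p q + ennreal (e / 2)"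
      using ex[of p q] False by blast
    obtain \<gamma>2 where \<gamma>2: "piecewise_C1_curve \<A> 0 1 \<gamma>2" "\<gamma>2 0 = q" "\<gamma>2 1 = r" "curve_length \<A> G 0 1 \<gamma>2 < riem_dist \<A> G q r + ennreal (e / 2)"
      using ex[of q r] False by blast
    obtain \<gamma> where \<gamma>: "piecewise_C1_curve \<A> 0 1 \<gamma>" "\<gamma> 0 = p" "\<gamma> 1 = r"
      "curve_length \<A> G 0 1 \<gamma> = curve_length \<A> G 0 1 \<gamma>1 + curve_length \<A> G 0 1 \<gamma>2"
      using curve_join[OF \<gamma>1(1) \<gamma>2(1)] \<gamma>1 \<gamma>2 by metis
    have "riem_dist \<A> G p r \<le> curve_length \<A> G 0 1 \<gamma>"
      unfolding riem_dist_def using \<gamma> by (intro INF_lower) auto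
    also have "\<dots> \<le> (riem_dist \<A> G p q + ennreal (e / 2)) + (riem_dist \<A> G q r + ennreal (e / 2))"
      unfolding \<gamma>(4) using \<gamma>1(4) \<gamma>2(4) by (intro add_mono) auto
    also have "\<dots> = riem_dist \<A> G p q + riem_dist \<A> G q r + (ennreal (e / 2) + ennreal (e / 2))" by (simp add: ac_simps)
    also have "ennreal (e / 2) + ennreal (e / 2) = ennreal e" using e by (simp flip: ennreal_plus)
    finally show "riem_dist \<A> G p r \<le> riem_dist \<A> G p q + riem_dist \<A> G q r + ennreal e" .
  qed
qed auto

text \<open>Source of all upper bounds on the distance: a straight segment in a chart is an
  admissible competitor.\<close>

lemma riem_dist_segment:
  assumes c: "c \<in> \<A>" and seg: "closed_segment x y \<subseteq> chart_ran c"
    and B: "\<And>z. z \<in> closed_segment x y \<Longrightarrow> metric_norm c z (y - x) \<le> B"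
  shows "riem_dist \<A> G (chart_inv c x) (chart_inv c y) \<le> ennreal B"
proof -
  define l where "l t = x + t *\<^sub>R (y - x)" for t :: real
  define \<gamma> where "\<gamma> t = chart_inv c (l t)" for t
  have l_seg: "l t \<in> closed_segment x y" if "t \<in> {0..1}" for t
    using that by (auto simp: l_def in_segment algebra_simps intro!: exI[of _ t])
  have l_cont: "continuous_on S l" for S unfolding l_def by (intro continuous_intros)
  have l_der: "(l has_vector_derivative y - x) (at t within S)" for t S
    unfolding l_def by (auto intro!: derivative_eq_intros)
  have ran: "l t \<in> chart_ran c" if "t \<in> {0..1}" for t using l_seg[OF that] seg by auto
  have cont: "continuous_on {0..1} \<gamma>"
    unfolding \<gamma>_def by (rule continuous_on_compose2[OF continuous_on_chart_inv[OF c] l_cont]) (use ran in auto)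
  have C1: "C1_curve \<A> 0 1 \<gamma>"
  proof (rule C1_curve_chart[OF c cont])
    show "continuous_on {0..1} (\<lambda>t::real. y - x)" by simp
    fix t :: real assume t: "t \<in> {0..1}"
    show "\<gamma> t \<in> chart_dom c" using ran[OF t] c by (simp add: \<gamma>_def)
    show "((coord c \<circ> \<gamma>) has_vector_derivative y - x) (at t within {0..1})"
      by (rule has_vector_derivative_transform[OF t _ l_der]) (use c ran in \<open>auto simp: \<gamma>_def\<close>)
  qed
  \<comment> \<open>One piece, with the embedding \<open>real\<close> as its sequence of
    nodes.\<close>
  have pw: "piecewise_C1_curve \<A> 0 1 \<gamma>"
    unfolding piecewise_C1_curve_def using C1 by (intro exI[of _ 1] exI[of _ real]) auto
  have le: "cut_speed \<gamma> t \<le> B * indicator {0..1} t" for t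
  proof (cases "0 < t \<and> t < 1")
    case True
    then have t: "t \<in> {0..1}" by auto
    have op: "t \<in> {0<..<1}" "open {0<..<1::real}" using True by auto
    have "continuous_on {0<..<1} \<gamma>" by (rule continuous_on_subset[OF cont]) auto
    then have "isCont \<gamma> t" using op by (auto simp: continuous_on_eq_continuous_at)
    moreover have "((coord c \<circ> \<gamma>) has_vector_derivative y - x) (at t)"
      by (rule has_vector_derivative_transform_within_open[OF l_der op(2,1)]) (use c ran in \<open>auto simp: \<gamma>_def\<close>)
    ultimately have "speed \<gamma> t = metric_norm c (coord c (\<gamma> t)) (y - x)"
      by (intro speed_eq) (use c ran[OF t] in \<open>auto simp: \<gamma>_def\<close>)
    also have "\<dots> = metric_norm c (l t) (y - x)" using c ran[OF t] by (simp add: \<gamma>_def)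
    also have "\<dots> \<le> B" by (rule B[OF l_seg[OF t]])
    finally show ?thesis using True by (simp add: cut_speed_def)
  next
    case False
    have "0 \<le> B" using metric_norm_nonneg[OF c, of x "y - x"] B[of x] seg by (auto intro: order_trans)
    then show ?thesis using False by (auto simp: cut_speed_def indicator_def)
  qed
  have "curve_length \<A> G 0 1 \<gamma> \<le> (\<integral>\<^sup>+ t. ennreal (B * indicator {0..1::real} t) \<partial>lborel)"
    unfolding curve_length_eq by (rule nn_integral_mono) (rule ennreal_leI[OF le])
  also have "\<dots> = (\<integral>\<^sup>+ t. ennreal B * indicator {0..1::real} t \<partial>lborel)"
    by (intro nn_integral_cong) (auto simp: indicator_def)
  also have "\<dots> = ennreal B" by (simp add: nn_integral_cmult)
  finally have "curve_length \<A> G 0 1 \<gamma> \<le> ennreal B" .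
  then show ?thesis unfolding riem_dist_def
    by (intro INF_lower2[of \<gamma>]) (use pw in \<open>auto simp: \<gamma>_def l_def\<close>)
qed

lemma riem_dist_refl: "riem_dist \<A> G p p = 0"
proof -
  let ?c = "chart_at \<A> p"
  have "riem_dist \<A> G (chart_inv ?c (coord ?c p)) (chart_inv ?c (coord ?c p)) \<le> ennreal 0"
    by (rule riem_dist_segment) (auto simp: chart_at metric_norm_def blinfun.bilinear_simps)
  then show ?thesis by (simp add: chart_at)
qed

text \<open>
  In infinite dimension a closed coordinate ball is not compact, so it is not clear a priori that it
  is closed in the manifold.  A curve of finite length which stays in the chart up to time \<open>\<tau>\<close>,
  however, has a limit in coordinates, and this limit is the curve point because the manifold is
  Hausdorff.
\<close>

lemma riem_dist_less_imp_chart_ball: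
  assumes c: "c \<in> \<A>" "p \<in> chart_dom c" and r: "r > 0" and m: "m > 0"
    and ball: "ball (coord c p) r \<subseteq> chart_ran c"
    and lower: "\<And>z u. z \<in> ball (coord c p) r \<Longrightarrow> m * norm u \<le> metric_norm c z u"
    and q: "riem_dist \<A> G p q < ennreal (m * r)"
  shows "q \<in> chart_dom c \<and> coord c q \<in> ball (coord c p) r"
proof -
  obtain \<gamma> where \<gamma>: "piecewise_C1_curve \<A> 0 1 \<gamma>" "\<gamma> 0 = p" "\<gamma> 1 = q" "curve_length \<A> G 0 1 \<gamma> < ennreal (m * r)"
    using q unfolding riem_dist_def INF_less_iff by auto
  obtain K where K: "finite K" and cont: "continuous_on {0..1} \<gamma>"
    and reg: "\<And>t c. 0 < t \<Longrightarrow> t < 1 \<Longrightarrow> t \<notin> K \<Longrightarrow> c \<in> \<A> \<Longrightarrow> \<gamma> t \<in> chart_dom c \<Longrightarrow>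
       isCont \<gamma> t \<and> (\<exists>v. ((coord c \<circ> \<gamma>) has_vector_derivative v) (at t))"
    by (rule piecewise_C1_regular[OF \<gamma>(1)]) blast
  have len: "(\<integral>\<^sup>+ t. ennreal (cut_speed \<gamma> t) \<partial>lborel) < ennreal (m * r)"
    using \<gamma>(4) by (simp add: curve_length_eq)
  then have fin: "(\<integral>\<^sup>+ t. ennreal (cut_speed \<gamma> t) \<partial>lborel) < \<infinity>" by (auto intro: less_trans)
  have int: "cut_speed \<gamma> integrable_on UNIV"
    by (rule nn_integral_integrable_on[OF cut_speed_measurable[OF \<gamma>(1)] cut_speed_nonneg fin])
  have total: "integral UNIV (cut_speed \<gamma>) < m * r"
    using len nn_integral_lborel_eq_integral[OF cut_speed_measurable[OF \<gamma>(1)] cut_speed_nonneg fin] m r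
    by (simp add: ennreal_less_iff integral_nonneg[OF int] cut_speed_nonneg)
  have int_ab: "cut_speed \<gamma> integrable_on {a..b}" for a b by (rule integrable_on_subinterval[OF int]) auto
  \<comment> \<open>Division by \<open>m\<close> passes from Riemannian to coordinate length, so
    increments of \<open>\<Lambda>\<close> bound coordinate displacements, and its total increase is
    less than \<open>r\<close>.\<close>
  define \<Lambda> where "\<Lambda> t = integral {0..t} (cut_speed \<gamma>) / m" for t
  define W where "W = {q \<in> chart_dom c. coord c q \<in> ball (coord c p) r}"
  have "\<gamma> 1 \<in> W"
  proof (rule continuous_induction)
    have "open W" unfolding W_def by (rule open_coord_preimage[OF c(1)]) simp
    then show "openin (top_of_set {0..1}) {t \<in> {0..1}. \<gamma> t \<in> W}"
      using continuous_openin_preimage_gen[OF cont] by (simp add: vimage_def Int_def)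
    show "\<gamma> 0 \<in> W" using \<gamma> c r by (simp add: W_def)
    fix \<tau> :: real assume \<tau>: "0 < \<tau>" "\<tau> \<le> 1" and W: "\<And>s. 0 \<le> s \<Longrightarrow> s < \<tau> \<Longrightarrow> \<gamma> s \<in> W"
    have inc: "norm ((coord c \<circ> \<gamma>) b - (coord c \<circ> \<gamma>) a) \<le> \<Lambda> b - \<Lambda> a" if ab: "0 \<le> a" "a \<le> b" "b < \<tau>" for a b
    proof -
      \<comment> \<open>The value 0 is a filler at the nodes and at time 0, where the curve need not
        be differentiable; the fundamental theorem of calculus tolerates finitely many such
        times.\<close>
      define x' where "x' t = (if t \<in> K \<union> {0} then 0 else vector_derivative (coord c \<circ> \<gamma>) (at t))" for t
      have der: "((coord c \<circ> \<gamma>) has_vector_derivative x' t) (at t)" "isCont \<gamma> t" if "t \<in> {a..b} - (K \<union> {0})" for t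
        using reg[of t c] W[of t] that ab \<tau> c
        by (auto simp: x'_def W_def intro: vector_derivative_works[THEN iffD1, OF differentiableI_vector])
      have dom: "\<gamma> t \<in> chart_dom c" if "t \<in> {a..b}" for t using W[of t] that ab by (auto simp: W_def)
      have "(x' has_integral ((coord c \<circ> \<gamma>) b - (coord c \<circ> \<gamma>) a)) {a..b}"
      proof (rule fundamental_theorem_of_calculus_strong[of "K \<union> {0}"])
        show "continuous_on {a..b} (coord c \<circ> \<gamma>)"
          by (rule continuous_on_compose[OF continuous_on_subset[OF cont] continuous_on_subset[OF continuous_on_coord[OF c(1)]]])
             (use ab \<tau> dom in auto)
      qed (use K ab der(1) in blast)+
      moreover have "norm (x' t) \<le> cut_speed \<gamma> t / m" if t: "t \<in> {a..b}" for t
      proof (cases "t \<in> K \<union> {0}")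
        case True then show ?thesis using m cut_speed_nonneg[of \<gamma> t] by (simp add: x'_def)
      next
        case False
        then have "m * norm (x' t) \<le> metric_norm c (coord c (\<gamma> t)) (x' t)"
          using W[of t] t ab by (intro lower) (auto simp: W_def)
        also have "\<dots> = speed \<gamma> t" using der[of t] False t dom[OF t] c by (intro speed_eq[symmetric]) auto
        also have "\<dots> = cut_speed \<gamma> t" using False t ab \<tau> by (auto simp: cut_speed_def)
        finally show ?thesis using m by (simp add: pos_le_divide_eq mult.commute)
      qed
      ultimately have "norm ((coord c \<circ> \<gamma>) b - (coord c \<circ> \<gamma>) a) \<le> integral {a..b} (\<lambda>t. cut_speed \<gamma> t / m)"
        using Henstock_Kurzweil_Integration.integral_norm_bound_integral[of x' "{a..b}" "\<lambda>t. cut_speed \<gamma> t / m"]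
          has_integral_divide[OF integrable_integral[OF int_ab[of a b]], of m, THEN has_integral_integrable]
        by (auto simp: has_integral_iff)
      also have "\<dots> = \<Lambda> b - \<Lambda> a"
        using Henstock_Kurzweil_Integration.integral_combine[of 0 a b "cut_speed \<gamma>"] int_ab[of 0 b] ab
        by (simp add: \<Lambda>_def diff_divide_distrib[symmetric])
      finally show ?thesis .
    qed
    have "continuous_on {0..\<tau>} \<Lambda>"
      unfolding \<Lambda>_def by (intro continuous_intros indefinite_integral_continuous_1 int_ab) (use m in auto)
    then obtain l where l: "((coord c \<circ> \<gamma>) \<longlongrightarrow> l) (at_left \<tau>)" "norm (l - (coord c \<circ> \<gamma>) 0) \<le> \<Lambda> \<tau> - \<Lambda> 0"
      using limit_at_left_of_bounded_variation[of \<tau> \<Lambda> "coord c \<circ> \<gamma>", OF \<tau>(1) _ inc] by blast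
    \<comment> \<open>The strict bound on the total length puts the limit into the open ball, hence
      into the chart.\<close>
    have "\<Lambda> \<tau> - \<Lambda> 0 = integral {0..\<tau>} (cut_speed \<gamma>) / m" by (simp add: \<Lambda>_def)
    also have "\<dots> \<le> integral UNIV (cut_speed \<gamma>) / m"
      using m by (intro divide_right_mono integral_subset_le int_ab int) (auto simp: cut_speed_nonneg)
    also have "\<dots> < r" using total m by (simp add: pos_divide_less_eq mult.commute)
    finally have lr: "l \<in> ball (coord c p) r" using l(2) \<gamma>(2) by (simp add: dist_norm norm_minus_commute)
    have "(\<gamma> \<longlongrightarrow> \<gamma> \<tau>) (at \<tau> within {0..\<tau>})"
      using continuous_on_subset[OF cont, of "{0..\<tau>}"] \<tau> by (auto simp: continuous_on_def)
    then have "(\<gamma> \<longlongrightarrow> \<gamma> \<tau>) (at_left \<tau>)" using \<tau> by (simp add: at_within_Icc_at_left)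
    moreover have "\<forall>\<^sub>F s in at_left \<tau>. \<gamma> s \<in> chart_dom c"
      using eventually_at_left_real[OF \<tau>(1)] by eventually_elim (use W in \<open>auto simp: W_def\<close>)
    ultimately have "\<gamma> \<tau> = chart_inv c l"
      using chart_limit[OF c(1) _ l(1)] lr ball by auto
    then show "\<gamma> \<tau> \<in> W" using lr ball c by (auto simp: W_def subset_iff)
  qed simp
  then show ?thesis using \<gamma>(3) by (simp add: W_def)
qed

end

section \<open>Geodesics and the exponential map\<close>

context riemannian_manifold
begin

definition metric_deriv :: "('m, 'h) chart \<Rightarrow> 'h \<Rightarrow> 'h \<Rightarrow>\<^sub>L ('h \<Rightarrow>\<^sub>L ('h \<Rightarrow>\<^sub>L real))" where
  "metric_deriv c = (SOME f1. \<exists>f2. C2_on (chart_ran c) (G c) f1 f2)"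

lemma C2_on_metric:
  assumes "c \<in> \<A>"
  obtains f2 where "C2_on (chart_ran c) (G c) (metric_deriv c) f2"
proof -
  have "\<exists>f1 f2. C2_on (chart_ran c) (G c) f1 f2"
    using smooth_on_imp_C2_on[OF open_chart_ran[OF assms] smooth_metric[OF assms]] by metis
  then have "\<exists>f2. C2_on (chart_ran c) (G c) (metric_deriv c) f2"
    unfolding metric_deriv_def by (rule someI_ex)
  then show thesis using that by blast
qed

lemma metric_has_derivative:
  assumes "c \<in> \<A>" "x \<in> chart_ran c"
  shows "(G c has_derivative blinfun_apply (metric_deriv c x)) (at x)"
  using C2_on_metric[OF assms(1)] assms(2) by (metis C2_on_def)

lemma frechet_derivative_metric:
  "c \<in> \<A> \<Longrightarrow> x \<in> chart_ran c \<Longrightarrow> frechet_derivative (G c) (at x) = blinfun_apply (metric_deriv c x)"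
  by (rule frechet_derivative_at[symmetric, OF metric_has_derivative])

text \<open>Pointwise form of the equation in \<open>geodesic_on\<close>, with the acceleration as a
  separate argument, so that it can be transformed between charts and solved for.\<close>

definition geodesic_eq :: "('m, 'h) chart \<Rightarrow> 'h \<Rightarrow> 'h \<Rightarrow> 'h \<Rightarrow> bool" where
  "geodesic_eq c x v a \<longleftrightarrow>
     (\<forall>w. G c x a w + metric_deriv c x v v w - metric_deriv c x w v v / 2 = 0)"

text \<open>Product rule applied to \<open>metric_trans\<close>; the second derivative of the
  transition map contributes the two terms that are not tensorial.\<close>

lemma metric_deriv_trans:
  assumes c: "c \<in> \<A>" "c' \<in> \<A>" and p: "p \<in> chart_dom c" "p \<in> chart_dom c'"
  defines "x \<equiv> coord c p" and "y \<equiv> coord c' p"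
  shows "metric_deriv c x h u w =
    metric_deriv c' y (trans_deriv c c' x h) (trans_deriv c c' x u) (trans_deriv c c' x w) +
    G c' y (trans_deriv2 c c' x h u) (trans_deriv c c' x w) +
    G c' y (trans_deriv c c' x u) (trans_deriv2 c c' x h w)"
proof -
  let ?T = "transition c c'" and ?T1 = "trans_deriv c c'" and ?T2 = "trans_deriv2 c c'"
  have xo: "x \<in> overlap c c'" and xr: "x \<in> chart_ran c" and yr: "y \<in> chart_ran c'"
    using p by (auto simp: x_def y_def coord_in_overlap)
  have Tx: "?T x = y" using c p by (simp add: x_def y_def)
  have T1u: "((\<lambda>z. ?T1 z u) has_derivative (\<lambda>h. ?T2 x h u)) (at x)" for u
    using blinfun.FDERIV[OF transition_has_derivative(2)[OF c xo] has_derivative_const[of u]]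
    by (simp add: blinfun.bilinear_simps)
  have GT: "((\<lambda>z. G c' (?T z)) has_derivative (\<lambda>h. metric_deriv c' y (?T1 x h))) (at x)"
    using has_derivative_compose[OF transition_has_derivative(1)[OF c xo] , of "G c'"] metric_has_derivative[OF c(2) yr]
    by (simp add: Tx)
  have "((\<lambda>z. G c' (?T z) (?T1 z u) (?T1 z w)) has_derivative
     (\<lambda>h. G c' (?T x) (?T1 x u) (?T2 x h w) + (G c' (?T x) (?T2 x h u) + metric_deriv c' y (?T1 x h) (?T1 x u)) (?T1 x w))) (at x)"
    by (rule blinfun.FDERIV[OF blinfun.FDERIV[OF GT T1u] T1u])
  moreover have "((\<lambda>z. G c' (?T z) (?T1 z u) (?T1 z w)) has_derivative (\<lambda>h. metric_deriv c x h u w)) (at x)"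
  proof (rule has_derivative_transform_within_open[OF _ open_overlap[OF c] xo])
    show "((\<lambda>z. G c z u w) has_derivative (\<lambda>h. metric_deriv c x h u w)) (at x)"
      using blinfun.FDERIV[OF blinfun.FDERIV[OF metric_has_derivative[OF c(1) xr] has_derivative_const[of u]] has_derivative_const[of w]]
      by (simp add: blinfun.bilinear_simps)
    fix z assume "z \<in> overlap c c'"
    then show "G c z u w = G c' (?T z) (?T1 z u) (?T1 z w)"
      using metric_trans[OF c] c by (auto simp: overlap_def)
  qed
  ultimately have "(\<lambda>h. G c' (?T x) (?T1 x u) (?T2 x h w) + (G c' (?T x) (?T2 x h u) + metric_deriv c' y (?T1 x h) (?T1 x u)) (?T1 x w))
     = (\<lambda>h. metric_deriv c x h u w)"
    by (rule has_derivative_unique)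
  then have "metric_deriv c x h u w = G c' (?T x) (?T1 x u) (?T2 x h w) + (G c' (?T x) (?T2 x h u) + metric_deriv c' y (?T1 x h) (?T1 x u)) (?T1 x w)"
    by (rule fun_cong[symmetric])
  then show ?thesis by (simp add: Tx blinfun.bilinear_simps)
qed

text \<open>By symmetry of the second derivative, half of the two extra terms from
  \<open>metric_deriv c x w v v\<close> cancels one of those from
  \<open>metric_deriv c x v v w\<close>. The extra term that survives belongs to the transformed
  acceleration.\<close>

lemma geodesic_eq_trans:
  assumes c: "c \<in> \<A>" "c' \<in> \<A>" and p: "p \<in> chart_dom c" "p \<in> chart_dom c'"
    and eq: "geodesic_eq c (coord c p) v a"
  shows "geodesic_eq c' (coord c' p) (trans_deriv c c' (coord c p) v)
    (trans_deriv2 c c' (coord c p) v v + trans_deriv c c' (coord c p) a)"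
  unfolding geodesic_eq_def
proof
  fix w'
  define x where "x = coord c p"
  define y where "y = coord c' p"
  define w where "w = trans_deriv c' c y w'"
  let ?T1 = "trans_deriv c c' x" and ?T2 = "trans_deriv2 c c' x" and ?D = "metric_deriv c' y"
  have w': "w' = ?T1 w" by (simp add: w_def x_def y_def trans_deriv_inverse[OF c p])
  have yr: "y \<in> chart_ran c'" using p by (simp add: y_def)
  have "G c x a w = G c' y (?T1 a) (?T1 w)" using metric_trans[OF c p] by (simp add: x_def y_def)
  moreover have "metric_deriv c x v v w = ?D (?T1 v) (?T1 v) (?T1 w) + G c' y (?T2 v v) (?T1 w) + G c' y (?T1 v) (?T2 v w)"
    unfolding x_def y_def by (rule metric_deriv_trans[OF c p])
  moreover have "metric_deriv c x w v v = ?D (?T1 w) (?T1 v) (?T1 v) + G c' y (?T2 w v) (?T1 v) + G c' y (?T1 v) (?T2 w v)"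
    unfolding x_def y_def by (rule metric_deriv_trans[OF c p])
  moreover have "?T2 w v = ?T2 v w" using trans_deriv2_sym[OF c coord_in_overlap[OF p]] by (simp add: x_def)
  moreover have "G c' y (?T2 v w) (?T1 v) = G c' y (?T1 v) (?T2 v w)" by (rule metric_sym[OF c(2) yr])
  moreover have "G c x a w + metric_deriv c x v v w - metric_deriv c x w v v / 2 = 0"
    using eq by (simp add: geodesic_eq_def x_def)
  ultimately show "G c' (coord c' p) (trans_deriv2 c c' (coord c p) v v + trans_deriv c c' (coord c p) a) w' +
     metric_deriv c' (coord c' p) (trans_deriv c c' (coord c p) v) (trans_deriv c c' (coord c p) v) w' -
     metric_deriv c' (coord c' p) w' (trans_deriv c c' (coord c p) v) (trans_deriv c c' (coord c p) v) / 2 = 0"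
    by (simp add: w' x_def[symmetric] y_def[symmetric] blinfun.bilinear_simps)
qed

text \<open>\<open>geodesic_on\<close> demands the equation in every chart; by invariance it may be
  verified in one chart that contains the curve.\<close>

lemma geodesic_on_chart:
  assumes c: "c \<in> \<A>" and cont: "continuous_on {a..b} \<gamma>" and dom: "\<And>t. t \<in> {a..b} \<Longrightarrow> \<gamma> t \<in> chart_dom c"
    and x': "\<And>t. t \<in> {a..b} \<Longrightarrow> ((coord c \<circ> \<gamma>) has_vector_derivative x' t) (at t within {a..b})"
    and x'': "\<And>t. t \<in> {a..b} \<Longrightarrow> (x' has_vector_derivative x'' t) (at t within {a..b})"
    and eq: "\<And>t. t \<in> {a..b} \<Longrightarrow> geodesic_eq c (coord c (\<gamma> t)) (x' t) (x'' t)"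
  shows "geodesic_on \<A> G a b \<gamma>"
  unfolding geodesic_on_def Let_def
proof (intro conjI ballI)
  fix c' assume c': "c' \<in> \<A>"
  let ?J = "{t \<in> {a..b}. \<gamma> t \<in> chart_dom c'}"
  define y' where "y' t = trans_deriv c c' (coord c (\<gamma> t)) (x' t)" for t
  define y'' where "y'' t = trans_deriv2 c c' (coord c (\<gamma> t)) (x' t) (x' t) + trans_deriv c c' (coord c (\<gamma> t)) (x'' t)" for t
  have *: "((coord c' \<circ> \<gamma>) has_vector_derivative y' t) (at t within ?J) \<and> (y' has_vector_derivative y'' t) (at t within ?J) \<and>
    geodesic_eq c' (coord c' (\<gamma> t)) (y' t) (y'' t)" if t: "t \<in> ?J" for t
  proof -
    have t': "t \<in> {a..b}" using t by auto
    have tc: "\<gamma> t \<in> chart_dom c" "\<gamma> t \<in> chart_dom c'" using t dom by auto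
    have xJ: "((coord c \<circ> \<gamma>) has_vector_derivative x' t) (at t within ?J)"
      by (rule has_vector_derivative_within_subset[OF x'[OF t']]) auto
    have x'J: "(x' has_vector_derivative x'' t) (at t within ?J)"
      by (rule has_vector_derivative_within_subset[OF x''[OF t']]) auto
    have "continuous_on ?J \<gamma>" by (rule continuous_on_subset[OF cont]) auto
    then have contJ: "continuous (at t within ?J) \<gamma>" using t by (simp add: continuous_on_eq_continuous_within)
    have "((coord c' \<circ> \<gamma>) has_vector_derivative y' t) (at t within ?J)"
      unfolding y'_def by (rule coord_change_vector_derivative[OF c c' tc t contJ xJ])
    moreover have "(y' has_vector_derivative y'' t) (at t within ?J)"
    proof -
      have "(trans_deriv c c' \<circ> (coord c \<circ> \<gamma>) has_vector_derivative trans_deriv2 c c' (coord c (\<gamma> t)) (x' t)) (at t within ?J)"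
        by (rule vector_derivative_diff_chain_within[OF xJ])
           (simp add: has_derivative_at_withinI[OF transition_has_derivative(2)[OF c c' coord_in_overlap[OF tc]]])
      from blinfun.has_vector_derivative[OF this x'J]
      show ?thesis by (simp add: y'_def[abs_def] y''_def o_def add.commute)
    qed
    moreover have "geodesic_eq c' (coord c' (\<gamma> t)) (y' t) (y'' t)"
      unfolding y'_def y''_def by (rule geodesic_eq_trans[OF c c' tc eq[OF t']])
    ultimately show ?thesis by blast
  qed
  show "\<exists>x' x''. \<forall>t\<in>?J.
          (coord c' \<circ> \<gamma> has_vector_derivative x' t) (at t within ?J) \<and>
          (x' has_vector_derivative x'' t) (at t within ?J) \<and>
          (\<forall>w. G c' ((coord c' \<circ> \<gamma>) t) (x'' t) w + frechet_derivative (G c') (at ((coord c' \<circ> \<gamma>) t)) (x' t) (x' t) w -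
                frechet_derivative (G c') (at ((coord c' \<circ> \<gamma>) t)) w (x' t) (x' t) / 2 = 0)"
    by (rule exI[of _ y'], rule exI[of _ y''])
       (use * in \<open>auto simp: frechet_derivative_metric[OF c'] geodesic_eq_def\<close>)
qed (rule cont)

text \<open>Without compact balls, uniform bounds come from continuity at the centre: the second
  derivative of the metric is bounded near \<open>z\<close>, and the mean value inequality passes
  this on to the first derivative and to the metric.\<close>

lemma metric_local_bounds:
  assumes c: "c \<in> \<A>" and z: "z \<in> chart_ran c"
  obtains R m M where "R > 0" "m > 0" "M > 0" "cball z R \<subseteq> chart_ran c"
    "\<And>x u. x \<in> cball z R \<Longrightarrow> m * (norm u)\<^sup>2 \<le> G c x u u"
    "\<And>x. x \<in> cball z R \<Longrightarrow> norm (metric_deriv c x) \<le> M"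
    "\<And>x y. x \<in> cball z R \<Longrightarrow> y \<in> cball z R \<Longrightarrow> norm (G c x - G c y) \<le> M * norm (x - y)"
    "\<And>x y. x \<in> cball z R \<Longrightarrow> y \<in> cball z R \<Longrightarrow> norm (metric_deriv c x - metric_deriv c y) \<le> M * norm (x - y)"
proof -
  obtain f2 where C2: "C2_on (chart_ran c) (G c) (metric_deriv c) f2" by (rule C2_on_metric[OF c])
  obtain m0 where m0: "m0 > 0" "\<And>u. m0 * (norm u)\<^sup>2 \<le> G c z u u" using metric_coercive[OF c z] by blast
  define L where "L = norm (f2 z) + 1"
  define M where "M = norm (metric_deriv c z) + L"
  have LM: "0 < L" "L \<le> M" "0 < M" by (auto simp: L_def M_def add_nonneg_pos)
  obtain r where r: "r > 0" "cball z r \<subseteq> chart_ran c" using open_chart_ran[OF c] z open_contains_cball by metis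
  have "continuous_on (chart_ran c) f2" using C2 by (simp add: C2_on_def)
  then have "isCont f2 z" using open_chart_ran[OF c] z by (simp add: continuous_on_eq_continuous_at)
  then obtain d where d: "d > 0" "\<And>x. dist x z < d \<Longrightarrow> dist (f2 x) (f2 z) < 1"
    unfolding continuous_at_eps_delta by (meson zero_less_one)
  \<comment> \<open>The last entry lets the Gram form change by at most half of its coercivity; the
    entry 1 lets the first derivative change by at most \<open>L\<close>.\<close>
  define R where "R = min (min r (d / 2)) (min 1 (m0 / (2 * M)))"
  have R: "R > 0" "R \<le> r" "R < d" "R \<le> 1" "R \<le> m0 / (2 * M)" using r d m0 LM by (auto simp: R_def)
  have sub: "cball z R \<subseteq> chart_ran c" using r(2) R(2) by (auto simp: subset_iff)
  have f2_le: "norm (f2 x) \<le> L" if "x \<in> cball z R" for x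
  proof -
    have "dist (f2 x) (f2 z) < 1" using that R by (intro d(2)) (auto simp: dist_commute)
    then show ?thesis using norm_triangle_ineq2[of "f2 x" "f2 z"] by (simp add: L_def dist_norm)
  qed
  have DL: "norm (metric_deriv c x - metric_deriv c y) \<le> L * norm (x - y)" if "x \<in> cball z R" "y \<in> cball z R" for x y
  proof (rule differentiable_bound[where f'="\<lambda>x. blinfun_apply (f2 x)" and S="cball z R"])
    show "(metric_deriv c has_derivative blinfun_apply (f2 x)) (at x within cball z R)" if "x \<in> cball z R" for x
    proof -
      have "x \<in> chart_ran c" using sub that by auto
      then show ?thesis using C2 unfolding C2_on_def by (auto intro!: has_derivative_at_withinI[of _ _ x "cball z R"])
    qed
    show "onorm (blinfun_apply (f2 x)) \<le> L" if "x \<in> cball z R" for x using f2_le[OF that] by (simp add: norm_blinfun.rep_eq)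
  qed (use that in auto)
  have D_le: "norm (metric_deriv c x) \<le> M" if "x \<in> cball z R" for x
  proof -
    have "norm (metric_deriv c x - metric_deriv c z) \<le> L * norm (x - z)" using that R by (intro DL) auto
    also have "\<dots> \<le> L * 1" using that R LM by (intro mult_left_mono) (auto simp: dist_norm norm_minus_commute)
    finally show ?thesis using norm_triangle_ineq2[of "metric_deriv c x" "metric_deriv c z"] by (simp add: M_def)
  qed
  have GL: "norm (G c x - G c y) \<le> M * norm (x - y)" if "x \<in> cball z R" "y \<in> cball z R" for x y
  proof (rule differentiable_bound[where f'="\<lambda>x. blinfun_apply (metric_deriv c x)" and S="cball z R"])
    show "(G c has_derivative blinfun_apply (metric_deriv c x)) (at x within cball z R)" if "x \<in> cball z R" for x
      by (rule has_derivative_at_withinI[OF metric_has_derivative[OF c]]) (use sub that in auto)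
    show "onorm (blinfun_apply (metric_deriv c x)) \<le> M" if "x \<in> cball z R" for x using D_le[OF that] by (simp add: norm_blinfun.rep_eq)
  qed (use that in auto)
  show thesis
  proof (rule that[of R "m0 / 2" M])
    fix x y assume x: "x \<in> cball z R" and y: "y \<in> cball z R"
    have "L * norm (x - y) \<le> M * norm (x - y)" using LM by (intro mult_right_mono) auto
    then show "norm (metric_deriv c x - metric_deriv c y) \<le> M * norm (x - y)" using DL[OF x y] by simp
  next
    fix x u assume x: "x \<in> cball z R"
    have "norm (G c x - G c z) \<le> M * norm (x - z)" using x R by (intro GL) auto
    also have "\<dots> \<le> M * (m0 / (2 * M))" using x R LM by (intro mult_left_mono) (auto simp: dist_norm norm_minus_commute)
    also have "\<dots> = m0 / 2" using LM by simp
    finally have n: "norm (G c x - G c z) \<le> m0 / 2" .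
    have "\<bar>(G c x - G c z) u u\<bar> \<le> norm (G c x - G c z) * norm u * norm u"
      using norm_blinfun2[of "G c x - G c z" u u] by simp
    also have "\<dots> \<le> (m0 / 2 * norm u) * norm u" using n by (intro mult_right_mono) auto
    finally have "\<bar>(G c x - G c z) u u\<bar> \<le> m0 / 2 * (norm u)\<^sup>2" by (simp add: power2_eq_square)
    from abs_le_D2[OF this] show "m0 / 2 * (norm u)\<^sup>2 \<le> G c x u u" using m0(2)[of u] by (simp add: blinfun.bilinear_simps)
  qed (use R m0 LM sub D_le GL in auto)
qed

text \<open>Minus the Christoffel form at \<open>v\<close>, \<open>v\<close>. It exists by
  \<open>riesz_coercive\<close> and is unique by coercivity.\<close>

definition acceleration :: "('m, 'h) chart \<Rightarrow> 'h \<Rightarrow> 'h \<Rightarrow> 'h" where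
  "acceleration c x v = (SOME a. geodesic_eq c x v a)"

lemma geodesic_eq_acceleration:
  assumes c: "c \<in> \<A>" and x: "x \<in> chart_ran c"
  shows "geodesic_eq c x v (acceleration c x v)"
proof -
  obtain m where m: "m > 0" "\<And>u. m * (norm u)\<^sup>2 \<le> G c x u u" using metric_coercive[OF c x] by blast
  define l where "l w = metric_deriv c x w v v / 2 - metric_deriv c x v v w" for w
  have "bounded_linear l"
    unfolding l_def
    by (intro bounded_linear_sub bounded_linear_compose[OF bounded_linear_divide]
        bounded_linear_compose[OF blinfun.bounded_linear_left] blinfun.bounded_linear_right)
  then have l: "blinfun_apply (Blinfun l) w = l w" for w by (simp add: bounded_linear_Blinfun_apply)
  obtain a where "\<forall>w. G c x a w = Blinfun l w"
    using riesz_coercive[OF metric_sym[OF c x] m] by blast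
  then have "geodesic_eq c x v a" by (simp add: geodesic_eq_def l l_def)
  then show ?thesis unfolding acceleration_def by (rule someI)
qed

lemma geodesic_eq_unique:
  assumes c: "c \<in> \<A>" and x: "x \<in> chart_ran c" and a: "geodesic_eq c x v a" and b: "geodesic_eq c x v b"
  shows "a = b"
proof -
  obtain m where m: "m > 0" "\<And>u. m * (norm u)\<^sup>2 \<le> G c x u u" using metric_coercive[OF c x] by blast
  have "G c x a (a - b) + metric_deriv c x v v (a - b) - metric_deriv c x (a - b) v v / 2 = 0"
    "G c x b (a - b) + metric_deriv c x v v (a - b) - metric_deriv c x (a - b) v v / 2 = 0"
    using a b unfolding geodesic_eq_def by blast+
  then have "G c x a (a - b) = G c x b (a - b)" by linarith
  then have "G c x (a - b) (a - b) = 0" by (simp add: blinfun.diff_right[of "G c x"] blinfun.diff_left)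
  then have "m * (norm (a - b))\<^sup>2 \<le> 0" using m(2)[of "a - b"] by simp
  then show ?thesis using m(1) by (simp add: mult_le_0_iff)
qed

text \<open>The acceleration is known only through its pairings with test vectors. Testing with the
  vector to be estimated and dividing by the coercivity constant, as in \<open>cancel\<close>, gives
  both bounds.\<close>

lemma acceleration_bounds:
  assumes c: "c \<in> \<A>" and sub: "cball z R \<subseteq> chart_ran c" and m: "m > 0" and M: "M > 0"
    and coercive: "\<And>x u. x \<in> cball z R \<Longrightarrow> m * (norm u)\<^sup>2 \<le> G c x u u"
    and D: "\<And>x. x \<in> cball z R \<Longrightarrow> norm (metric_deriv c x) \<le> M"
    and GL: "\<And>x y. x \<in> cball z R \<Longrightarrow> y \<in> cball z R \<Longrightarrow> norm (G c x - G c y) \<le> M * norm (x - y)"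
    and DL: "\<And>x y. x \<in> cball z R \<Longrightarrow> y \<in> cball z R \<Longrightarrow> norm (metric_deriv c x - metric_deriv c y) \<le> M * norm (x - y)"
  shows "x \<in> cball z R \<Longrightarrow> norm (acceleration c x u) \<le> (3 / 2 * M / m) * (norm u)\<^sup>2"
    and "x \<in> cball z R \<Longrightarrow> y \<in> cball z R \<Longrightarrow> norm u \<le> 1 \<Longrightarrow> norm w \<le> 1 \<Longrightarrow>
      norm (acceleration c x u - acceleration c y w) \<le>
        ((3 / 2 * M + 3 / 2 * M * M / m) / m) * (norm (x - y) + norm (u - w)) * (norm u + norm w)"
proof -
  have eq: "G c x (acceleration c x u) v = metric_deriv c x v u u / 2 - metric_deriv c x u u v" if "x \<in> cball z R" for x u v
    using geodesic_eq_acceleration[OF c, of x u] sub that unfolding geodesic_eq_def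
    by (auto simp: algebra_simps subset_iff dest: spec[of _ v])
  have cancel: "norm a \<le> k / m" if "x \<in> cball z R" "G c x a a \<le> k * norm a" and "0 \<le> k" for x a k
  proof (cases "a = 0")
    case True
    then show ?thesis using \<open>0 \<le> k\<close> m by simp
  next
    case False
    have "m * (norm a)\<^sup>2 \<le> k * norm a" using coercive[OF that(1), of a] that(2) by simp
    then have "(m * norm a) * norm a \<le> k * norm a" by (simp add: power2_eq_square mult.assoc)
    then have "m * norm a \<le> k" using False by (simp add: mult_le_cancel_right)
    then show ?thesis using m by (simp add: pos_le_divide_eq mult.commute)
  qed
  have tri: "\<bar>D a b d\<bar> \<le> K * norm a * norm b * norm d" if "norm D \<le> K" for D :: "'h \<Rightarrow>\<^sub>L 'h \<Rightarrow>\<^sub>L 'h \<Rightarrow>\<^sub>L real" and a b d K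
    by (rule order_trans[OF norm_blinfun3]) (intro mult_right_mono that norm_ge_zero)
  show bound: "norm (acceleration c x u) \<le> (3 / 2 * M / m) * (norm u)\<^sup>2" if x: "x \<in> cball z R" for x u
  proof -
    let ?a = "acceleration c x u"
    have "\<bar>metric_deriv c x ?a u u\<bar> \<le> M * norm ?a * norm u * norm u" "\<bar>metric_deriv c x u u ?a\<bar> \<le> M * norm u * norm u * norm ?a"
      by (rule tri[OF D[OF x]])+
    then have "G c x ?a ?a \<le> (3 / 2 * M * (norm u)\<^sup>2) * norm ?a"
      unfolding eq[OF x] by (simp add: power2_eq_square mult_ac)
    from cancel[OF x this] M show ?thesis by simp
  qed
  show "norm (acceleration c x u - acceleration c y w) \<le>
        ((3 / 2 * M + 3 / 2 * M * M / m) / m) * (norm (x - y) + norm (u - w)) * (norm u + norm w)"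
    if x: "x \<in> cball z R" and y: "y \<in> cball z R" and u: "norm u \<le> 1" and w: "norm w \<le> 1" for x y u w
  proof -
    let ?a = "acceleration c x u" and ?b = "acceleration c y w"
    let ?Dx = "metric_deriv c x" and ?Dy = "metric_deriv c y"
    let ?s = "(norm (x - y) + norm (u - w)) * (norm u + norm w)"
    define d where "d = ?a - ?b"
    \<comment> \<open>Speeds at most 1 turn a square of a speed into a sum of speeds, the form
      required by the Lipschitz condition of \<open>second_order_ode\<close>.\<close>
    have uu: "norm u * norm u \<le> norm u + norm w" using mult_left_le[OF u norm_ge_zero[of u]] norm_ge_zero[of w] by linarith
    have ww: "norm w * norm w \<le> norm u + norm w" using mult_left_le[OF w norm_ge_zero[of w]] norm_ge_zero[of u] by linarith
    have sp: "norm (x - y) * (norm u * norm u) + norm (u - w) * norm u + norm (u - w) * norm w \<le> ?s"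
    proof -
      have "norm (x - y) * (norm u * norm u) \<le> norm (x - y) * (norm u + norm w)" using uu by (intro mult_left_mono) auto
      then show ?thesis by (simp add: algebra_simps)
    qed
    have t1: "\<bar>?Dx d u u - ?Dy d w w\<bar> \<le> M * ?s * norm d"
    proof -
      have "?Dx d u u - ?Dy d w w = (?Dx - ?Dy) d u u + ?Dy d (u - w) u + ?Dy d w (u - w)"
        by (simp add: blinfun.bilinear_simps)
      also have "\<bar>\<dots>\<bar> \<le> (M * norm (x - y)) * norm d * norm u * norm u + M * norm d * norm (u - w) * norm u + M * norm d * norm w * norm (u - w)"
        using tri[OF DL[OF x y], of d u u] tri[OF D[OF y], of d "u - w" u] tri[OF D[OF y], of d w "u - w"] by linarith
      also have "\<dots> = M * norm d * (norm (x - y) * (norm u * norm u) + norm (u - w) * norm u + norm (u - w) * norm w)"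
        by (simp add: algebra_simps)
      also have "\<dots> \<le> M * norm d * ?s" using M by (intro mult_left_mono sp) auto
      finally show ?thesis by (simp add: mult_ac)
    qed
    have t2: "\<bar>?Dx u u d - ?Dy w w d\<bar> \<le> M * ?s * norm d"
    proof -
      have "?Dx u u d - ?Dy w w d = (?Dx - ?Dy) u u d + ?Dy (u - w) u d + ?Dy w (u - w) d"
        by (simp add: blinfun.bilinear_simps)
      also have "\<bar>\<dots>\<bar> \<le> (M * norm (x - y)) * norm u * norm u * norm d + M * norm (u - w) * norm u * norm d + M * norm w * norm (u - w) * norm d"
        using tri[OF DL[OF x y], of u u d] tri[OF D[OF y], of "u - w" u d] tri[OF D[OF y], of w "u - w" d] by linarith
      also have "\<dots> = M * norm d * (norm (x - y) * (norm u * norm u) + norm (u - w) * norm u + norm (u - w) * norm w)"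
        by (simp add: algebra_simps)
      also have "\<dots> \<le> M * norm d * ?s" using M by (intro mult_left_mono sp) auto
      finally show ?thesis by (simp add: mult_ac)
    qed
    have t3: "\<bar>(G c x - G c y) ?b d\<bar> \<le> (3 / 2 * M * M / m) * ?s * norm d"
    proof -
      have "\<bar>(G c x - G c y) ?b d\<bar> \<le> norm (G c x - G c y) * norm ?b * norm d"
        using norm_blinfun2[of "G c x - G c y" ?b d] by simp
      also have "\<dots> \<le> ((M * norm (x - y)) * ((3 / 2 * M / m) * (norm w)\<^sup>2)) * norm d"
        using GL[OF x y] bound[OF y, of w] M by (intro mult_right_mono mult_mono) auto
      also have "\<dots> = (3 / 2 * M * M / m) * (norm (x - y) * (norm w * norm w)) * norm d" by (simp add: power2_eq_square)
      also have "\<dots> \<le> (3 / 2 * M * M / m) * ?s * norm d"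
        using M m ww by (intro mult_right_mono mult_left_mono mult_mono) auto
      finally show ?thesis .
    qed
    \<comment> \<open>Both equations are tested with \<open>d\<close>. Freezing the metric at
      \<open>x\<close> leaves one term for its change between \<open>x\<close> and \<open>y\<close>,
      estimated by \<open>t3\<close>.\<close>
    have "G c x d d = (?Dx d u u - ?Dy d w w) / 2 - (?Dx u u d - ?Dy w w d) - (G c x - G c y) ?b d"
    proof -
      have "G c x d d = G c x ?a d - G c y ?b d - (G c x - G c y) ?b d" by (simp add: d_def blinfun.bilinear_simps)
      also have "\<dots> = (?Dx d u u / 2 - ?Dx u u d) - (?Dy d w w / 2 - ?Dy w w d) - (G c x - G c y) ?b d"
        by (simp only: eq[OF x] eq[OF y])
      finally show ?thesis by (simp add: diff_divide_distrib)
    qed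
    also have "\<dots> \<le> M * ?s * norm d / 2 + M * ?s * norm d + (3 / 2 * M * M / m) * ?s * norm d"
    proof -
      have "a / 2 - b - e \<le> k / 2 + k + k'" if "a \<le> k" "- b \<le> k" "- e \<le> k'" for a b e k k' :: real
        using that by linarith
      from this[OF abs_le_D1[OF t1] abs_le_D2[OF t2] abs_le_D2[OF t3]] show ?thesis .
    qed
    also have "\<dots> = ((3 / 2 * M + 3 / 2 * M * M / m) * ?s) * norm d"
    proof -
      have "k * s * n / 2 + k * s * n + e * s * n = ((3 / 2 * k + e) * s) * n" for k s n e :: real
        by (simp add: algebra_simps)
      then show ?thesis .
    qed
    finally have "G c x d d \<le> ((3 / 2 * M + 3 / 2 * M * M / m) * ?s) * norm d" .
    from cancel[OF x this] M m have "norm d \<le> ((3 / 2 * M + 3 / 2 * M * M / m) * ?s) / m" by simp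
    then show ?thesis by (simp add: d_def mult.assoc)
  qed
qed

lemma geodesic_ode:
  assumes c: "c \<in> \<A>" and z: "z \<in> chart_ran c"
  obtains C R \<beta> where "second_order_ode (acceleration c) z C R \<beta>" "2 * \<beta> < R" "cball z R \<subseteq> chart_ran c"
proof -
  obtain R m M where R: "R > 0" "m > 0" "M > 0" "cball z R \<subseteq> chart_ran c"
    and B: "\<And>x u. x \<in> cball z R \<Longrightarrow> m * (norm u)\<^sup>2 \<le> G c x u u"
    "\<And>x. x \<in> cball z R \<Longrightarrow> norm (metric_deriv c x) \<le> M"
    "\<And>x y. x \<in> cball z R \<Longrightarrow> y \<in> cball z R \<Longrightarrow> norm (G c x - G c y) \<le> M * norm (x - y)"
    "\<And>x y. x \<in> cball z R \<Longrightarrow> y \<in> cball z R \<Longrightarrow> norm (metric_deriv c x - metric_deriv c y) \<le> M * norm (x - y)"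
    by (rule metric_local_bounds[OF c z]) blast
  define C where "C = (3 / 2 * M + 3 / 2 * M * M / m) / m"
  have C: "C > 0" "3 / 2 * M / m \<le> C"
    unfolding C_def by (use R in \<open>simp add: add_pos_pos\<close>) (rule divide_right_mono, use R in auto)
  \<comment> \<open>\<open>R / 4\<close> rather than \<open>R / 2\<close>, so that 2 \<beta> < R
    holds strictly and slow geodesics stay inside the open ball.\<close>
  define \<beta> where "\<beta> = min (R / 4) (min (1/2) (1 / (32 * C)))"
  have \<beta>: "0 < \<beta>" "\<beta> \<le> R / 4" "\<beta> \<le> 1/2" "\<beta> \<le> 1 / (32 * C)" using R C by (auto simp: \<beta>_def)
  have "second_order_ode (acceleration c) z C R \<beta>"
  proof
    show "32 * C * \<beta> \<le> 1" using \<beta>(4) C by (simp add: pos_le_divide_eq mult.commute)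
    show "norm (acceleration c x u) \<le> C * (norm u)\<^sup>2" if "x \<in> cball z R" for x u
    proof (rule order_trans)
      show "norm (acceleration c x u) \<le> (3 / 2 * M / m) * (norm u)\<^sup>2"
        by (rule acceleration_bounds(1)[OF c R(4,2,3)]) (use B that in blast)+
    qed (intro mult_right_mono C zero_le_power2)
    show "norm (acceleration c x u - acceleration c y w) \<le> C * (norm (x - y) + norm (u - w)) * (norm u + norm w)"
      if "x \<in> cball z R" "y \<in> cball z R" "norm u \<le> 1" "norm w \<le> 1" for x y u w
      unfolding C_def by (rule acceleration_bounds(2)[OF c R(4,2,3)]) (use B that in blast)+
  qed (use \<beta> R C in auto)
  then show thesis using \<beta> R by (intro that) auto
qed

text \<open>
  The competitors in the definition of \<open>riem_exp\<close> may a priori leave the chart and return; the bound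
  on the acceleration shows that a geodesic with small initial velocity cannot.
\<close>

lemma geodesic_is_solution:
  assumes c: "c \<in> \<A>" and p: "p \<in> chart_dom c" and ode: "second_order_ode (acceleration c) (coord c p) C R \<beta>"
    and R: "2 * \<beta> < R" "cball (coord c p) R \<subseteq> chart_ran c"
    and g: "geodesic_on \<A> G 0 1 \<gamma>" "\<gamma> 0 = p" "((coord c \<circ> \<gamma>) has_vector_derivative v) (at 0 within {0..1})"
    and v: "norm v < \<beta>"
  shows "\<gamma> 1 \<in> chart_dom c \<and> (\<exists>u. second_order_ode.solution (acceleration c) (coord c p) \<beta> v (coord c \<circ> \<gamma>) u)"
proof -
  interpret second_order_ode "acceleration c" "coord c p" C R \<beta> by (rule ode)
  define z0 where "z0 = coord c p"
  define x where "x = coord c \<circ> \<gamma>"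
  define J where "J = {t\<in>{0..1}. \<gamma> t \<in> chart_dom c}"
  have cont: "continuous_on {0..1} \<gamma>" using g(1) by (simp add: geodesic_on_def)
  have "\<exists>x' x''. \<forall>t\<in>J. (x has_vector_derivative x' t) (at t within J) \<and>
      (x' has_vector_derivative x'' t) (at t within J) \<and>
      (\<forall>w. G c (x t) (x'' t) w + frechet_derivative (G c) (at (x t)) (x' t) (x' t) w
        - frechet_derivative (G c) (at (x t)) w (x' t) (x' t) / 2 = 0)"
    using g(1) c unfolding geodesic_on_def Let_def J_def x_def by blast
  then obtain x' x'' where xx': "\<forall>t\<in>J. (x has_vector_derivative x' t) (at t within J) \<and>
      (x' has_vector_derivative x'' t) (at t within J) \<and>
      (\<forall>w. G c (x t) (x'' t) w + frechet_derivative (G c) (at (x t)) (x' t) (x' t) w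
        - frechet_derivative (G c) (at (x t)) w (x' t) (x' t) / 2 = 0)" by (elim exE)
  note xx = bspec[OF xx']
  have x1: "(x has_vector_derivative x' t) (at t within J)" and x2: "(x' has_vector_derivative x'' t) (at t within J)" if "t \<in> J" for t
    using xx[OF that] by auto
  have x3: "x'' t = acceleration c (x t) (x' t)" if "t \<in> J" for t
  proof (rule geodesic_eq_unique[OF c _ _ geodesic_eq_acceleration[OF c]])
    show ran: "x t \<in> chart_ran c" using that by (simp add: x_def J_def)
    show "geodesic_eq c (x t) (x' t) (x'' t)"
      using xx[OF that] by (simp add: geodesic_eq_def frechet_derivative_metric[OF c ran])
    show "x t \<in> chart_ran c" by (rule ran)
  qed
  define W where "W = {q \<in> chart_dom c. coord c q \<in> ball z0 R}"
  have W: "open W" unfolding W_def by (rule open_coord_preimage[OF c]) simp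
  have J0: "0 \<in> J" using g p by (simp add: J_def)
  \<comment> \<open>\<open>x'\<close> is a derivative within \<open>J\<close>, while
    \<open>v\<close> is one within the unit interval. Near 0 these two sets coincide.\<close>
  have "x' 0 = v"
  proof -
    have "openin (top_of_set {0..1}) J"
      using continuous_openin_preimage_gen[OF cont open_chart_dom[OF c]] by (simp add: J_def vimage_def Int_def)
    then obtain Q where Q: "open Q" "J = {0..1} \<inter> Q" by (auto simp: openin_open)
    have "at 0 within J = at 0 within {0..1}" by (rule at_within_nhd[of 0 Q]) (use Q J0 in auto)
    then have "(x has_vector_derivative x' 0) (at 0 within {0..1})" using x1[OF J0] by simp
    then show ?thesis using g(3) vector_derivative_unique_within_closed_interval[of 0 1 0 x "x' 0" v] by (simp add: x_def)
  qed
  \<comment> \<open>Bootstrap: as long as the speed is at most 2 \<beta>, the velocity changes by at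
    most \<beta>/8 in total, so it stays below \<beta> + \<beta>/8 and the strict bound is recovered
    at \<tau>.\<close>
  have good: "\<gamma> t \<in> W \<and> norm (x' t) < 2 * \<beta>" if "t \<in> {0..1}" for t
  proof (rule continuous_induction[where P="\<lambda>t. \<gamma> t \<in> W \<and> norm (x' t) < 2 * \<beta>", OF _ _ _ that])
    let ?J' = "{t\<in>{0..1}. \<gamma> t \<in> W}"
    have "openin (top_of_set {0..1}) ?J'"
      using continuous_openin_preimage_gen[OF cont W] by (simp add: vimage_def Int_def)
    moreover have "continuous_on J x'" by (rule continuous_on_vector_derivative) (rule x2)
    then have "continuous_on ?J' (\<lambda>t. norm (x' t))"
      by (intro continuous_intros) (rule continuous_on_subset, auto simp: J_def W_def)
    then have "openin (top_of_set ?J') (?J' \<inter> (\<lambda>t. norm (x' t)) -` {..<2 * \<beta>})"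
      by (rule continuous_openin_preimage_gen) simp
    ultimately have "openin (top_of_set {0..1}) (?J' \<inter> (\<lambda>t. norm (x' t)) -` {..<2 * \<beta>})"
      by (rule openin_trans[rotated])
    also have "?J' \<inter> (\<lambda>t. norm (x' t)) -` {..<2 * \<beta>} = {t\<in>{0..1}. \<gamma> t \<in> W \<and> norm (x' t) < 2 * \<beta>}" by auto
    finally show "openin (top_of_set {0..1}) {t\<in>{0..1}. \<gamma> t \<in> W \<and> norm (x' t) < 2 * \<beta>}" .
    show "\<gamma> 0 \<in> W \<and> norm (x' 0) < 2 * \<beta>"
      using g(2) p R \<beta> v \<open>x' 0 = v\<close> by (simp add: W_def z0_def)
    fix \<tau> :: real assume \<tau>: "0 < \<tau>" "\<tau> \<le> 1" and P: "\<And>s. 0 \<le> s \<Longrightarrow> s < \<tau> \<Longrightarrow> \<gamma> s \<in> W \<and> norm (x' s) < 2 * \<beta>"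
    have inJ: "s \<in> J" if "0 \<le> s" "s < \<tau>" for s using P[OF that] that \<tau> by (auto simp: J_def W_def)
    have inc: "norm (x b - x a) \<le> 2 * \<beta> * b - 2 * \<beta> * a" if ab: "0 \<le> a" "a \<le> b" "b < \<tau>" for a b
    proof -
      have "norm (x b - x a - (b - a) *\<^sub>R 0) \<le> 2 * \<beta> * (b - a)"
      proof (rule vector_mean_value_bound[where g'=x'])
        fix s assume s: "s \<in> {a..b}"
        show "(x has_vector_derivative x' s) (at s within {a..b})"
          by (rule has_vector_derivative_within_subset[OF x1[OF inJ]]) (use s ab inJ in auto)
        show "norm (x' s - 0) \<le> 2 * \<beta>" using P[of s] s ab by auto
      qed (use ab in auto)
      then show ?thesis by (simp add: algebra_simps)
    qed
    obtain l where l: "(x \<longlongrightarrow> l) (at_left \<tau>)" "norm (l - x 0) \<le> 2 * \<beta> * \<tau> - 2 * \<beta> * 0"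
      by (rule limit_at_left_of_bounded_variation[of \<tau> "\<lambda>t. 2 * \<beta> * t" x, OF \<tau>(1) _ inc]) (auto intro!: continuous_intros)
    have "2 * \<beta> * \<tau> \<le> 2 * \<beta> * 1" using \<tau> \<beta> by (intro mult_left_mono) auto
    then have lr: "l \<in> ball z0 R" using l(2) g(2) R by (simp add: dist_norm norm_minus_commute z0_def x_def)
    have "(\<gamma> \<longlongrightarrow> \<gamma> \<tau>) (at \<tau> within {0..\<tau>})"
      using continuous_on_subset[OF cont, of "{0..\<tau>}"] \<tau> by (auto simp: continuous_on_def)
    then have "(\<gamma> \<longlongrightarrow> \<gamma> \<tau>) (at_left \<tau>)" using \<tau> by (simp add: at_within_Icc_at_left)
    moreover have "\<forall>\<^sub>F s in at_left \<tau>. \<gamma> s \<in> chart_dom c"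
      using eventually_at_left_real[OF \<tau>(1)] by eventually_elim (use P in \<open>auto simp: W_def\<close>)
    moreover have lran: "l \<in> chart_ran c" using lr R by (auto simp: z0_def)
    ultimately have "\<gamma> \<tau> = chart_inv c l"
      using chart_limit[OF c lran l(1)[unfolded x_def]] by auto
    then have W\<tau>: "\<gamma> \<tau> \<in> W" using lr lran c by (auto simp: W_def)
    then have sub: "{0..\<tau>} \<subseteq> J" using inJ \<tau> by (force simp: J_def W_def order_le_less)
    have x2': "(x' has_vector_derivative x'' s) (at s within {0..\<tau>})" if "s \<in> {0..\<tau>}" for s
      using that sub by (intro has_vector_derivative_within_subset[OF x2]) auto
    have contx': "continuous_on {0..\<tau>} x'" by (rule continuous_on_vector_derivative) (rule x2')
    \<comment> \<open>By continuity the weak inequality reaches \<tau> itself; the strict one is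
      restored below.\<close>
    have x'le: "norm (x' s) \<le> 2 * \<beta>" if "s \<in> {0..\<tau>}" for s
      by (rule continuous_on_closure_norm_le[of "{0..<\<tau>}"]) (use contx' \<tau> P that in \<open>auto intro: less_imp_le\<close>)
    have "norm (x' \<tau> - x' 0 - (\<tau> - 0) *\<^sub>R 0) \<le> (\<beta> / 8) * (\<tau> - 0)"
    proof (rule vector_mean_value_bound[where g'=x''])
      fix s assume s: "s \<in> {0..\<tau>}"
      then show "(x' has_vector_derivative x'' s) (at s within {0..\<tau>})" by (rule x2')
      have "x s \<in> cball (coord c p) R"
        using s P[of s] W\<tau> by (cases "s = \<tau>") (auto simp: W_def z0_def x_def)
      then have "norm (acceleration c (x s) (x' s)) \<le> C * (norm (x' s))\<^sup>2" by (rule bound)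
      also have "\<dots> \<le> C * (2 * \<beta>)\<^sup>2" using C x'le[OF s] by (intro mult_left_mono power_mono) auto
      also have "\<dots> = (32 * C * \<beta>) * (\<beta> / 8)" by (simp add: power2_eq_square)
      also have "\<dots> \<le> 1 * (\<beta> / 8)" using \<beta> by (intro mult_right_mono) auto
      finally show "norm (x'' s - 0) \<le> \<beta> / 8" using x3 s sub by (simp add: subset_iff)
    qed (use \<tau> in auto)
    also have "\<dots> \<le> (\<beta> / 8) * 1" using \<tau> \<beta> by (intro mult_left_mono) auto
    finally have "norm (x' \<tau> - v) \<le> \<beta> / 8" by (simp add: \<open>x' 0 = v\<close>)
    then have "norm (x' \<tau>) < 2 * \<beta>" using norm_triangle_ineq2[of "x' \<tau>" v] v \<beta> by simp
    with W\<tau> show "\<gamma> \<tau> \<in> W \<and> norm (x' \<tau>) < 2 * \<beta>" by blast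
  qed
  then have J: "J = {0..1}" by (auto simp: J_def W_def)
  have "solution v x x'"
    unfolding solution_def
    using good x1 x2 x3 \<open>x' 0 = v\<close> g(2) by (auto simp: J x_def less_imp_le)
  then show ?thesis using good[of 1] by (auto simp: W_def x_def)
qed

text \<open>For small \<open>v\<close> the description in \<open>riem_exp\<close> has exactly one
  candidate: it exists by \<open>solution_exists\<close>, and by \<open>geodesic_is_solution\<close>
  every competing geodesic is a solution covered by \<open>solution_unique\<close>.\<close>

lemma riem_exp_expansion:
  fixes p :: 'm
  defines "c \<equiv> chart_at \<A> p"
  obtains \<rho> K where "\<rho> > 0" "K \<ge> 0"
    "\<And>v. norm v < \<rho> \<Longrightarrow> \<exists>y \<in> chart_ran c. riem_exp \<A> G p v = chart_inv c y \<and>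
       norm (y - coord c p - v) \<le> K * (norm v)\<^sup>2"
proof -
  have c: "c \<in> \<A>" "p \<in> chart_dom c" by (auto simp: c_def chart_at)
  obtain C R \<beta> where ode: "second_order_ode (acceleration c) (coord c p) C R \<beta>" and R: "2 * \<beta> < R" "cball (coord c p) R \<subseteq> chart_ran c"
    by (rule geodesic_ode[OF c(1) coord_in_ran[OF c(2)]])
  interpret second_order_ode "acceleration c" "coord c p" C R \<beta> by (rule ode)
  show thesis
  proof (rule that[of \<beta> "4 * C"])
    fix v :: 'h assume v: "norm v < \<beta>"
    obtain x u where s: "solution v x u" using solution_exists v by (metis less_imp_le)
    have ball: "x t \<in> cball (coord c p) (2 * \<beta>)" if "t \<in> {0..1}" for t by (rule solution_stays[OF s that])
    have ran: "x t \<in> chart_ran c" if "t \<in> {0..1}" for t using ball[OF that] R by auto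
    define \<gamma> where "\<gamma> t = chart_inv c (x t)" for t
    have co: "(coord c \<circ> \<gamma>) t = x t" if "t \<in> {0..1}" for t using ran[OF that] c by (simp add: \<gamma>_def)
    have x1: "(x has_vector_derivative u t) (at t within {0..1})" and x2: "(u has_vector_derivative acceleration c (x t) (u t)) (at t within {0..1})"
      if "t \<in> {0..1}" for t using s that by (auto simp: solution_def)
    have cx: "((coord c \<circ> \<gamma>) has_vector_derivative u t) (at t within {0..1})" if "t \<in> {0..1}" for t
      by (rule has_vector_derivative_transform[OF that _ x1[OF that]]) (use co in auto)
    have "continuous_on {0..1} x" by (rule continuous_on_vector_derivative) (rule x1)
    then have "continuous_on {0..1} \<gamma>"
      unfolding \<gamma>_def by (rule continuous_on_compose2[OF continuous_on_chart_inv[OF c(1)]]) (use ran in auto)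
    then have geo: "geodesic_on \<A> G 0 1 \<gamma>"
    proof (rule geodesic_on_chart[OF c(1) _ _ cx x2])
      fix t :: real assume t: "t \<in> {0..1}"
      show "\<gamma> t \<in> chart_dom c" using ran[OF t] c by (simp add: \<gamma>_def)
      show "geodesic_eq c (coord c (\<gamma> t)) (u t) (acceleration c (x t) (u t))"
        using geodesic_eq_acceleration[OF c(1) ran[OF t]] co[OF t] by simp
    qed
    have \<gamma>0: "\<gamma> 0 = p" using s c by (simp add: \<gamma>_def solution_def)
    have vel: "((coord c \<circ> \<gamma>) has_vector_derivative v) (at 0 within {0..1})" using cx[of 0] s by (simp add: solution_def)
    have "riem_exp \<A> G p v = chart_inv c (x 1)"
      unfolding riem_exp_def c_def[symmetric]
    proof (rule the_equality)
      show "\<exists>\<gamma>. geodesic_on \<A> G 0 1 \<gamma> \<and> \<gamma> 0 = p \<and> (coord c \<circ> \<gamma> has_vector_derivative v) (at 0 within {0..1}) \<and> \<gamma> 1 = chart_inv c (x 1)"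
        using geo \<gamma>0 vel by (intro exI[of _ \<gamma>]) (simp add: \<gamma>_def)
      fix q assume "\<exists>\<gamma>. geodesic_on \<A> G 0 1 \<gamma> \<and> \<gamma> 0 = p \<and> (coord c \<circ> \<gamma> has_vector_derivative v) (at 0 within {0..1}) \<and> \<gamma> 1 = q"
      then obtain \<eta> where \<eta>: "geodesic_on \<A> G 0 1 \<eta>" "\<eta> 0 = p" "(coord c \<circ> \<eta> has_vector_derivative v) (at 0 within {0..1})" "\<eta> 1 = q"
        by blast
      from geodesic_is_solution[OF c ode R \<eta>(1-3) v] obtain u' where
        "\<eta> 1 \<in> chart_dom c" "solution v (coord c \<circ> \<eta>) u'" by blast
      then show "q = chart_inv c (x 1)" using solution_unique[OF s] \<eta>(4) c by auto
    qed
    then show "\<exists>y \<in> chart_ran c. riem_exp \<A> G p v = chart_inv c y \<and> norm (y - coord c p - v) \<le> 4 * C * (norm v)\<^sup>2"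
      using ran[of 1] solution_estimate[OF s] by auto
  qed (use \<beta> C in auto)
qed

end

section \<open>Proximal subgradients and the decrease principle\<close>

text \<open>\<open>Liminf (at x)\<close> ignores the value at \<open>x\<close>; the assumption
  \<open>a < f x\<close> adds that point, so strict superlevel sets are neighbourhoods of their
  points.\<close>

lemma closed_sublevel_of_lower_semicont:
  fixes f :: "'a::topological_space \<Rightarrow> 'b::complete_linorder"
  assumes "lower_semicont f"
  shows "closed {x. f x \<le> a}"
proof -
  have "\<exists>T. open T \<and> x \<in> T \<and> T \<subseteq> {x. a < f x}" if x: "a < f x" for x
  proof -
    have "f x \<le> Liminf (at x) f" using assms by (simp add: lower_semicont_def)
    then have "\<forall>\<^sub>F y in at x. a < f y" using x by (simp add: le_Liminf_iff)
    then have "\<forall>\<^sub>F y in nhds x. a < f y" using x by (simp add: eventually_nhds_conv_at)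
    then show ?thesis unfolding eventually_nhds by blast
  qed
  then have "open {x. a < f x}" by (subst open_subopen) auto
  moreover have "- {x. f x \<le> a} = {x. a < f x}" by auto
  ultimately show ?thesis by (simp add: closed_def)
qed

text \<open>
  The norm is replaced by the smooth function \<open>h z = sqrt (B (z - z0) (z - z0) + \<theta>\<^sup>2)\<close>, whose gradient
  still has norm at most \<open>1\<close>.  Minimising over the sublevel set \<open>X\<close> with the margin \<open>1\<close> keeps \<open>f\<close>
  real-valued, and points outside \<open>X\<close> satisfy the final inequality trivially.
\<close>

lemma exists_subgradient_near_approximate_minimum:
  fixes f :: "'h::{real_inner, banach} \<Rightarrow> ennreal" and B :: "'h \<Rightarrow>\<^sub>L ('h \<Rightarrow>\<^sub>L real)"
  assumes sym: "\<And>u v. B u v = B v u" and m: "m > 0" and coercive: "\<And>u. m * (norm u)\<^sup>2 \<le> B u u"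
    and R: "R > 0" and closed: "\<And>a. closed {z\<in>cball z0 R. f z \<le> a}" and fin: "f z0 < \<infinity>"
    and \<kappa>: "0 \<le> \<kappa>1" "\<kappa>1 < \<kappa>2" and e: "e > 0"
    and approx_min: "\<And>z. z \<in> cball z0 R \<Longrightarrow> f z0 \<le> f z + ennreal (\<kappa>1 * sqrt (B (z - z0) (z - z0)))"
  obtains z' \<sigma> and l :: "'h \<Rightarrow>\<^sub>L real" where "z' \<in> ball z0 R" "f z' < \<infinity>" "\<sigma> \<ge> 0"
    "\<And>u. l u \<le> (\<kappa>2 + e) * sqrt (B u u)"
    "\<And>z. z \<in> cball z0 R \<Longrightarrow> enn2ereal (f z') + ereal (l (z - z') - \<sigma> * (norm (z - z'))\<^sup>2) \<le> enn2ereal (f z)"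
proof -
  define N where "N u = sqrt (B u u)" for u
  have B0: "0 \<le> B u u" for u using coercive[of u] m by (meson mult_nonneg_nonneg less_imp_le order_trans zero_le_power2)
  have N0: "0 \<le> N u" for u using B0 by (simp add: N_def)
  have N2: "(N u)\<^sup>2 = B u u" for u using B0 by (simp add: N_def)
  have mN: "sqrt m * norm u \<le> N u" for u
    using real_sqrt_le_mono[OF coercive[of u]] m by (simp add: N_def real_sqrt_mult)
  define r where "r = norm z0 + R"
  have r: "r > 0" using R by (simp add: r_def add_nonneg_pos)
  have ball_r: "norm z \<le> r" if "z \<in> cball z0 R" for z
    using that norm_triangle_ineq2[of z z0] by (simp add: r_def dist_norm norm_minus_commute)
  define g where "g z = enn2real (f z)" for z
  obtain f0 where f0: "f z0 = ennreal f0" "f0 \<ge> 0" using fin by (cases "f z0") auto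
  \<comment> \<open>\<open>gap\<close> is the cost of the perturbation at \<open>z0\<close>, half
    for the smoothing and half for the quadratic. The bound 1 fits the margin in \<open>X\<close>;
    the other one keeps the minimiser off the boundary of the ball.\<close>
  define gap where "gap = min 1 ((\<kappa>2 - \<kappa>1) * (sqrt m * R) / 2)"
  have gap: "gap > 0" "gap \<le> 1" "gap < (\<kappa>2 - \<kappa>1) * (sqrt m * R)"
  proof -
    have "0 < (\<kappa>2 - \<kappa>1) * (sqrt m * R)" using \<kappa> m R by simp
    moreover have "0 < min 1 (q / 2) \<and> min 1 (q / 2) \<le> 1 \<and> min 1 (q / 2) < q" if "0 < q" for q :: real
      using that by (auto simp: min_def)
    ultimately show "gap > 0" "gap \<le> 1" "gap < (\<kappa>2 - \<kappa>1) * (sqrt m * R)"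
      unfolding gap_def by blast+
  qed
  have \<kappa>2: "\<kappa>2 > 0" using \<kappa> by simp
  define \<theta> where "\<theta> = gap / (2 * \<kappa>2)"
  have \<theta>: "\<theta> > 0" "\<kappa>2 * \<theta> = gap / 2" using gap \<kappa>2 by (auto simp: \<theta>_def)
  \<comment> \<open>The first entry bounds the cost at \<open>z0\<close>, where
    \<open>norm (z0 - w) \<le> 2 * r\<close>. The second bounds the slope: the gradient of the
    quadratic has norm at most \<open>\<epsilon> * (4 * r)\<close>.\<close>
  define \<epsilon> where "\<epsilon> = min (gap / (8 * r\<^sup>2)) (e * sqrt m / (4 * r))"
  have \<epsilon>: "\<epsilon> > 0" "\<epsilon> * (4 * r\<^sup>2) \<le> gap / 2" "\<epsilon> * (4 * r) \<le> e * sqrt m"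
  proof -
    show "\<epsilon> > 0" using gap r e m by (simp add: \<epsilon>_def)
    have "\<epsilon> * (4 * r\<^sup>2) \<le> (gap / (8 * r\<^sup>2)) * (4 * r\<^sup>2)" by (intro mult_right_mono) (auto simp: \<epsilon>_def)
    then show "\<epsilon> * (4 * r\<^sup>2) \<le> gap / 2" using r by simp
    have "\<epsilon> * (4 * r) \<le> (e * sqrt m / (4 * r)) * (4 * r)" using r by (intro mult_right_mono) (auto simp: \<epsilon>_def)
    then show "\<epsilon> * (4 * r) \<le> e * sqrt m" using r by simp
  qed
  define h where "h z = sqrt (B (z - z0) (z - z0) + \<theta>\<^sup>2)" for z
  have h_pos: "h z > 0" for z using B0[of "z - z0"] \<theta> by (simp add: h_def add_nonneg_pos)
  have h2: "(h z)\<^sup>2 = B (z - z0) (z - z0) + \<theta>\<^sup>2" for z using B0[of "z - z0"] by (simp add: h_def)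
  have h_ge: "N (z - z0) \<le> h z" for z unfolding N_def h_def by (rule real_sqrt_le_mono) simp
  have h0: "h z0 = \<theta>" using \<theta> by (simp add: h_def)
  define X where "X = {z\<in>cball z0 R. f z \<le> ennreal (f0 + 1)}"
  have fX: "f z = ennreal (g z)" if "z \<in> X" for z
    using that unfolding X_def g_def by (cases "f z") (auto simp: top_unique)
  have g_nonneg: "0 \<le> g z" for z by (simp add: g_def)
  have z0X: "z0 \<in> X" using R f0 by (auto simp: X_def intro!: ennreal_leI)
  have closed_g: "closed {z\<in>X. g z \<le> a}" for a
  proof (cases "a \<ge> 0")
    case True
    have "{z\<in>X. g z \<le> a} = {z\<in>cball z0 R. f z \<le> min (ennreal (f0 + 1)) (ennreal a)}"
      using True by (auto simp: X_def g_def enn2real_leI) (metis X_def enn2real_nonneg ennreal_leI fX g_def mem_Collect_eq mem_cball)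
    then show ?thesis by (simp only: closed)
  next
    case False
    moreover have "0 \<le> g z" for z by (simp add: g_def)
    ultimately have "{z\<in>X. g z \<le> a} = {}" by (auto dest: order_trans)
    then show ?thesis by (simp only: closed_empty)
  qed
  have cont_h: "continuous_on UNIV (\<lambda>z. \<kappa>2 * h z)" unfolding h_def by (intro continuous_intros)
  obtain z' w where z': "z' \<in> X" and w: "norm w \<le> r"
    and min: "\<And>z. z \<in> X \<Longrightarrow> g z' + \<kappa>2 * h z' + \<epsilon> * (norm (z' - w))\<^sup>2 \<le> g z + \<kappa>2 * h z + \<epsilon> * (norm (z - w))\<^sup>2"
  proof (rule smooth_variational_principle[of X "\<lambda>z. g z + \<kappa>2 * h z" r 0 \<epsilon>])
    show "closed {z \<in> X. g z + \<kappa>2 * h z \<le> a}" for a by (rule closed_sublevel_add[OF closed_g cont_h])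
    show "norm z \<le> r" if "z \<in> X" for z using ball_r that by (simp add: X_def)
    show "0 \<le> g z + \<kappa>2 * h z" for z using \<kappa>2 h_pos[of z] by (simp add: g_def add_nonneg_nonneg less_imp_le)
  qed (use z0X \<epsilon> in auto)
  define \<Psi> where "\<Psi> z = \<kappa>2 * h z + \<epsilon> * (norm (z - w))\<^sup>2" for z
  have \<Psi>0: "0 \<le> \<Psi> z" for z using \<kappa>2 h_pos[of z] \<epsilon> by (simp add: \<Psi>_def less_imp_le add_nonneg_nonneg)
  have g0: "g z0 = f0" using f0 by (simp add: g_def)
  have top: "g z' + \<Psi> z' \<le> f0 + gap"
  proof -
    have "norm (z0 - w) \<le> 2 * r" using norm_triangle_ineq4[of z0 w] w ball_r[of z0] R by simp
    then have "(norm (z0 - w))\<^sup>2 \<le> (2 * r)\<^sup>2" by (intro power_mono) auto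
    then have "\<epsilon> * (norm (z0 - w))\<^sup>2 \<le> \<epsilon> * (4 * r\<^sup>2)" using \<epsilon> by (simp add: power_mult_distrib)
    then have "\<epsilon> * (norm (z0 - w))\<^sup>2 \<le> gap / 2" using \<epsilon>(2) by simp
    then show ?thesis using min[OF z0X] \<theta>(2) by (simp add: \<Psi>_def g0 h0)
  qed
  \<comment> \<open>The assumption with slope \<kappa>1 and the perturbed minimality with slope
    \<kappa>2 squeeze \<open>(\<kappa>2 - \<kappa>1) * N (z' - z0)\<close> to at most
    \<open>gap\<close>.\<close>
  have z'R: "z' \<in> ball z0 R"
  proof -
    have "f z0 \<le> f z' + ennreal (\<kappa>1 * N (z' - z0))" using approx_min[of z'] z' by (simp add: X_def N_def)
    also have "\<dots> = ennreal (g z' + \<kappa>1 * N (z' - z0))"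
      using \<kappa> N0[of "z' - z0"] by (simp add: fX[OF z'] g_nonneg)
    finally have "ennreal f0 \<le> ennreal (g z' + \<kappa>1 * N (z' - z0))" by (simp only: f0)
    moreover have "0 \<le> g z' + \<kappa>1 * N (z' - z0)" using \<kappa> N0[of "z' - z0"] by (simp add: g_def)
    ultimately have "f0 \<le> g z' + \<kappa>1 * N (z' - z0)" using ennreal_le_iff by blast
    moreover have "g z' + \<kappa>2 * N (z' - z0) \<le> f0 + gap"
    proof -
      have "\<kappa>2 * N (z' - z0) \<le> \<kappa>2 * h z'" using h_ge \<kappa>2 by (intro mult_left_mono) auto
      moreover have "0 \<le> \<epsilon> * (norm (z' - w))\<^sup>2" using \<epsilon> by simp
      ultimately show ?thesis using top by (simp add: \<Psi>_def)
    qed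
    ultimately have "(\<kappa>2 - \<kappa>1) * N (z' - z0) \<le> gap" by (simp add: algebra_simps)
    also have "gap < (\<kappa>2 - \<kappa>1) * (sqrt m * R)" by (rule gap(3))
    finally have "N (z' - z0) < sqrt m * R" using \<kappa> by (simp add: mult_less_cancel_left_pos)
    then have "sqrt m * norm (z' - z0) < sqrt m * R" using mN[of "z' - z0"] by simp
    then show ?thesis using m by (simp add: dist_norm norm_minus_commute)
  qed
  have ineq: "ennreal (g z' + \<Psi> z') \<le> f z + ennreal (\<Psi> z)" if z: "z \<in> cball z0 R" for z
  proof (cases "z \<in> X")
    case True
    have "g z' + \<Psi> z' \<le> g z + \<Psi> z" using min[OF True] by (simp add: \<Psi>_def)
    then have "ennreal (g z' + \<Psi> z') \<le> ennreal (g z + \<Psi> z)" by (rule ennreal_leI)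
    then show ?thesis by (simp only: fX[OF True] ennreal_plus[OF g_nonneg \<Psi>0])
  next
    case False
    then have "ennreal (f0 + 1) \<le> f z" using z by (auto simp: X_def)
    moreover have "ennreal (g z' + \<Psi> z') \<le> ennreal (f0 + 1)" using top gap by (intro ennreal_leI) auto
    ultimately show ?thesis by (meson add_increasing2 order_trans zero_le)
  qed
  define k where "k = \<kappa>2 / h z'"
  have k: "k > 0" using \<kappa>2 h_pos by (simp add: k_def)
  \<comment> \<open>Minus the derivative of \<open>\<Psi>\<close> at \<open>z'\<close>.\<close>
  define l0 where "l0 u = - (k * B (z' - z0) u + 2 * \<epsilon> * ((z' - w) \<bullet> u))" for u
  define l where "l = Blinfun l0"
  have "bounded_linear l0"
    unfolding l0_def
    by (intro bounded_linear_minus bounded_linear_add bounded_linear_const_mult blinfun.bounded_linear_right bounded_linear_inner_right)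
  then have l: "l u = - (k * B (z' - z0) u + 2 * \<epsilon> * ((z' - w) \<bullet> u))" for u
    by (simp add: l_def bounded_linear_Blinfun_apply l0_def)
  define \<sigma> where "\<sigma> = k / 2 * norm B + \<epsilon>"
  have \<Psi>_le: "\<Psi> z - \<Psi> z' \<le> - l (z - z') + \<sigma> * (norm (z - z'))\<^sup>2" for z
  proof -
    \<comment> \<open>Concavity of the square root: the increment of \<open>h\<close> is controlled
      by that of its square, which is an exact quadratic, so no Taylor remainder arises.\<close>
    have "2 * h z' * (h z - h z') \<le> (h z)\<^sup>2 - (h z')\<^sup>2"
      using zero_le_power2[of "h z - h z'"] by (simp add: power2_eq_square algebra_simps)
    also have "\<dots> = 2 * B (z' - z0) (z - z') + B (z - z') (z - z')"
      by (simp add: h2 blinfun.bilinear_simps sym[of z z0] sym[of z' z0] sym[of z z'] algebra_simps)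
    also have "B (z - z') (z - z') \<le> norm B * (norm (z - z'))\<^sup>2"
    proof -
      have "B (z - z') (z - z') \<le> norm B * norm (z - z') * norm (z - z')"
        using norm_blinfun2[of B "z - z'" "z - z'"] by simp
      then show ?thesis by (simp add: power2_eq_square mult.assoc)
    qed
    finally have "(k / 2) * (2 * h z' * (h z - h z')) \<le> (k / 2) * (2 * B (z' - z0) (z - z') + norm B * (norm (z - z'))\<^sup>2)"
      using k by (intro mult_left_mono) auto
    moreover have "(k / 2) * (2 * h z' * (h z - h z')) = \<kappa>2 * (h z - h z')" using h_pos[of z'] by (simp add: k_def)
    ultimately have "\<kappa>2 * (h z - h z') \<le> k * B (z' - z0) (z - z') + k / 2 * norm B * (norm (z - z'))\<^sup>2"
      by (simp add: algebra_simps)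
    moreover have "(norm (z - w))\<^sup>2 - (norm (z' - w))\<^sup>2 = 2 * ((z' - w) \<bullet> (z - z')) + (norm (z - z'))\<^sup>2"
      by (simp add: power2_norm_eq_inner inner_diff inner_commute algebra_simps)
    then have "\<epsilon> * (norm (z - w))\<^sup>2 - \<epsilon> * (norm (z' - w))\<^sup>2 = 2 * \<epsilon> * ((z' - w) \<bullet> (z - z')) + \<epsilon> * (norm (z - z'))\<^sup>2"
      by (simp flip: right_diff_distrib) (simp add: algebra_simps)
    ultimately show ?thesis by (simp add: \<Psi>_def l \<sigma>_def algebra_simps)
  qed
  show thesis
  proof (rule that[of z' \<sigma> l])
    show "z' \<in> ball z0 R" by (rule z'R)
    show "f z' < \<infinity>" using fX[OF z'] by simp
    show "\<sigma> \<ge> 0" using k \<epsilon> by (simp add: \<sigma>_def)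
    show "l u \<le> (\<kappa>2 + e) * sqrt (B u u)" for u
    proof -
      \<comment> \<open>Cauchy--Schwarz for \<open>B\<close>, from its nonnegativity at the
        combination \<open>N b *\<^sub>R a + N a *\<^sub>R b\<close>.\<close>
      have cs: "- B a b \<le> N a * N b" for a b
      proof (cases "N a = 0 \<or> N b = 0")
        case True
        then have "norm a = 0 \<or> norm b = 0" using mN[of a] mN[of b] m by (auto simp: mult_le_0_iff)
        then show ?thesis using N0 by auto
      next
        case False
        then have pos: "N a > 0" "N b > 0" using N0 by (auto simp: order_le_less)
        have "0 \<le> B (N b *\<^sub>R a + N a *\<^sub>R b) (N b *\<^sub>R a + N a *\<^sub>R b)" by (rule B0)
        also have "\<dots> = (N b)\<^sup>2 * (N a)\<^sup>2 + (N a)\<^sup>2 * (N b)\<^sup>2 + 2 * (N a * N b) * B a b"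
          unfolding N2 by (simp add: blinfun.bilinear_simps sym[of b a])
            (simp add: N2[symmetric] power2_eq_square algebra_simps)
        also have "\<dots> = 2 * (N a * N b) * (N a * N b + B a b)" by (simp add: power2_eq_square algebra_simps)
        finally have "0 \<le> 2 * (N a * N b) * (N a * N b + B a b)" .
        moreover have "0 < 2 * (N a * N b)" using pos by simp
        ultimately have "0 \<le> N a * N b + B a b" by (meson mult_pos_neg not_le)
        then show ?thesis by simp
      qed
      have "k * (- B (z' - z0) u) \<le> k * (N (z' - z0) * N u)" using cs k by (intro mult_left_mono) auto
      also have "\<dots> \<le> k * (h z' * N u)" using k h_ge N0 by (intro mult_left_mono mult_right_mono) auto
      also have "\<dots> = \<kappa>2 * N u" using h_pos[of z'] by (simp add: k_def)
      finally have a: "k * (- B (z' - z0) u) \<le> \<kappa>2 * N u" .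
      have "- ((z' - w) \<bullet> u) = (w - z') \<bullet> u" by (simp add: inner_diff_left)
      also have "\<dots> \<le> norm (z' - w) * norm u" using norm_cauchy_schwarz[of "w - z'" u] by (simp add: norm_minus_commute)
      also have "\<dots> \<le> (2 * r) * norm u"
      proof (rule mult_right_mono)
        have "norm z' \<le> r" using z' ball_r by (simp add: X_def)
        then show "norm (z' - w) \<le> 2 * r" using norm_triangle_ineq4[of z' w] w by simp
      qed simp
      finally have "2 * \<epsilon> * (- ((z' - w) \<bullet> u)) \<le> 2 * \<epsilon> * ((2 * r) * norm u)" using \<epsilon> by (intro mult_left_mono) auto
      also have "\<dots> = \<epsilon> * (4 * r) * norm u" by simp
      also have "\<dots> \<le> (e * sqrt m) * norm u" using \<epsilon> by (intro mult_right_mono) auto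
      also have "\<dots> \<le> e * N u" using mN[of u] e by (simp add: mult.assoc)
      finally show ?thesis using a by (simp add: l N_def algebra_simps)
    qed
    fix z assume z: "z \<in> cball z0 R"
    show "enn2ereal (f z') + ereal (l (z - z') - \<sigma> * (norm (z - z'))\<^sup>2) \<le> enn2ereal (f z)"
    proof (cases "f z")
      case (real t)
      have "g z' + \<Psi> z' \<le> t + \<Psi> z"
        using ineq[OF z] real \<Psi>0[of z] by (simp add: ennreal_le_iff flip: ennreal_plus)
      then have "g z' + (l (z - z') - \<sigma> * (norm (z - z'))\<^sup>2) \<le> t" using \<Psi>_le[of z] by simp
      then show ?thesis by (simp add: real fX[OF z'] g_nonneg enn2ereal_ennreal)
    qed simp
  qed
qed

section \<open>From support inequalities in a chart to proximal subgradients\<close>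

context riemannian_manifold
begin

text \<open>The support inequality lives in the chart at the Ekeland point, but
  \<open>riem_exp\<close> is expanded in the chart chosen at \<open>p\<close>. The transition map
  between them adds only another second order error.\<close>

lemma riem_exp_in_chart:
  assumes c: "c \<in> \<A>" and p: "p \<in> chart_dom c"
  defines "T \<equiv> trans_deriv (chart_at \<A> p) c (coord (chart_at \<A> p) p)"
  obtains \<rho> K where "\<rho> > 0" "K \<ge> 0"
    "\<And>v. norm v < \<rho> \<Longrightarrow> \<exists>z \<in> chart_ran c. riem_exp \<A> G p v = chart_inv c z \<and>
       norm (z - coord c p - T v) \<le> K * (norm v)\<^sup>2"
proof -
  define c' where "c' = chart_at \<A> p"
  have c': "c' \<in> \<A>" "p \<in> chart_dom c'" by (auto simp: c'_def chart_at)
  define y where "y = coord c' p"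
  have T: "T = trans_deriv c' c y" by (simp add: T_def c'_def y_def)
  have yo: "y \<in> overlap c' c" using coord_in_overlap[OF c'(2) p] by (simp add: y_def)
  obtain \<rho> K where \<rho>: "\<rho> > 0" and K: "K \<ge> 0" and ex: "\<And>v. norm v < \<rho> \<Longrightarrow> \<exists>x \<in> chart_ran c'. riem_exp \<A> G p v = chart_inv c' x \<and>
       norm (x - y - v) \<le> K * (norm v)\<^sup>2"
    unfolding y_def c'_def by (rule riem_exp_expansion) blast
  let ?\<tau> = "transition c' c"
  let ?f2 = "trans_deriv2 c' c y"
  have "(trans_deriv c' c has_derivative blinfun_apply ?f2) (at y)"
    by (rule transition_has_derivative(2)[OF c'(1) c yo])
  from this[unfolded has_derivative_at_alt] obtain d1 where d1: "d1 > 0"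
    "\<And>x. norm (x - y) < d1 \<Longrightarrow> norm (trans_deriv c' c x - T - ?f2 (x - y)) \<le> 1 * norm (x - y)"
    unfolding T using zero_less_one by blast
  obtain d2 where d2: "d2 > 0" "ball y d2 \<subseteq> overlap c' c"
    using open_overlap[OF c'(1) c] yo by (meson openE)
  define d where "d = min d1 d2"
  have d: "d > 0" using d1 d2 by (simp add: d_def)
  define L where "L = norm ?f2 + 1"
  have L: "L > 0" by (simp add: L_def add_nonneg_pos)
  have lip: "norm (trans_deriv c' c x - T) \<le> L * norm (x - y)" if "x \<in> ball y d" for x
  proof -
    have "norm (trans_deriv c' c x - T) \<le> norm (trans_deriv c' c x - T - ?f2 (x - y)) + norm (?f2 (x - y))"
      by (metis diff_add_cancel norm_triangle_ineq)
    also have "\<dots> \<le> 1 * norm (x - y) + norm ?f2 * norm (x - y)"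
      using that by (intro add_mono d1(2) norm_blinfun) (auto simp: d_def dist_norm norm_minus_commute)
    finally show ?thesis by (simp add: L_def algebra_simps)
  qed
  have quad: "norm (?\<tau> x - ?\<tau> y - T (x - y)) \<le> L * (norm (x - y))\<^sup>2" if x: "x \<in> ball y d" for x
  proof -
    \<comment> \<open>On this ball the derivative differs from \<open>T\<close> by at most
      \<open>L * norm (x - y)\<close>, so the mean value inequality yields a square.\<close>
    let ?B = "cball y (norm (x - y))"
    have sub: "?B \<subseteq> ball y d" using x by (auto simp: dist_norm norm_minus_commute)
    have "norm ((?\<tau> x - T x) - (?\<tau> y - T y)) \<le> (L * norm (x - y)) * norm (x - y)"
    proof (rule differentiable_bound[where S="?B" and f'="\<lambda>x h. trans_deriv c' c x h - T h"])
      fix s assume s: "s \<in> ?B"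
      then have so: "s \<in> overlap c' c" using sub d2 by (auto simp: d_def subset_iff)
      have "((\<lambda>x. ?\<tau> x - T x) has_derivative (\<lambda>h. trans_deriv c' c s h - T h)) (at s)"
        by (rule has_derivative_diff[OF transition_has_derivative(1)[OF c'(1) c so]])
           (rule bounded_linear_imp_has_derivative[OF blinfun.bounded_linear_right])
      then show "((\<lambda>x. ?\<tau> x - T x) has_derivative (\<lambda>h. trans_deriv c' c s h - T h)) (at s within ?B)"
        by (rule has_derivative_at_withinI)
      have "norm ((trans_deriv c' c s - T) h) \<le> (L * norm (x - y)) * norm h" for h
      proof -
        have "norm (trans_deriv c' c s - T) \<le> L * norm (s - y)" by (rule lip) (use s sub in auto)
        also have "\<dots> \<le> L * norm (x - y)" using s L by (intro mult_left_mono) (auto simp: dist_norm norm_minus_commute)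
        finally show ?thesis by (intro order_trans[OF norm_blinfun] mult_right_mono) auto
      qed
      then show "onorm (\<lambda>h. trans_deriv c' c s h - T h) \<le> L * norm (x - y)"
        using L by (intro onorm_bound) (auto simp: blinfun.diff_left)
    qed (auto simp: dist_norm norm_minus_commute)
    then show ?thesis by (simp add: power2_eq_square blinfun.diff_right algebra_simps)
  qed
  define \<rho>' where "\<rho>' = min \<rho> (min 1 (d / (1 + K)))"
  have "\<rho>' > 0" using \<rho> K d by (simp add: \<rho>'_def add_pos_nonneg)
  define K' where "K' = L * (1 + K)\<^sup>2 + norm T * K"
  have "K' \<ge> 0" using L K by (simp add: K'_def)
  show thesis
  proof (rule that[OF \<open>\<rho>' > 0\<close> \<open>K' \<ge> 0\<close>])
    fix v :: 'h assume v: "norm v < \<rho>'"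
    then have v1: "norm v < \<rho>" "norm v \<le> 1" "norm v < d / (1 + K)" by (auto simp: \<rho>'_def)
    obtain x where x: "x \<in> chart_ran c'" "riem_exp \<A> G p v = chart_inv c' x" "norm (x - y - v) \<le> K * (norm v)\<^sup>2"
      using ex[OF v1(1)] by blast
    have "K * (norm v)\<^sup>2 \<le> K * norm v"
      using K v1(2) by (intro mult_left_mono) (auto simp: power2_eq_square mult_left_le)
    then have xy: "norm (x - y) \<le> (1 + K) * norm v"
      using x(3) norm_triangle_ineq[of "x - y - v" v] by (simp add: algebra_simps)
    also have "\<dots> < d" using v1(3) K by (simp add: pos_less_divide_eq mult.commute add_pos_nonneg)
    finally have xd: "x \<in> ball y d" by (simp add: dist_norm norm_minus_commute)
    then have "x \<in> overlap c' c" using d2 by (auto simp: d_def subset_iff)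
    then obtain q where q: "q \<in> chart_dom c'" "q \<in> chart_dom c" "x = coord c' q" by (auto simp: overlap_def)
    have tx: "?\<tau> x = coord c q" "chart_inv c' x = q" using q c' by auto
    have ty: "?\<tau> y = coord c p" using c' by (simp add: y_def)
    have "norm (coord c q - coord c p - T v) \<le> norm (?\<tau> x - ?\<tau> y - T (x - y)) + norm (T (x - y - v))"
      using norm_triangle_ineq[of "?\<tau> x - ?\<tau> y - T (x - y)" "T (x - y - v)"] by (simp add: tx ty blinfun.diff_right)
    also have "\<dots> \<le> L * (norm (x - y))\<^sup>2 + norm T * (K * (norm v)\<^sup>2)"
      using x(3) by (intro add_mono quad[OF xd] order_trans[OF norm_blinfun] mult_left_mono) auto
    also have "\<dots> \<le> L * ((1 + K) * norm v)\<^sup>2 + norm T * (K * (norm v)\<^sup>2)"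
      using xy L K by (intro add_mono mult_left_mono power_mono) auto
    also have "\<dots> = K' * (norm v)\<^sup>2" by (simp only: K'_def power_mult_distrib) (simp only: distrib_right mult.assoc)
    finally show "\<exists>z \<in> chart_ran c. riem_exp \<A> G p v = chart_inv c z \<and> norm (z - coord c p - T v) \<le> K' * (norm v)\<^sup>2"
      using x(2) tx q c by (intro bexI[of _ "coord c q"]) auto
  qed
qed

text \<open>The deviation of \<open>riem_exp\<close> from the affine map is quadratic in the tangent
  vector and is absorbed by enlarging the coefficient \<sigma>. The subgradient represents the
  pulled-back slope in the metric.\<close>

lemma proximal_subgradient_from_chart:
  fixes l :: "'h \<Rightarrow>\<^sub>L real" and g :: "'m \<Rightarrow> ereal"
  assumes c: "c \<in> \<A>" and p: "p \<in> chart_dom c" and fin: "g p < \<infinity>" and \<sigma>: "\<sigma> \<ge> 0" and r: "r > 0" and L: "L \<ge> 0"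
    and ineq: "\<And>z. z \<in> ball (coord c p) r \<Longrightarrow> z \<in> chart_ran c \<Longrightarrow>
      g p + ereal (l (z - coord c p) - \<sigma> * (norm (z - coord c p))\<^sup>2) \<le> g (chart_inv c z)"
    and slope: "\<And>u. l u \<le> L * metric_norm c (coord c p) u"
  obtains \<zeta> where "\<zeta> \<in> riem_proximal_subdiff \<A> G g p" "tangent_norm \<A> G p \<zeta> \<le> L"
proof -
  define c' where "c' = chart_at \<A> p"
  have c': "c' \<in> \<A>" "p \<in> chart_dom c'" by (auto simp: c'_def chart_at)
  define y where "y = coord c' p"
  have yr: "y \<in> chart_ran c'" using c' by (simp add: y_def)
  define T where "T = trans_deriv c' c y"
  obtain \<rho> K where \<rho>: "\<rho> > 0" and K: "K \<ge> 0" and ex: "\<And>v. norm v < \<rho> \<Longrightarrow> \<exists>z \<in> chart_ran c. riem_exp \<A> G p v = chart_inv c z \<and>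
       norm (z - coord c p - T v) \<le> K * (norm v)\<^sup>2"
    unfolding T_def y_def c'_def by (rule riem_exp_in_chart[OF c p]) blast
  obtain m where m: "m > 0" "\<And>u. m * (norm u)\<^sup>2 \<le> G c' y u u" using metric_coercive[OF c'(1) yr] by blast
  have inner: "tangent_inner \<A> G p = (\<lambda>u v. G c' y u v)" by (simp add: tangent_inner_def[abs_def] c'_def y_def)
  have tn: "tangent_norm \<A> G p u = metric_norm c' y u" for u by (simp add: tangent_norm_def inner metric_norm_def)
  obtain \<zeta> where \<zeta>: "\<And>w. G c' y \<zeta> w = (l o\<^sub>L T) w"
    using riesz_coercive[OF metric_sym[OF c'(1) yr] m] by blast
  have Tn: "metric_norm c (coord c p) (T u) = metric_norm c' y u" for u
    using metric_trans[OF c'(1) c c'(2) p] by (simp add: metric_norm_def T_def y_def)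
  have sq: "(metric_norm c' y u)\<^sup>2 = G c' y u u" for u using metric_nonneg[OF c'(1) yr] by (simp add: metric_norm_def)
  have le_L: "tangent_norm \<A> G p \<zeta> \<le> L"
  proof (cases "metric_norm c' y \<zeta> = 0")
    case True then show ?thesis using L by (simp add: tn)
  next
    case False
    then have pos: "metric_norm c' y \<zeta> > 0" using metric_norm_nonneg[OF c'(1) yr, of \<zeta>] by simp
    have "(metric_norm c' y \<zeta>)\<^sup>2 = l (T \<zeta>)" by (simp add: sq \<zeta>)
    also have "\<dots> \<le> L * metric_norm c' y \<zeta>" using slope[of "T \<zeta>"] by (simp add: Tn)
    finally show ?thesis using pos by (simp add: tn power2_eq_square)
  qed
  define A where "A = norm T + K + 1"
  have A: "A > 0" using K by (simp add: A_def add_nonneg_pos)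
  \<comment> \<open>\<open>sqrt m\<close> converts the metric norm into the model norm.
    \<open>A\<close> bounds the displacement in the chart per unit of \<open>norm u\<close>, so
    \<open>r / A\<close> keeps the end point in the given ball.\<close>
  define \<eta> where "\<eta> = sqrt m * min \<rho> (min 1 (r / A))"
  have \<eta>: "\<eta> > 0" using m \<rho> r A by (simp add: \<eta>_def)
  \<comment> \<open>Division by \<open>m\<close> passes from the model norm to the metric norm; the
    added 1 makes the coefficient positive even if the other terms vanish.\<close>
  define \<sigma>' where "\<sigma>' = (norm l * K + \<sigma> * A\<^sup>2) / m + 1"
  have \<sigma>': "\<sigma>' > 0" using m K \<sigma> by (simp add: \<sigma>'_def add_nonneg_pos)
  have exp0: "riem_exp \<A> G p 0 = p" using ex[of 0] \<rho> c p by auto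
  have main: "g p + ereal (G c' y \<zeta> u - \<sigma>' * (metric_norm c' y u)\<^sup>2) \<le> g (riem_exp \<A> G p u)"
    if u: "metric_norm c' y u < \<eta>" for u
  proof -
    have "sqrt m * norm u \<le> metric_norm c' y u"
      using real_sqrt_le_mono[OF m(2)[of u]] by (simp add: metric_norm_def real_sqrt_mult)
    then have "sqrt m * norm u < sqrt m * min \<rho> (min 1 (r / A))" using u by (simp add: \<eta>_def)
    then have u3: "norm u < \<rho>" "norm u \<le> 1" "norm u < r / A" using m(1) by (simp_all add: mult_less_cancel_left_pos)
    obtain z where z: "z \<in> chart_ran c" "riem_exp \<A> G p u = chart_inv c z" "norm (z - coord c p - T u) \<le> K * (norm u)\<^sup>2"
      using ex[OF u3(1)] by blast
    have "K * (norm u)\<^sup>2 \<le> K * norm u"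
      using K u3(2) by (intro mult_left_mono) (auto simp: power2_eq_square mult_left_le)
    moreover have "norm (T u) \<le> norm T * norm u" by (rule norm_blinfun)
    moreover have "norm (z - coord c p) \<le> norm (z - coord c p - T u) + norm (T u)" by (metis diff_add_cancel norm_triangle_ineq)
    ultimately have "norm (z - coord c p) \<le> (norm T + K) * norm u" using z(3) by (simp add: algebra_simps)
    also have "\<dots> \<le> A * norm u" by (intro mult_right_mono) (auto simp: A_def)
    finally have zA: "norm (z - coord c p) \<le> A * norm u" .
    also have "\<dots> < r" using u3(3) A by (simp add: pos_less_divide_eq mult.commute)
    finally have zr: "z \<in> ball (coord c p) r" by (simp add: dist_norm norm_minus_commute)
    have "- l (z - coord c p - T u) \<le> norm l * (K * (norm u)\<^sup>2)"
    proof -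
      have "- l (z - coord c p - T u) \<le> norm l * norm (z - coord c p - T u)"
        using norm_blinfun[of l "z - coord c p - T u"] by (simp add: abs_le_iff)
      also have "\<dots> \<le> norm l * (K * (norm u)\<^sup>2)" by (intro mult_left_mono z) auto
      finally show ?thesis .
    qed
    then have "l (T u) - norm l * (K * (norm u)\<^sup>2) \<le> l (z - coord c p)" by (simp add: blinfun.diff_right)
    moreover have "\<sigma> * (norm (z - coord c p))\<^sup>2 \<le> \<sigma> * (A\<^sup>2 * (norm u)\<^sup>2)"
      using power_mono[OF zA, of 2] \<sigma> by (intro mult_left_mono) (auto simp: power_mult_distrib)
    moreover have "(norm l * K + \<sigma> * A\<^sup>2) * (norm u)\<^sup>2 \<le> \<sigma>' * (metric_norm c' y u)\<^sup>2"
    proof -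
      have "(norm l * K + \<sigma> * A\<^sup>2) * (norm u)\<^sup>2 = ((norm l * K + \<sigma> * A\<^sup>2) / m) * (m * (norm u)\<^sup>2)" using m by simp
      also have "\<dots> \<le> \<sigma>' * (metric_norm c' y u)\<^sup>2"
        using m K \<sigma> m(2)[of u] \<sigma>' by (intro mult_mono) (auto simp: \<sigma>'_def sq)
      finally show ?thesis .
    qed
    ultimately have "G c' y \<zeta> u - \<sigma>' * (metric_norm c' y u)\<^sup>2 \<le> l (z - coord c p) - \<sigma> * (norm (z - coord c p))\<^sup>2"
      by (simp add: \<zeta> algebra_simps)
    then have "g p + ereal (G c' y \<zeta> u - \<sigma>' * (metric_norm c' y u)\<^sup>2) \<le> g p + ereal (l (z - coord c p) - \<sigma> * (norm (z - coord c p))\<^sup>2)"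
      by (intro add_left_mono) simp
    also have "\<dots> \<le> g (riem_exp \<A> G p u)" unfolding z(2) by (rule ineq[OF zr z(1)])
    finally show ?thesis .
  qed
  have "\<forall>u. sqrt (G c' y (u - 0) (u - 0)) < \<eta> \<longrightarrow> (g \<circ> riem_exp \<A> G p) 0 +
      ereal (G c' y \<zeta> (u - 0) - \<sigma>' * (sqrt (G c' y (u - 0) (u - 0)))\<^sup>2) \<le> (g \<circ> riem_exp \<A> G p) u"
    using main by (simp add: exp0 metric_norm_def)
  then have "\<zeta> \<in> riem_proximal_subdiff \<A> G g p"
    unfolding riem_proximal_subdiff_def proximal_subdiff_def inner
    using fin \<sigma>' \<eta> exp0 by (intro CollectI conjI) (simp, simp, blast)
  then show thesis by (rule that[OF _ le_L])
qed

text \<open>\<open>M * R \<le> \<eta> * m\<close> makes the change of the Gram form at most \<eta>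
  times the form itself. One direction serves to bound distances, the other to bound the slope at a
  point other than the centre.\<close>

lemma metric_norm_comparison:
  assumes c: "c \<in> \<A>" and z: "z \<in> chart_ran c" and \<eta>: "\<eta> > 0" and r: "r > 0"
  obtains R m where "R > 0" "R \<le> r" "m > 0" "cball z R \<subseteq> chart_ran c"
    "\<And>x u. x \<in> cball z R \<Longrightarrow> m * (norm u)\<^sup>2 \<le> G c x u u"
    "\<And>x u. x \<in> cball z R \<Longrightarrow> metric_norm c x u \<le> (1 + \<eta>) * metric_norm c z u"
    "\<And>x u. x \<in> cball z R \<Longrightarrow> metric_norm c z u \<le> (1 + \<eta>) * metric_norm c x u"
proof -
  obtain R0 m M where R0: "R0 > 0" "m > 0" "M > 0" "cball z R0 \<subseteq> chart_ran c"
    and B: "\<And>x u. x \<in> cball z R0 \<Longrightarrow> m * (norm u)\<^sup>2 \<le> G c x u u"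
    "\<And>x y. x \<in> cball z R0 \<Longrightarrow> y \<in> cball z R0 \<Longrightarrow> norm (G c x - G c y) \<le> M * norm (x - y)"
    by (rule metric_local_bounds[OF c z]) blast
  define R where "R = min (min R0 r) (\<eta> * m / M)"
  have R: "R > 0" "R \<le> R0" "R \<le> r" "M * R \<le> \<eta> * m"
  proof -
    show "R > 0" "R \<le> R0" "R \<le> r" using R0 \<eta> r by (auto simp: R_def)
    have "M * R \<le> M * (\<eta> * m / M)" using R0 by (intro mult_left_mono) (auto simp: R_def)
    then show "M * R \<le> \<eta> * m" using R0 by simp
  qed
  have sub: "cball z R \<subseteq> cball z R0" using R by auto
  have diff: "\<bar>G c x u u - G c z u u\<bar> \<le> \<eta> * (m * (norm u)\<^sup>2)" if x: "x \<in> cball z R" for x u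
  proof -
    have "\<bar>(G c x - G c z) u u\<bar> \<le> norm (G c x - G c z) * norm u * norm u"
      using norm_blinfun2[of "G c x - G c z" u u] by simp
    also have "\<dots> \<le> ((M * norm (x - z)) * norm u) * norm u"
      using B(2)[of x z] x sub R0 by (intro mult_right_mono) auto
    also have "\<dots> \<le> ((M * R) * norm u) * norm u"
      using x R0 by (intro mult_right_mono mult_left_mono) (auto simp: dist_norm norm_minus_commute)
    also have "\<dots> \<le> ((\<eta> * m) * norm u) * norm u" using R by (intro mult_right_mono) auto
    finally show ?thesis by (simp add: blinfun.diff_left power2_eq_square mult.assoc)
  qed
  have root: "sqrt a \<le> (1 + \<eta>) * sqrt b" if "a \<le> b + \<eta> * b" "0 \<le> b" for a b
  proof -
    have "0 \<le> \<eta> * b + \<eta>\<^sup>2 * b" using \<eta> that by simp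
    then have "a \<le> (1 + \<eta>)\<^sup>2 * b" using that by (simp add: power2_eq_square algebra_simps)
    then have "sqrt a \<le> sqrt ((1 + \<eta>)\<^sup>2 * b)" by simp
    then show ?thesis using \<eta> by (simp add: real_sqrt_mult)
  qed
  show thesis
  proof (rule that[of R m])
    fix x u assume x: "x \<in> cball z R"
    have zR: "z \<in> cball z R" using R by simp
    have mx: "m * (norm u)\<^sup>2 \<le> G c x u u" "m * (norm u)\<^sup>2 \<le> G c z u u" using B(1)[of x u] B(1)[of z u] x zR sub R0(1) by auto
    have nn: "0 \<le> m * (norm u)\<^sup>2" using R0 by simp
    have "\<eta> * (m * (norm u)\<^sup>2) \<le> \<eta> * G c x u u" "\<eta> * (m * (norm u)\<^sup>2) \<le> \<eta> * G c z u u"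
      using mx \<eta> by (auto intro: mult_left_mono)
    with abs_le_D1[OF diff[OF x, of u]] abs_le_D2[OF diff[OF x, of u]] mx nn
    show "metric_norm c x u \<le> (1 + \<eta>) * metric_norm c z u" "metric_norm c z u \<le> (1 + \<eta>) * metric_norm c x u"
      unfolding metric_norm_def by (auto intro!: root)
    show "m * (norm u)\<^sup>2 \<le> G c x u u" by (rule mx)
  qed (use R R0 sub in auto)
qed

lemma riem_dist_le_in_ball:
  assumes c: "c \<in> \<A>" and p: "p \<in> chart_dom c" and sub: "cball (coord c p) R \<subseteq> chart_ran c"
    and cmp: "\<And>x u. x \<in> cball (coord c p) R \<Longrightarrow> metric_norm c x u \<le> k * metric_norm c (coord c p) u"
    and z: "z \<in> cball (coord c p) R"
  shows "riem_dist \<A> G p (chart_inv c z) \<le> ennreal (k * metric_norm c (coord c p) (z - coord c p))"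
proof -
  have "0 \<le> dist (coord c p) z" by simp
  then have "0 \<le> R" using z by (meson mem_cball order_trans)
  then have seg: "closed_segment (coord c p) z \<subseteq> cball (coord c p) R"
    using z by (intro closed_segment_subset) auto
  have "riem_dist \<A> G (chart_inv c (coord c p)) (chart_inv c z) \<le> ennreal (k * metric_norm c (coord c p) (z - coord c p))"
    by (rule riem_dist_segment[OF c]) (use seg sub cmp in auto)
  then show ?thesis using c p by simp
qed

text \<open>One half of the comparison between distance and topology, by straight segments in a
  chart.\<close>

lemma riem_dist_less_nbhd:
  assumes e: "e > 0"
  obtains S where "open S" "p \<in> S" "\<And>q. q \<in> S \<Longrightarrow> riem_dist \<A> G p q < ennreal e"
proof -
  define c where "c = chart_at \<A> p"
  have c: "c \<in> \<A>" "p \<in> chart_dom c" by (auto simp: c_def chart_at)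
  obtain R where R: "R > 0" "cball (coord c p) R \<subseteq> chart_ran c"
    and cmp: "\<And>x u. x \<in> cball (coord c p) R \<Longrightarrow> metric_norm c x u \<le> (1 + 1) * metric_norm c (coord c p) u"
    by (rule metric_norm_comparison[OF c(1) coord_in_ran[OF c(2)] zero_less_one zero_less_one]) blast
  let ?N = "\<lambda>z. (1 + 1) * metric_norm c (coord c p) (z - coord c p)"
  have cont: "continuous_on UNIV ?N" unfolding metric_norm_def by (intro continuous_intros)
  have "open (?N -` {..<e})" using open_vimage[OF _ cont, of "{..<e}"] by simp
  then have "open (ball (coord c p) R \<inter> (?N -` {..<e}))" by blast
  then have "open {q \<in> chart_dom c. coord c q \<in> ball (coord c p) R \<inter> (?N -` {..<e})}"
    by (rule open_coord_preimage[OF c(1)])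
  then show thesis
  proof (rule that)
    show "p \<in> {q \<in> chart_dom c. coord c q \<in> ball (coord c p) R \<inter> (?N -` {..<e})}"
      using c R e by (simp add: metric_norm_def)
    fix q assume q: "q \<in> {q \<in> chart_dom c. coord c q \<in> ball (coord c p) R \<inter> (?N -` {..<e})}"
    have "riem_dist \<A> G p (chart_inv c (coord c q)) \<le> ennreal (?N (coord c q))"
      by (rule riem_dist_le_in_ball[OF c R(2) cmp]) (use q in auto)
    also have "\<dots> < ennreal e" using q e by (simp add: ennreal_lessI)
    finally show "riem_dist \<A> G p q < ennreal e" using q c by simp
  qed
qed

text \<open>The other half, by \<open>riem_dist_less_imp_chart_ball\<close>. It connects
  completeness, stated for the distance, with lower semicontinuity, stated for the topology.\<close>

lemma tendsto_of_riem_dist: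
  assumes "(\<lambda>n. riem_dist \<A> G (X n) p) \<longlonglongrightarrow> 0"
  shows "X \<longlonglongrightarrow> p"
proof (rule topological_tendstoI)
  fix S :: "'m set" assume S: "open S" "p \<in> S"
  define c where "c = chart_at \<A> p"
  have c: "c \<in> \<A>" "p \<in> chart_dom c" by (auto simp: c_def chart_at)
  have "open (coord c ` (S \<inter> chart_dom c))"
    by (rule open_coord_image[OF c(1)]) (use S open_chart_dom[OF c(1)] in auto)
  moreover have "coord c p \<in> coord c ` (S \<inter> chart_dom c)" using S c by auto
  ultimately obtain r0 where r0: "r0 > 0" "ball (coord c p) r0 \<subseteq> coord c ` (S \<inter> chart_dom c)" by (meson openE)
  obtain R m where R: "R > 0" "R \<le> r0" "m > 0" "cball (coord c p) R \<subseteq> chart_ran c"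
    "\<And>x u. x \<in> cball (coord c p) R \<Longrightarrow> m * (norm u)\<^sup>2 \<le> G c x u u"
    by (rule metric_norm_comparison[OF c(1) coord_in_ran[OF c(2)] zero_less_one r0(1)]) blast
  have lower: "sqrt m * norm u \<le> metric_norm c x u" if "x \<in> ball (coord c p) R" for x u
    using real_sqrt_le_mono[OF R(5)[of x u]] that by (simp add: metric_norm_def real_sqrt_mult)
  have "0 < ennreal (sqrt m * R)" using R by simp
  with assms have "\<forall>\<^sub>F n in sequentially. riem_dist \<A> G (X n) p < ennreal (sqrt m * R)" by (rule order_tendstoD)
  then show "\<forall>\<^sub>F n in sequentially. X n \<in> S"
  proof eventually_elim
    case (elim n)
    have q: "X n \<in> chart_dom c \<and> coord c (X n) \<in> ball (coord c p) R"
      by (rule riem_dist_less_imp_chart_ball[OF c R(1)]) (use R elim lower riem_dist_sym[of p "X n"] in auto)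
    then obtain s where "s \<in> S" "s \<in> chart_dom c" "coord c (X n) = coord c s" using r0(2) R(2) by (force simp: subset_iff)
    then show ?case using chart_inv_coord[OF c(1)] q by metis
  qed
qed

lemma exists_small_proximal_subgradient:
  fixes f :: "'m \<Rightarrow> ennreal"
  assumes lsc: "lower_semicont f" and fin: "f y < \<infinity>" and \<kappa>: "0 < \<kappa>" "\<kappa> < \<delta>"
    and min: "\<And>z. f y \<le> f z + ennreal \<kappa> * riem_dist \<A> G y z"
    and S: "open S" "y \<in> S"
  obtains p \<zeta> where "p \<in> S" "\<zeta> \<in> riem_proximal_subdiff \<A> G (\<lambda>q. enn2ereal (f q)) p" "tangent_norm \<A> G p \<zeta> < \<delta>"
proof -
  define c where "c = chart_at \<A> y"
  have c: "c \<in> \<A>" "y \<in> chart_dom c" by (auto simp: c_def chart_at)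
  define z0 where "z0 = coord c y"
  have z0: "z0 \<in> chart_ran c" using c by (simp add: z0_def)
  \<comment> \<open>As \<eta> \<le> 1, the cube of 1 + \<eta> is at most 1 + 7 \<eta>; the 8 leaves
    it strictly below \<delta>/\<kappa>.\<close>
  define \<eta> where "\<eta> = min 1 ((\<delta> / \<kappa> - 1) / 8)"
  have "\<eta> \<le> (\<delta> / \<kappa> - 1) / 8" unfolding \<eta>_def by (rule min.cobounded2)
  then have \<eta>: "\<eta> > 0" "\<eta> \<le> 1" "8 * \<eta> \<le> \<delta> / \<kappa> - 1" using \<kappa> by (auto simp: \<eta>_def)
  have cube: "\<kappa> * (1 + \<eta>) ^ 3 < \<delta>"
  proof -
    have "\<eta> ^ 2 \<le> \<eta>" "\<eta> ^ 3 \<le> \<eta>" using \<eta> by (auto simp: power_le_one_iff power2_eq_square power3_eq_cube mult_left_le mult_le_one intro!: mult_left_le)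
    then have "(1 + \<eta>) ^ 3 \<le> 1 + 7 * \<eta>" by (simp add: power3_eq_cube power2_eq_square algebra_simps)
    also have "\<dots> < \<delta> / \<kappa>" using \<eta> by simp
    finally show ?thesis using \<kappa> by (simp add: pos_less_divide_eq mult.commute)
  qed
  \<comment> \<open>One factor for the distance, a second for the room between \<kappa>1 and
    \<kappa>2, a third later for the change of base point; \<open>e\<close> spends half of what then
    remains below \<delta>.\<close>
  define \<kappa>1 where "\<kappa>1 = \<kappa> * (1 + \<eta>)"
  define \<kappa>2 where "\<kappa>2 = \<kappa> * (1 + \<eta>) ^ 2"
  define e where "e = (\<delta> - \<kappa> * (1 + \<eta>) ^ 3) / (2 * (1 + \<eta>))"
  have e: "e > 0" using cube \<eta> by (simp add: e_def)
  have \<kappa>12: "0 \<le> \<kappa>1" "\<kappa>1 < \<kappa>2"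
    using \<kappa> \<eta> by (auto simp: \<kappa>1_def \<kappa>2_def power2_eq_square)
  have e\<delta>: "(\<kappa>2 + e) * (1 + \<eta>) < \<delta>"
  proof -
    have half: "X / (2 * q) * q = X / 2" if "q > 0" for X q :: real using that by simp
    have "e * (1 + \<eta>) = (\<delta> - \<kappa> * (1 + \<eta>) ^ 3) / 2" unfolding e_def by (rule half) (use \<eta> in simp)
    moreover have "\<kappa>2 * (1 + \<eta>) = \<kappa> * (1 + \<eta>) ^ 3" by (simp add: \<kappa>2_def power3_eq_cube power2_eq_square)
    ultimately have "(\<kappa>2 + e) * (1 + \<eta>) = \<kappa> * (1 + \<eta>) ^ 3 + (\<delta> - \<kappa> * (1 + \<eta>) ^ 3) / 2"
      by (simp only: distrib_right[of \<kappa>2 e])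
    moreover have "X + (\<delta> - X) / 2 < \<delta>" if "X < \<delta>" for X using that by (simp add: field_simps)
    ultimately show ?thesis using cube by (simp only:)
  qed
  have "open (coord c ` (S \<inter> chart_dom c))"
    by (rule open_coord_image[OF c(1)]) (use S open_chart_dom[OF c(1)] in auto)
  moreover have "z0 \<in> coord c ` (S \<inter> chart_dom c)" using S c by (auto simp: z0_def)
  ultimately obtain r where r: "r > 0" "ball z0 r \<subseteq> coord c ` (S \<inter> chart_dom c)" by (meson openE)
  obtain R m where R: "R > 0" "R \<le> r" "m > 0" "cball z0 R \<subseteq> chart_ran c"
    and coercive: "\<And>x u. x \<in> cball z0 R \<Longrightarrow> m * (norm u)\<^sup>2 \<le> G c x u u"
    and cmp: "\<And>x u. x \<in> cball z0 R \<Longrightarrow> metric_norm c x u \<le> (1 + \<eta>) * metric_norm c z0 u"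
    and cmp': "\<And>x u. x \<in> cball z0 R \<Longrightarrow> metric_norm c z0 u \<le> (1 + \<eta>) * metric_norm c x u"
    by (rule metric_norm_comparison[OF c(1) z0 \<eta>(1) r(1)]) blast
  obtain z' \<sigma> and l :: "'h \<Rightarrow>\<^sub>L real" where z': "z' \<in> ball z0 R" "f (chart_inv c z') < \<infinity>" and \<sigma>: "\<sigma> \<ge> 0"
    and l: "\<And>u. l u \<le> (\<kappa>2 + e) * sqrt (G c z0 u u)"
    and ineq: "\<And>z. z \<in> cball z0 R \<Longrightarrow> enn2ereal (f (chart_inv c z')) + ereal (l (z - z') - \<sigma> * (norm (z - z'))\<^sup>2) \<le> enn2ereal (f (chart_inv c z))"
  proof (rule exists_subgradient_near_approximate_minimum[of "G c z0" m R z0 "\<lambda>z. f (chart_inv c z)" \<kappa>1 \<kappa>2 e])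
    show "G c z0 u v = G c z0 v u" for u v by (rule metric_sym[OF c(1) z0])
    show "m * (norm u)\<^sup>2 \<le> G c z0 u u" for u using coercive[of z0 u] R by simp
    show "closed {z \<in> cball z0 R. f (chart_inv c z) \<le> a}" for a
      using continuous_closed_preimage[OF continuous_on_subset[OF continuous_on_chart_inv[OF c(1)] R(4)] closed_cball
          closed_sublevel_of_lower_semicont[OF lsc, of a]]
      by (simp add: Int_def vimage_def)
    show "f (chart_inv c z0) < \<infinity>" using fin c by (simp add: z0_def)
    fix z assume z: "z \<in> cball z0 R"
    have "f y \<le> f (chart_inv c z) + ennreal \<kappa> * riem_dist \<A> G y (chart_inv c z)" by (rule min)
    also have "riem_dist \<A> G y (chart_inv c z) \<le> ennreal ((1 + \<eta>) * metric_norm c z0 (z - z0))"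
      unfolding z0_def by (rule riem_dist_le_in_ball[OF c R(4)[unfolded z0_def] cmp[unfolded z0_def] z[unfolded z0_def]])
    also have "ennreal \<kappa> * ennreal ((1 + \<eta>) * metric_norm c z0 (z - z0)) = ennreal (\<kappa>1 * sqrt (G c z0 (z - z0) (z - z0)))"
      using \<kappa> by (simp add: \<kappa>1_def metric_norm_def mult.assoc flip: ennreal_mult')
    finally show "f (chart_inv c z0) \<le> f (chart_inv c z) + ennreal (\<kappa>1 * sqrt (G c z0 (z - z0) (z - z0)))"
      using c by (simp add: z0_def add_left_mono mult_left_mono)
  qed (use R e \<kappa>12 in blast)+
  define p where "p = chart_inv c z'"
  have z'c: "z' \<in> cball z0 R" using z' by simp
  have z'r: "z' \<in> chart_ran c" using z'c R by auto
  have p: "p \<in> chart_dom c" "coord c p = z'" using c z'r by (auto simp: p_def)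
  obtain \<zeta> where \<zeta>: "\<zeta> \<in> riem_proximal_subdiff \<A> G (\<lambda>q. enn2ereal (f q)) p" "tangent_norm \<A> G p \<zeta> \<le> (\<kappa>2 + e) * (1 + \<eta>)"
  proof (rule proximal_subgradient_from_chart[where g="\<lambda>q. enn2ereal (f q)" and \<sigma>=\<sigma> and r="R - dist z0 z'"
        and l=l and L="(\<kappa>2 + e) * (1 + \<eta>)", OF c(1) p(1)])
    show "enn2ereal (f p) < \<infinity>" using z'(2) by (cases "f p") (auto simp: p_def)
    show "R - dist z0 z' > 0" using z' by simp
    show "0 \<le> (\<kappa>2 + e) * (1 + \<eta>)" using \<kappa>12 e \<eta> by simp
    show "l u \<le> (\<kappa>2 + e) * (1 + \<eta>) * metric_norm c (coord c p) u" for u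
    proof -
      have "l u \<le> (\<kappa>2 + e) * metric_norm c z0 u" using l by (simp add: metric_norm_def)
      also have "\<dots> \<le> (\<kappa>2 + e) * ((1 + \<eta>) * metric_norm c z' u)"
        using cmp'[OF z'c] \<kappa>12 e by (intro mult_left_mono) auto
      finally show ?thesis by (simp add: p mult.assoc)
    qed
    fix z assume z: "z \<in> ball (coord c p) (R - dist z0 z')"
    then have "z \<in> cball z0 R" using dist_triangle[of z0 z z'] by (simp add: p)
    then show "enn2ereal (f p) + ereal (l (z - coord c p) - \<sigma> * (norm (z - coord c p))\<^sup>2) \<le> enn2ereal (f (chart_inv c z))"
      using ineq by (simp add: p p_def[symmetric])
  qed (use \<sigma> in blast)+
  have "p \<in> S"
  proof -
    have "z' \<in> coord c ` (S \<inter> chart_dom c)" using r(2) R(2) z' by (force simp: subset_iff)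
    then obtain s where "s \<in> S" "s \<in> chart_dom c" "z' = coord c s" by auto
    then show ?thesis using c by (simp add: p_def)
  qed
  then show thesis using \<zeta> e\<delta> by (intro that[of p \<zeta>]) auto
qed

text \<open>If the bound fails, there is room between the quotient and the minimum of the distances:
  \<open>b\<close> confines the Ekeland point, and the larger \<open>d\<close> leaves a
  neighbourhood of it in which a subgradient can be sought without leaving \<open>V\<close> or
  meeting a zero of \<open>f\<close>.\<close>

lemma decrease_principle:
  fixes f :: "'m \<Rightarrow> ennreal"
  assumes complete: "riem_complete \<A> G" and lsc: "lower_semicont f" and \<delta>: "\<delta> > 0"
    and decrease: "\<And>x \<zeta>. x \<in> V \<Longrightarrow> f x > 0 \<Longrightarrow> \<zeta> \<in> riem_proximal_subdiff \<A> G (\<lambda>y. enn2ereal (f y)) x \<Longrightarrow>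
        tangent_norm \<A> G x \<zeta> \<ge> \<delta>"
  shows "min (riem_dist_set \<A> G x (- V)) (min (riem_dist_set \<A> G x (- U)) (riem_dist_set \<A> G x {x \<in> U. f x = 0}))
    \<le> f x / ennreal \<delta>"
proof (rule ccontr)
  define D where "D = min (riem_dist_set \<A> G x (- V)) (min (riem_dist_set \<A> G x (- U)) (riem_dist_set \<A> G x {x \<in> U. f x = 0}))"
  assume "\<not> ?thesis"
  then have D: "f x / ennreal \<delta> < D" by (simp add: D_def not_le)
  \<comment> \<open>A point closer to \<open>x\<close> than \<open>D\<close> avoids all three sets;
    avoiding the third while lying in \<open>U\<close> means that \<open>f\<close> does not vanish
    there.\<close>
  have far: "q \<in> V \<and> q \<in> U \<and> f q \<noteq> 0" if q: "riem_dist \<A> G x q < D" for q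
  proof -
    have "q \<notin> T" if "riem_dist_set \<A> G x T \<ge> D" for T
    proof
      assume "q \<in> T"
      then have "riem_dist_set \<A> G x T \<le> riem_dist \<A> G x q" unfolding riem_dist_set_def by (rule INF_lower)
      then show False using that q by (meson leD order_trans)
    qed
    moreover have "D \<le> riem_dist_set \<A> G x (- V)" "D \<le> riem_dist_set \<A> G x (- U)" "D \<le> riem_dist_set \<A> G x {x \<in> U. f x = 0}"
      by (auto simp: D_def intro: min.coboundedI1 min.coboundedI2)
    ultimately show ?thesis by blast
  qed
  have "f x \<noteq> \<infinity>" using D \<delta> by (auto simp: ennreal_top_divide)
  then obtain a where a: "f x = ennreal a" "a \<ge> 0" by (cases "f x") auto
  have fa: "f x / ennreal \<delta> = ennreal (a / \<delta>)" using a \<delta> by (simp add: divide_ennreal)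
  obtain b' where "f x / ennreal \<delta> < b'" "b' < D" using dense[OF D] by blast
  then obtain b where b: "a / \<delta> < b" "ennreal b < D" "b > 0"
  proof (cases b')
    case (real t)
    have "ennreal (a / \<delta>) < ennreal t" using \<open>f x / ennreal \<delta> < b'\<close> by (simp only: fa real)
    moreover have "0 \<le> a / \<delta>" using a \<delta> by simp
    ultimately have "a / \<delta> < t" by (simp only: ennreal_less_iff)
    moreover from this \<open>0 \<le> a / \<delta>\<close> have "0 < t" by (rule le_less_trans[rotated])
    ultimately show thesis using that[of t] \<open>b' < D\<close> by (simp only: real)
  qed auto
  obtain d' where "ennreal b < d'" "d' < D" using dense[OF b(2)] by blast
  then obtain d where d: "b < d" "ennreal d < D"
  proof (cases d')
    case (real t)
    then show thesis using that[of t] \<open>ennreal b < d'\<close> \<open>d' < D\<close> b by (auto simp: ennreal_less_iff)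
  qed auto
  \<comment> \<open>\<open>a / b\<close> confines the Ekeland point to distance \<open>b\<close> and
    is below \<delta> by the choice of \<open>b\<close>; \<open>\<delta> / 2\<close> keeps \<kappa>
    positive when \<open>a = 0\<close>.\<close>
  define \<kappa> where "\<kappa> = max (a / b) (\<delta> / 2)"
  have \<kappa>: "0 < \<kappa>" "\<kappa> < \<delta>" "a \<le> \<kappa> * b"
  proof -
    show "0 < \<kappa>" using \<delta> by (simp add: \<kappa>_def)
    show "\<kappa> < \<delta>" using b \<delta> by (simp add: \<kappa>_def field_simps)
    have "(a / b) * b \<le> \<kappa> * b" using b by (intro mult_right_mono) (auto simp: \<kappa>_def)
    then show "a \<le> \<kappa> * b" using b by simp
  qed
  obtain y where y: "f y + ennreal \<kappa> * riem_dist \<A> G x y \<le> f x" "\<And>z. f y \<le> f z + ennreal \<kappa> * riem_dist \<A> G y z"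
  proof (rule ekeland[of "riem_dist \<A> G" f x \<kappa>])
    show "\<exists>p. (\<lambda>n. riem_dist \<A> G (X n) p) \<longlonglongrightarrow> 0"
      if "\<And>e. e > 0 \<Longrightarrow> \<exists>N. \<forall>m\<ge>N. \<forall>n\<ge>N. riem_dist \<A> G (X m) (X n) < e" for X :: "nat \<Rightarrow> 'm"
      using complete that unfolding riem_complete_def by blast
    show "f p \<le> a" if "X \<longlonglongrightarrow> p" "\<And>n. f (X n) \<le> a" for X :: "nat \<Rightarrow> 'm" and p a
      using Lim_in_closed_set[OF closed_sublevel_of_lower_semicont[OF lsc, of a] _ _ that(1)] that(2) by auto
    show "f x < \<infinity>" using a by simp
  qed (use riem_dist_refl riem_dist_sym riem_dist_triangle tendsto_of_riem_dist \<kappa> in blast)+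
  have dist_y: "riem_dist \<A> G x y \<le> ennreal b"
  proof -
    have "ennreal \<kappa> * riem_dist \<A> G x y \<le> f y + ennreal \<kappa> * riem_dist \<A> G x y" by (rule add_increasing) auto
    also have "\<dots> \<le> ennreal (\<kappa> * b)" using y(1) \<kappa> by (auto simp: a intro: order_trans ennreal_leI)
    also have "\<dots> = ennreal \<kappa> * ennreal b" using \<kappa> b by (simp add: ennreal_mult)
    finally show ?thesis using \<kappa> by (simp add: ennreal_mult_le_mult_iff)
  qed
  have fy: "f y < \<infinity>"
  proof -
    have "f y \<le> f y + ennreal \<kappa> * riem_dist \<A> G x y" by (rule add_increasing2) auto
    also have "\<dots> \<le> f x" by (rule y)
    finally show ?thesis using a by (auto intro: le_less_trans)
  qed
  obtain S where S: "open S" "y \<in> S" "\<And>q. q \<in> S \<Longrightarrow> riem_dist \<A> G y q < ennreal (d - b)"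
    by (rule riem_dist_less_nbhd[of "d - b" y]) (use d in auto)
  have SD: "riem_dist \<A> G x q < D" if "q \<in> S" for q
  proof -
    have "riem_dist \<A> G x q \<le> riem_dist \<A> G x y + riem_dist \<A> G y q" by (rule riem_dist_triangle)
    also have "\<dots> \<le> ennreal b + ennreal (d - b)" using dist_y S(3)[OF that] by (intro add_mono) auto
    also have "\<dots> = ennreal d" using b d by (simp flip: ennreal_plus)
    also have "\<dots> < D" by (rule d)
    finally show ?thesis .
  qed
  obtain p \<zeta> where p: "p \<in> S" "\<zeta> \<in> riem_proximal_subdiff \<A> G (\<lambda>q. enn2ereal (f q)) p" "tangent_norm \<A> G p \<zeta> < \<delta>"
    by (rule exists_small_proximal_subgradient[OF lsc fy \<kappa>(1,2) y(2) S(1,2)]) blast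
  have "p \<in> V" "f p > 0" using far[OF SD[OF p(1)]] by (auto simp: zero_less_iff_neq_zero)
  then show False using decrease[OF _ _ p(2)] p(3) by simp
qed

end

text \<open>The estimate is made for each parameter \<alpha> separately, by
  \<open>decrease_principle\<close> for the single function
  \<open>\<lambda>x. F x \<alpha>\<close>.\<close>

theorem theorem25:
  fixes \<A> :: "('m::t2_space, 'h::{real_inner, banach}) chart set"
    and G :: "('m, 'h) chart \<Rightarrow> 'h \<Rightarrow> 'h \<Rightarrow>\<^sub>L ('h \<Rightarrow>\<^sub>L real)"
    and U V :: "'m set"
    and A :: "'a set"
    and F :: "'m \<Rightarrow> 'a \<Rightarrow> ennreal"
    and \<phi> :: "'a \<Rightarrow> 'm set"
    and \<delta> :: real
  assumes manifold: "riemannian_manifold \<A> G"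
    and complete: "riem_complete \<A> G"
    and lsc: "\<And>\<alpha>. \<alpha> \<in> A \<Longrightarrow> lower_semicont (\<lambda>x. F x \<alpha>)"
    and proper: "\<And>\<alpha>. \<alpha> \<in> A \<Longrightarrow> \<exists>x. F x \<alpha> \<noteq> \<infinity>"
    and phi: "\<And>\<alpha>. \<alpha> \<in> A \<Longrightarrow> \<phi> \<alpha> = {x \<in> U. F x \<alpha> = 0}"
    and delta: "\<delta> > 0"
    and decrease: "\<And>\<alpha> x \<zeta>. \<alpha> \<in> A \<Longrightarrow> x \<in> V \<Longrightarrow> F x \<alpha> > 0 \<Longrightarrow>
        \<zeta> \<in> riem_proximal_subdiff \<A> G (\<lambda>y. enn2ereal (F y \<alpha>)) x \<Longrightarrow>
        tangent_norm \<A> G x \<zeta> \<ge> \<delta>"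
  shows "\<forall>x. \<forall>\<alpha>\<in>A.
    min (riem_dist_set \<A> G x (- V))
        (min (riem_dist_set \<A> G x (- U)) (riem_dist_set \<A> G x (\<phi> \<alpha>)))
    \<le> F x \<alpha> / ennreal \<delta>"
proof (intro allI ballI)
  interpret riemannian_manifold \<A> G by (rule manifold)
  fix x \<alpha> assume \<alpha>: "\<alpha> \<in> A"
  show "min (riem_dist_set \<A> G x (- V)) (min (riem_dist_set \<A> G x (- U)) (riem_dist_set \<A> G x (\<phi> \<alpha>))) \<le> F x \<alpha> / ennreal \<delta>"
    unfolding phi[OF \<alpha>]
    by (rule decrease_principle[OF complete lsc[OF \<alpha>] delta]) (rule decrease[OF \<alpha>])
qed

end
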